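(* There exists a sequence of total Boolean functions $f_j$ with $\mathrm{UC}_1(f_j)\to\infty$ such that $Q(f_j)=\widetilde{\Omega}(\mathrm{UC}_1(f_j)^2)$, i.e. there is a constant $c$ with $Q(f_j)\geq \mathrm{UC}_1(f_j)^2/\bigl(c\,\log^{c}\mathrm{UC}_1(f_j)\bigr)$ for all sufficiently large $j$.
   Context: For $f:\{0,1\}^n\to\{0,1\}$, $Q(f)$ is the bounded-error quantum query complexity (minimum worst-case number of oracle queries of a quantum algorithm outputting $f(x)$ with probability at least $2/3$ on every input). A $1$-certificate for an input $x$ with $f(x)=1$ is a partial assignment consistent with $x$ such that every input consistent with it has $f$-value 1. The unambiguous $1$-certificate complexity $\mathrm{UC}_1(f)$ is the minimum $w$ such that $f$ can be written as a DNF in which every term has at most $w$ literals and at most one term evaluates to 1 on any input (equivalently, the 1-inputs are partitioned into subcubes each fixing at most $w$ variables, each contained in $f^{-1}(1)$). *)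

theory Defs
  imports Complex_Main "Jordan_Normal_Form.Schur_Decomposition"
begin

text \<open>An element of \<open>{0,1}^n\<close> is a Boolean list of length \<open>n\<close>. A total Boolean function on \<open>{0,1}^n\<close>
  is given by \<open>n\<close> and some \<open>f :: bool list \<Rightarrow> bool\<close>; the values of \<open>f\<close> at lists of other lengths are
  never used.\<close>

definition cube :: "nat \<Rightarrow> bool list set" where
  "cube n = {x. length x = n}"

section \<open>Unambiguous 1-certificate complexity\<close>

text \<open>A term is a partial assignment of the variables \<open>0, \<dots>, n - 1\<close>; its literals correspond to the
  elements of its domain.\<close>

definition terms :: "nat \<Rightarrow> (nat \<Rightarrow> bool option) set" where
  "terms n = {t. dom t \<subseteq> {..<n}}"

definition width :: "(nat \<Rightarrow> bool option) \<Rightarrow> nat" where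
  "width t = card (dom t)"

definition consistent :: "(nat \<Rightarrow> bool option) \<Rightarrow> bool list \<Rightarrow> bool" where
  "consistent t x \<longleftrightarrow> (\<forall>i\<in>dom t. t i = Some (x ! i))"

definition unambiguous_dnf ::
  "nat \<Rightarrow> (bool list \<Rightarrow> bool) \<Rightarrow> (nat \<Rightarrow> bool option) set \<Rightarrow> bool" where
  "unambiguous_dnf n f D \<longleftrightarrow>
     D \<subseteq> terms n \<and>
     (\<forall>x\<in>cube n. f x \<longleftrightarrow> (\<exists>t\<in>D. consistent t x)) \<and>
     (\<forall>x\<in>cube n. \<forall>s\<in>D. \<forall>t\<in>D. consistent s x \<longrightarrow> consistent t x \<longrightarrow> s = t)"

definition UC1 :: "nat \<Rightarrow> (bool list \<Rightarrow> bool) \<Rightarrow> nat" where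
  "UC1 n f = (LEAST w. \<exists>D. unambiguous_dnf n f D \<and> (\<forall>t\<in>D. width t \<le> w))"

section \<open>Bounded-error quantum query complexity\<close>

definition unitary_mat :: "nat \<Rightarrow> complex mat \<Rightarrow> bool" where
  "unitary_mat d U \<longleftrightarrow> U \<in> carrier_mat d d \<and> mat_adjoint U * U = 1\<^sub>m d"

text \<open>With work space of dimension \<open>m\<close>, the computational basis consists of the vectors
  \<open>|i, b, z\<rangle>\<close> where \<open>i \<le> n\<close> is the query index, \<open>b < 2\<close> the answer bit and \<open>z < m\<close> the work register.
  The vector \<open>|i, b, z\<rangle>\<close> has number \<open>b + 2 * (i + (n + 1) * z)\<close>. The query index \<open>n\<close> is a null
  query, on which the oracle acts as the identity; it keeps the space nontrivial also for \<open>n = 0\<close>.\<close>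

definition space_dim :: "nat \<Rightarrow> nat \<Rightarrow> nat" where
  "space_dim n m = 2 * (n + 1) * m"

definition query_index :: "nat \<Rightarrow> nat \<Rightarrow> nat" where
  "query_index n k = (k div 2) mod (n + 1)"

definition flip_answer :: "nat \<Rightarrow> nat" where
  "flip_answer k = (if even k then k + 1 else k - 1)"

text \<open>The action \<open>|i, b, z\<rangle> \<mapsto> |i, b \<oplus> x\<^sub>i, z\<rangle>\<close> of the oracle on basis vectors.\<close>

definition oracle_perm :: "nat \<Rightarrow> bool list \<Rightarrow> nat \<Rightarrow> nat" where
  "oracle_perm n x k =
     (if query_index n k < n \<and> x ! query_index n k then flip_answer k else k)"

definition oracle_mat :: "nat \<Rightarrow> nat \<Rightarrow> bool list \<Rightarrow> complex mat" where
  "oracle_mat n m x =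
     mat (space_dim n m) (space_dim n m) (\<lambda>(r, c). if r = oracle_perm n x c then 1 else 0)"

text \<open>The state \<open>U\<^sub>T O\<^sub>x U\<^bsub>T-1\<^esub> \<dots> U\<^sub>1 O\<^sub>x U\<^sub>0 |0, 0, 0\<rangle>\<close>.\<close>

primrec query_state ::
  "nat \<Rightarrow> nat \<Rightarrow> (nat \<Rightarrow> complex mat) \<Rightarrow> bool list \<Rightarrow> nat \<Rightarrow> complex vec" where
  "query_state n m U x 0 = U 0 *\<^sub>v unit_vec (space_dim n m) 0"
| "query_state n m U x (Suc T) = U (Suc T) *\<^sub>v (oracle_mat n m x *\<^sub>v query_state n m U x T)"

text \<open>The final state is measured in the computational basis, and the algorithm outputs 1 iff the
  outcome lies in \<open>A\<close>.\<close>

definition output_prob ::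
  "nat \<Rightarrow> nat \<Rightarrow> (nat \<Rightarrow> complex mat) \<Rightarrow> nat set \<Rightarrow> nat \<Rightarrow> bool list \<Rightarrow> bool \<Rightarrow> real" where
  "output_prob n m U A T x v =
     (\<Sum>k | k < space_dim n m \<and> (k \<in> A \<longleftrightarrow> v). (cmod (query_state n m U x T $ k))\<^sup>2)"

definition quantum_computable_with :: "nat \<Rightarrow> (bool list \<Rightarrow> bool) \<Rightarrow> nat \<Rightarrow> bool" where
  "quantum_computable_with n f T \<longleftrightarrow>
     (\<exists>m U A. m \<ge> 1 \<and> (\<forall>t\<le>T. unitary_mat (space_dim n m) (U t)) \<and>
        (\<forall>x\<in>cube n. output_prob n m U A T x (f x) \<ge> 2 / 3))"

definition quantum_query_complexity :: "nat \<Rightarrow> (bool list \<Rightarrow> bool) \<Rightarrow> nat" where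
  "quantum_query_complexity n f = (LEAST T. quantum_computable_with n f T)"

end

theory Submission
  imports Defs "HOL-Library.Function_Algebras" "HOL-Library.FuncSet" "HOL-Analysis.L2_Norm"
begin

text \<open>An input consists of \<open>k\<close> groups of \<open>N\<close> blocks, where \<open>k = O(log N)\<close>. A block has \<open>k\<close> rows of \<open>N\<close>
  cells of \<open>2 * s\<close> bits, \<open>s = O(log\<^sup>2 N)\<close>. In an accepted input every block hides a tuple of cells, one
  per row, whose first halves have XOR 0; the XOR of their second halves is the label of the
  block. Moreover there is exactly one choice \<open>L\<close> of one block per group for which the labels have
  XOR 0. Finally, the input contains one advice string for each possible choice, and the advice
  string of this \<open>L\<close> has to name the hidden tuples of all blocks. A certificate reads this string,
  the tuples named by it, and the blocks of \<open>L\<close> completely, which makes it unambiguous. Its size is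
  \<open>N\<close> up to logarithmic factors, and every certificate touches all \<open>k * N\<close> blocks.

  For the lower bound take random blocks with hidden tuples and empty advice strings. By a hybrid
  argument an algorithm must query the advice string of \<open>L\<close> with constant total weight whenever the
  labels cancel on \<open>L\<close> only, and this must hold for all \<open>N\<^sup>k\<close> choices at once. Expand the amplitudes
  into characters of the block contents. A label is hidden from the part of degree less than
  \<open>R = N / 64\<close> in its block, so conditioning on cancellation on \<open>L\<close> does not affect states that know
  fewer than half of the labels on \<open>L\<close>. A product potential that weighs degree \<open>r\<close> in a block with
  \<open>1 + y * r / R\<close>, \<open>y = 4 / N\<close>, grows per query by a factor \<open>1 + O(1 / N\<^sup>2)\<close> only. After at most
  \<open>N\<^sup>2 / 256\<close> queries it is still bounded, hence the average weight of knowing half of the labels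
  on \<open>L\<close> is exponentially small in \<open>k\<close> and the advice strings receive too little query weight.\<close>

text \<open>Cancellation on \<open>L\<close> has probability 2^-s, so conditioning on it could
  amplify by 2^s any part of a state that knows half of the labels on \<open>L\<close>. Such a part
  cannot be bounded after conditioning; only the flow into it can. What a query pushes across the
  threshold still knows too few labels to be affected, and later steps do not increase its norm on
  the conditioned inputs.

  Plain characters are not orthogonal on inputs with hidden tuples. Each is therefore cut off at the
  tuples of which it touches \<open>h\<close> or more rows, where \<open>2 * h < k\<close>. For two
  cut characters some row of the tuple is untouched by both. Toggling bits there repairs a zero sum
  or changes a label unseen, which gives exact orthogonality and hides the labels. The price is an
  error \<open>eps\<close> per query, due to the rare tuples at the cut-off.

  The value y = 4 / N serves two demands. On average over the choices each known label costs a
  factor 1 / (y * N) = 1 / 4, so about 4 * log N labels absorb the factor T^4 lost in the flow and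
  hybrid estimates; and the growth y / R = 256 / N^2 per query stays bounded over N^2 / 256
  queries.\<close>

lemmas pointwise = plus_fun_apply minus_apply times_fun_apply zero_fun_apply one_fun_apply

text \<open>Functions are handled as elements of a ring, with scalars as constant functions, and are
  evaluated at points only on demand.\<close>

declare pointwise [simp del]

section \<open>Functions on a finite set with the counting inner product\<close>

definition ip :: "'w set \<Rightarrow> ('w \<Rightarrow> complex) \<Rightarrow> ('w \<Rightarrow> complex) \<Rightarrow> complex" where
  "ip \<Omega> f g = (\<Sum>\<omega>\<in>\<Omega>. cnj (f \<omega>) * g \<omega>)"

definition sqn :: "'w set \<Rightarrow> ('w \<Rightarrow> complex) \<Rightarrow> real" where
  "sqn \<Omega> f = (\<Sum>\<omega>\<in>\<Omega>. (cmod (f \<omega>))\<^sup>2)"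

lemma ip_self: "ip \<Omega> f f = of_real (sqn \<Omega> f)"
  unfolding ip_def sqn_def of_real_sum
  by (intro sum.cong refl) (metis complex_norm_square mult.commute of_real_power)

lemma sqn_nonneg [simp]: "0 \<le> sqn \<Omega> f"
  unfolding sqn_def by (simp add: sum_nonneg)

lemma sqn_zero [simp]: "sqn \<Omega> 0 = 0"
  unfolding sqn_def by (simp add: pointwise)

lemma ip_add_left: "ip \<Omega> (f + g) h = ip \<Omega> f h + ip \<Omega> g h"
  and ip_add_right: "ip \<Omega> h (f + g) = ip \<Omega> h f + ip \<Omega> h g"
  and ip_diff_left: "ip \<Omega> (f - g) h = ip \<Omega> f h - ip \<Omega> g h"
  and ip_diff_right: "ip \<Omega> h (f - g) = ip \<Omega> h f - ip \<Omega> h g"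
  unfolding ip_def by (simp_all add: pointwise algebra_simps sum.distrib sum_subtractf)

lemma ip_zero_left [simp]: "ip \<Omega> 0 f = 0" and ip_zero_right [simp]: "ip \<Omega> f 0 = 0"
  unfolding ip_def by (simp_all add: pointwise)

lemma ip_commute: "ip \<Omega> f g = cnj (ip \<Omega> g f)"
  unfolding ip_def by (simp add: pointwise mult.commute)

lemma ip_const_right: "ip \<Omega> f ((\<lambda>_. c) * g) = c * ip \<Omega> f g"
  and ip_const_left: "ip \<Omega> ((\<lambda>_. c) * f) g = cnj c * ip \<Omega> f g"
  unfolding ip_def by (simp_all add: pointwise sum_distrib_left algebra_simps)

lemma sum_fun_apply: "(\<Sum>i\<in>I. g i) x = (\<Sum>i\<in>I. g i x :: complex)"
  by (induction I rule: infinite_finite_induct) (simp_all add: pointwise)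

lemma ip_sum_right: "ip \<Omega> f (\<Sum>i\<in>I. g i) = (\<Sum>i\<in>I. ip \<Omega> f (g i))"
  unfolding ip_def sum_fun_apply sum_distrib_left by (rule sum.swap)

lemma ip_sum_left: "ip \<Omega> (\<Sum>i\<in>I. g i) f = (\<Sum>i\<in>I. ip \<Omega> (g i) f)"
  unfolding ip_def sum_fun_apply cnj_sum sum_distrib_right by (rule sum.swap)

lemma sqn_add_orth:
  assumes "ip \<Omega> f g = 0"
  shows "sqn \<Omega> (f + g) = sqn \<Omega> f + sqn \<Omega> g"
proof -
  have "ip \<Omega> g f = 0" using assms ip_commute[of \<Omega> g f] by simp
  then have "complex_of_real (sqn \<Omega> (f + g)) = of_real (sqn \<Omega> f + sqn \<Omega> g)"
    using assms by (simp add: ip_self[symmetric] ip_add_left ip_add_right)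
  then show ?thesis using of_real_eq_iff by blast
qed

lemma cmod_parallelogram: "(cmod (a + b))\<^sup>2 + (cmod (a - b))\<^sup>2 = 2 * (cmod a)\<^sup>2 + 2 * (cmod b)\<^sup>2"
  unfolding cmod_power2 by (simp add: power2_eq_square algebra_simps)

lemma sqn_parallelogram: "sqn \<Omega> (f + g) + sqn \<Omega> (f - g) = 2 * sqn \<Omega> f + 2 * sqn \<Omega> g"
  unfolding sqn_def
  by (simp only: pointwise sum.distrib[symmetric] sum_distrib_left cmod_parallelogram)

lemma sqn_diff_le: "sqn \<Omega> (f - g) \<le> 2 * sqn \<Omega> f + 2 * sqn \<Omega> g"
  using sqn_parallelogram[of \<Omega> f g] sqn_nonneg[of \<Omega> "f + g"] by linarith

lemma sqn_add_le: "sqn \<Omega> (f + g) \<le> 2 * sqn \<Omega> f + 2 * sqn \<Omega> g"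
  using sqn_parallelogram[of \<Omega> f g] sqn_nonneg[of \<Omega> "f - g"] by linarith

lemma sqn_mult_unit: "(\<And>\<omega>. cmod (m \<omega>) = 1) \<Longrightarrow> sqn \<Omega> (m * f) = sqn \<Omega> f"
  unfolding sqn_def by (simp add: pointwise norm_mult)

lemma sqn_const: "sqn \<Omega> ((\<lambda>_. c) * f) = (cmod c)\<^sup>2 * sqn \<Omega> f"
  unfolding sqn_def by (simp add: pointwise norm_mult power_mult_distrib sum_distrib_left)

lemma sqrt_sqn: "sqrt (sqn \<Omega> f) = L2_set (\<lambda>\<omega>. cmod (f \<omega>)) \<Omega>"
  unfolding L2_set_def sqn_def ..

lemma sqrt_sqn_triangle: "sqrt (sqn \<Omega> (f + g)) \<le> sqrt (sqn \<Omega> f) + sqrt (sqn \<Omega> g)"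
  unfolding sqrt_sqn
  by (rule order_trans[OF L2_set_mono L2_set_triangle_ineq]) (auto simp: pointwise intro: norm_triangle_ineq)

lemma sqn_sum_orth:
  assumes "finite I" "\<And>i j. i \<in> I \<Longrightarrow> j \<in> I \<Longrightarrow> i \<noteq> j \<Longrightarrow> ip \<Omega> (f i) (f j) = 0"
  shows "sqn \<Omega> (\<Sum>i\<in>I. f i) = (\<Sum>i\<in>I. sqn \<Omega> (f i))"
  using assms
proof (induction I)
  case (insert i I)
  have "ip \<Omega> (f i) (\<Sum>j\<in>I. f j) = 0"
    unfolding ip_sum_right using insert by (intro sum.neutral) auto
  then have "sqn \<Omega> (f i + (\<Sum>j\<in>I. f j)) = sqn \<Omega> (f i) + (\<Sum>j\<in>I. sqn \<Omega> (f j))"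
    using insert by (subst sqn_add_orth) auto
  with insert.hyps show ?case by (subst (1 2) sum.insert) auto
qed simp

text \<open>Cauchy-Schwarz against the constant 1. Both the hybrid argument and the estimate of the
  leakage lose a factor \<open>T\<close> here.\<close>

lemma sum_squared_le: "(\<Sum>i\<in>I. f i)\<^sup>2 \<le> (\<Sum>i\<in>I. (f i)\<^sup>2) * real (card I)"
proof -
  have "\<bar>\<Sum>i\<in>I. f i\<bar> \<le> (\<Sum>i\<in>I. \<bar>f i\<bar> * \<bar>1\<bar>)"
    using sum_abs[of f I] by simp
  also have "\<dots> \<le> L2_set f I * L2_set (\<lambda>_. 1) I"
    by (rule L2_set_mult_ineq)
  finally have "\<bar>\<Sum>i\<in>I. f i\<bar>\<^sup>2 \<le> (L2_set f I * L2_set (\<lambda>_. 1) I)\<^sup>2"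
    by (intro power_mono) auto
  then show ?thesis by (simp add: L2_set_def power_mult_distrib sum_nonneg)
qed

definition lin :: "(('w \<Rightarrow> complex) \<Rightarrow> ('w \<Rightarrow> complex)) \<Rightarrow> bool" where
  "lin Q \<longleftrightarrow> (\<forall>f g. Q (f + g) = Q f + Q g) \<and> (\<forall>c f. Q ((\<lambda>_. c) * f) = (\<lambda>_. c) * Q f)"

lemma lin_add: "lin Q \<Longrightarrow> Q (f + g) = Q f + Q g"
  and lin_const: "lin Q \<Longrightarrow> Q ((\<lambda>_. c) * f) = (\<lambda>_. c) * Q f"
  unfolding lin_def by auto

lemma lin_diff: assumes "lin Q" shows "Q (f - g) = Q f - Q g"
  using lin_add[OF assms, of "f - g" g] by (simp add: algebra_simps)

lemma lin_zero: assumes "lin Q" shows "Q 0 = 0"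
  using lin_add[OF assms, of 0 0] by (simp add: algebra_simps)

lemma lin_sum: assumes "lin Q" shows "Q (\<Sum>i\<in>I. f i) = (\<Sum>i\<in>I. Q (f i))"
proof (induction I rule: infinite_finite_induct)
  case (insert i I)
  then show ?case by (subst (1 2) sum.insert) (auto simp: lin_add[OF assms])
qed (simp_all only: sum.infinite sum.empty lin_zero[OF assms] simp_thms)

text \<open>Self-adjointness refers to the values on \<Omega>, whereas idempotence is an identity of
  functions on the whole type and thus usable for rewriting.\<close>

definition proj :: "'w set \<Rightarrow> (('w \<Rightarrow> complex) \<Rightarrow> ('w \<Rightarrow> complex)) \<Rightarrow> bool" where
  "proj \<Omega> Q \<longleftrightarrow> lin Q \<and> (\<forall>f. Q (Q f) = Q f) \<and> (\<forall>f g. ip \<Omega> (Q f) g = ip \<Omega> f (Q g))"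

lemma proj_lin: "proj \<Omega> Q \<Longrightarrow> lin Q"
  and proj_idem: "proj \<Omega> Q \<Longrightarrow> Q (Q f) = Q f"
  and proj_self_adjoint: "proj \<Omega> Q \<Longrightarrow> ip \<Omega> (Q f) g = ip \<Omega> f (Q g)"
  unfolding proj_def by auto

lemma proj_orth: assumes "proj \<Omega> Q" shows "ip \<Omega> (Q f) (g - Q g) = 0"
  by (simp add: proj_self_adjoint[OF assms] lin_diff[OF proj_lin[OF assms]] proj_idem[OF assms])

lemma sqn_proj_split: assumes "proj \<Omega> Q" shows "sqn \<Omega> f = sqn \<Omega> (Q f) + sqn \<Omega> (f - Q f)"
  using sqn_add_orth[OF proj_orth[OF assms, of f f]] by simp

lemma sqn_proj_le: "proj \<Omega> Q \<Longrightarrow> sqn \<Omega> (Q f) \<le> sqn \<Omega> f"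
  and sqn_coproj_le: "proj \<Omega> Q \<Longrightarrow> sqn \<Omega> (f - Q f) \<le> sqn \<Omega> f"
  using sqn_proj_split[of \<Omega> Q f] sqn_nonneg[of \<Omega> "Q f"] sqn_nonneg[of \<Omega> "f - Q f"] by linarith+

section \<open>Systems of blocks with hidden labels\<close>

text \<open>\<open>Q j r\<close> stands for the projection to the functions that have degree at most \<open>r\<close> in block \<open>j\<close>,
  \<open>sg e\<close> for the sign of the input bit \<open>e\<close>, and \<open>M j \<eta>\<close> for the character \<open>\<eta>\<close> of the label of block \<open>j\<close>.\<close>

locale block_system =
  fixes \<Omega> :: "'w set" and J :: "'j set"
    and Q :: "'j \<Rightarrow> nat \<Rightarrow> ('w \<Rightarrow> complex) \<Rightarrow> 'w \<Rightarrow> complex"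
    and sg :: "'e \<Rightarrow> 'w \<Rightarrow> complex" and blk :: "'e \<Rightarrow> 'j"
    and M :: "'j \<Rightarrow> nat set \<Rightarrow> 'w \<Rightarrow> complex"
    and R s :: nat and eps y :: real
  assumes finite_Omega: "finite \<Omega>"
    and R_pos: "0 < R" and eps_nonneg: "0 \<le> eps" and eps_le: "eps \<le> 1" and y_pos: "0 < y"
    and proj_Q: "j \<in> J \<Longrightarrow> proj \<Omega> (Q j r)"
    and Q_nest_up: "j \<in> J \<Longrightarrow> r \<le> r' \<Longrightarrow> Q j r' (Q j r f) = Q j r f"
    and Q_nest_down: "j \<in> J \<Longrightarrow> r \<le> r' \<Longrightarrow> Q j r (Q j r' f) = Q j r f"
    and Q_commute_distinct:
      "j \<in> J \<Longrightarrow> j' \<in> J \<Longrightarrow> j \<noteq> j' \<Longrightarrow> Q j r (Q j' r' f) = Q j' r' (Q j r f)"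
    and sg_cases: "sg e \<omega> = 1 \<or> sg e \<omega> = -1"
    and Q_sg_commute: "j \<in> J \<Longrightarrow> blk e \<in> J \<Longrightarrow> blk e \<noteq> j \<Longrightarrow> Q j r (sg e * f) = sg e * Q j r f"
    and Q_step: "blk e \<in> J \<Longrightarrow> Suc r < R \<Longrightarrow>
      sqn \<Omega> (sg e * Q (blk e) r f - Q (blk e) (Suc r) (sg e * Q (blk e) r f)) \<le> eps\<^sup>2 * sqn \<Omega> (Q (blk e) r f)"
    and Q_one: "j \<in> J \<Longrightarrow> Q j r 1 = 1"
    and M_empty: "M j {} = 1"
    and Q_M_commute: "j \<in> J \<Longrightarrow> j' \<in> J \<Longrightarrow> j \<noteq> j' \<Longrightarrow> Q j r (M j' \<eta> * f) = M j' \<eta> * Q j r f"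
    and label_hidden: "j \<in> J \<Longrightarrow> \<eta> \<subseteq> {..<s} \<Longrightarrow> \<eta> \<noteq> {} \<Longrightarrow>
      Q j (R - 1) (M j \<eta> * Q j (R - 1) f) = 0"
begin

definition top_grade :: nat where
  "top_grade = R - 1"

lemma lin_Q: "j \<in> J \<Longrightarrow> lin (Q j r)"
  using proj_Q proj_lin by blast

lemma Q_diff: "j \<in> J \<Longrightarrow> Q j r (f - g) = Q j r f - Q j r g"
  and Q_add: "j \<in> J \<Longrightarrow> Q j r (f + g) = Q j r f + Q j r g"
  and Q_zero: "j \<in> J \<Longrightarrow> Q j r 0 = 0"
  and Q_const: "j \<in> J \<Longrightarrow> Q j r ((\<lambda>_. c) * f) = (\<lambda>_. c) * Q j r f"
  and Q_idem: "j \<in> J \<Longrightarrow> Q j r (Q j r f) = Q j r f"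
  using lin_Q[of j r] by (simp_all only: lin_diff lin_add lin_zero lin_const proj_idem[OF proj_Q])

lemma Q_commute: "j \<in> J \<Longrightarrow> j' \<in> J \<Longrightarrow> Q j r (Q j' r' f) = Q j' r' (Q j r f)"
  by (cases "j = j'"; cases "r \<le> r'")
    (auto simp: Q_nest_up Q_nest_down intro: Q_commute_distinct)

lemma sg_norm: "cmod (sg e \<omega>) = 1"
  using sg_cases[of e \<omega>] by auto

lemma sqn_sg: "sqn \<Omega> (sg e * f) = sqn \<Omega> f"
  using sqn_mult_unit[of "sg e"] sg_norm by blast

section \<open>Growth of the potential under one query\<close>

definition rate :: real where
  "rate = 1 + y / R + eps * (1 + 2 * y)"

definition inc :: real where
  "inc = y / R"

lemma inc_nonneg: "0 \<le> inc"
  unfolding inc_def using y_pos by simp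

lemma rate_ge_1: "1 \<le> rate"
  unfolding rate_def using R_pos eps_nonneg y_pos by simp

text \<open>A query raises the degree by at most one up to error \<open>eps\<close>, so the tail
  beyond \<open>r + 1\<close> after it is essentially the tail beyond \<open>r\<close> before it.
  Shifting the sum over \<open>r\<close> leaves one new term, bounded by the whole norm; it causes
  the summand \<open>y / R\<close> of \<open>rate\<close>.\<close>

lemma one_block_growth:
  assumes "blk e = j" "j \<in> J"
  shows "sqn \<Omega> (sg e * f) + inc * (\<Sum>r<R. sqn \<Omega> (sg e * f - Q j r (sg e * f)))
    \<le> rate * (sqn \<Omega> f + inc * (\<Sum>r<R. sqn \<Omega> (f - Q j r f)))"
proof -
  obtain R' where R': "R = Suc R'" using R_pos gr0_implies_Suc by blast
  define G where "G r = sqn \<Omega> (f - Q j r f)" for r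
  define n where "n = sqn \<Omega> f"
  have n0: "0 \<le> n" and G0: "\<And>r. 0 \<le> G r" by (simp_all add: n_def G_def)
  have step: "sqn \<Omega> (sg e * f - Q j (Suc r) (sg e * f)) \<le> (1 + eps) * G r + 2 * eps * n"
    if "r < R'" for r
  proof -
    \<comment> \<open>The tail of \<open>a\<close>, the part above degree \<open>r\<close>, is at
      most its norm; the tail of \<open>b\<close>, the part of degree at most \<open>r\<close>, is
      controlled by \<open>Q_step\<close>.\<close>
    define a where "a = sg e * (f - Q j r f)"
    define b where "b = sg e * Q j r f"
    define u where "u = sqrt (sqn \<Omega> (a - Q j (Suc r) a))"
    define v where "v = sqrt (sqn \<Omega> (b - Q j (Suc r) b))"
    have ab: "sg e * f = a + b" unfolding a_def b_def by (simp add: algebra_simps)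
    have "sg e * f - Q j (Suc r) (sg e * f) = (a - Q j (Suc r) a) + (b - Q j (Suc r) b)"
      unfolding ab Q_add[OF assms(2)] by (simp only: algebra_simps)
    then have "sqrt (sqn \<Omega> (sg e * f - Q j (Suc r) (sg e * f))) \<le> u + v"
      unfolding u_def v_def using sqrt_sqn_triangle by metis
    then have "(sqrt (sqn \<Omega> (sg e * f - Q j (Suc r) (sg e * f))))\<^sup>2 \<le> (u + v)\<^sup>2"
      by (intro power_mono) auto
    then have 1: "sqn \<Omega> (sg e * f - Q j (Suc r) (sg e * f)) \<le> u\<^sup>2 + 2 * u * v + v\<^sup>2"
      by (simp add: power2_sum)
    have "u\<^sup>2 \<le> sqn \<Omega> a" unfolding u_def using sqn_coproj_le[OF proj_Q[OF assms(2)]] by simp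
    then have u: "u\<^sup>2 \<le> G r" unfolding a_def G_def sqn_sg .
    have "v\<^sup>2 \<le> eps\<^sup>2 * sqn \<Omega> (Q j r f)"
      unfolding v_def b_def using Q_step[of e r f] assms that R' by simp
    also have "\<dots> \<le> eps\<^sup>2 * n"
      unfolding n_def using sqn_proj_le[OF proj_Q[OF assms(2)]] by (intro mult_left_mono) auto
    finally have v2: "v\<^sup>2 \<le> eps\<^sup>2 * n" .
    then have "v \<le> sqrt (eps\<^sup>2 * n)" using real_le_rsqrt by blast
    then have "v \<le> eps * sqrt n" using eps_nonneg by (simp add: real_sqrt_mult)
    moreover have "0 \<le> u" by (simp add: u_def)
    ultimately have "2 * u * v \<le> eps * (2 * u * sqrt n)"
      using mult_left_mono[of v "eps * sqrt n" "2 * u"] by (simp add: algebra_simps)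
    also have "\<dots> \<le> eps * (u\<^sup>2 + n)"
      using sum_squares_bound[of u "sqrt n"] n0 eps_nonneg by (intro mult_left_mono) auto
    also have "\<dots> \<le> eps * (G r + n)" using u eps_nonneg by (intro mult_left_mono) auto
    finally have 2: "2 * u * v \<le> eps * G r + eps * n" by (simp add: algebra_simps)
    have "eps\<^sup>2 * n \<le> eps * n"
      using eps_le eps_nonneg n0 by (intro mult_right_mono) (auto simp: power2_eq_square mult_left_le)
    with 1 2 u v2 show ?thesis by (simp add: algebra_simps)
  qed
  have "(\<Sum>r<R. sqn \<Omega> (sg e * f - Q j r (sg e * f)))
      = sqn \<Omega> (sg e * f - Q j 0 (sg e * f)) + (\<Sum>r<R'. sqn \<Omega> (sg e * f - Q j (Suc r) (sg e * f)))"
    unfolding R' by (rule sum.lessThan_Suc_shift)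
  also have "\<dots> \<le> n + (\<Sum>r<R'. (1 + eps) * G r + 2 * eps * n)"
    using sqn_coproj_le[OF proj_Q[OF assms(2)], of "sg e * f" 0] step
    by (intro add_mono sum_mono) (auto simp: n_def sqn_sg)
  also have "\<dots> = n + (1 + eps) * (\<Sum>r<R'. G r) + R' * (2 * eps * n)"
    by (simp add: sum.distrib sum_distrib_left)
  also have "\<dots> \<le> n + (1 + eps) * (\<Sum>r<R. G r) + R * (2 * eps * n)"
    using G0 eps_nonneg n0 unfolding R' by (intro add_mono mult_left_mono mult_right_mono) auto
  finally have "y / R * (\<Sum>r<R. sqn \<Omega> (sg e * f - Q j r (sg e * f)))
      \<le> y / R * (n + (1 + eps) * (\<Sum>r<R. G r) + R * (2 * eps * n))"
    using y_pos by (intro mult_left_mono) auto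
  also have "\<dots> = (y / R + 2 * eps * y) * n + (1 + eps) * (y / R * (\<Sum>r<R. G r))"
    using R_pos by (simp add: field_simps)
  finally have "sqn \<Omega> (sg e * f) + y / R * (\<Sum>r<R. sqn \<Omega> (sg e * f - Q j r (sg e * f)))
     \<le> (1 + y / R + 2 * eps * y) * n + (1 + eps) * (y / R * (\<Sum>r<R. G r))"
    by (simp only: sqn_sg n_def[symmetric] distrib_right)
  also have "\<dots> \<le> rate * n + rate * (y / R * (\<Sum>r<R. G r))"
    using eps_nonneg y_pos n0 G0 unfolding rate_def
    by (intro add_mono mult_right_mono mult_nonneg_nonneg sum_nonneg) (auto simp: algebra_simps)
  finally show ?thesis unfolding inc_def by (simp add: n_def G_def algebra_simps)
qed

text \<open>The quadratic form of the operator \<open>\<Prod>\<^sub>j (1 + y * grade\<^sub>j / R)\<close>, where the grade of block \<open>j\<close>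
  is \<open>\<Sum>r<R. (1 - Q j r)\<close>. One query changes the grade of one block by about one, so the form
  grows by a factor of about \<open>1 + y / R\<close> only.\<close>

primrec potential :: "'j list \<Rightarrow> ('w \<Rightarrow> complex) \<Rightarrow> real" where
  "potential [] f = sqn \<Omega> f"
| "potential (j # js) f = potential js f + inc * (\<Sum>r<R. potential js (f - Q j r f))"

lemma potential_nonneg: "0 \<le> potential js f"
  using inc_nonneg by (induction js arbitrary: f) (auto intro!: add_nonneg_nonneg mult_nonneg_nonneg sum_nonneg)

text \<open>The oracle acts on the sum and the difference of the amplitudes of two basis states.
  Together with nonnegativity this law lets \<open>sum_ask_le\<close> follow a quadratic form
  through a query.\<close>

lemma potential_parallelogram:
  assumes "set js \<subseteq> J"
  shows "potential js (f + g) + potential js (f - g) = 2 * potential js f + 2 * potential js g"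
  using assms
proof (induction js arbitrary: f g)
  case Nil
  then show ?case by (simp add: sqn_parallelogram)
next
  case (Cons j js)
  have "potential js (f + g - Q j r (f + g)) + potential js (f - g - Q j r (f - g))
      = 2 * potential js (f - Q j r f) + 2 * potential js (g - Q j r g)" for r
  proof -
    have "f + g - Q j r (f + g) = (f - Q j r f) + (g - Q j r g)"
      and "f - g - Q j r (f - g) = (f - Q j r f) - (g - Q j r g)"
      using Cons.prems by (simp_all only: Q_add Q_diff set_simps insert_subset) (simp_all only: algebra_simps)
    then show ?thesis using Cons by (simp only: set_simps insert_subset)
  qed
  then have "(\<Sum>r<R. potential js (f + g - Q j r (f + g))) + (\<Sum>r<R. potential js (f - g - Q j r (f - g)))
      = 2 * (\<Sum>r<R. potential js (f - Q j r f)) + 2 * (\<Sum>r<R. potential js (g - Q j r g))"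
    by (simp only: sum.distrib[symmetric] sum_distrib_left)
  then have "inc * (\<Sum>r<R. potential js (f + g - Q j r (f + g))) + inc * (\<Sum>r<R. potential js (f - g - Q j r (f - g)))
      = 2 * (inc * (\<Sum>r<R. potential js (f - Q j r f))) + 2 * (inc * (\<Sum>r<R. potential js (g - Q j r g)))"
    by (metis (no_types, lifting) distrib_left mult.left_commute)
  with Cons show ?case by (simp add: algebra_simps)
qed

lemma potential_const:
  "set js \<subseteq> J \<Longrightarrow> potential js ((\<lambda>_. c) * f) = (cmod c)\<^sup>2 * potential js f"
proof (induction js arbitrary: f)
  case Nil
  then show ?case by (simp add: sqn_const)
next
  case (Cons j js)
  have "potential js ((\<lambda>_. c) * f - Q j r ((\<lambda>_. c) * f)) = (cmod c)\<^sup>2 * potential js (f - Q j r f)" for r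
  proof -
    have "(\<lambda>_. c) * f - Q j r ((\<lambda>_. c) * f) = (\<lambda>_. c) * (f - Q j r f)"
      using Cons.prems by (subst Q_const) (auto simp: algebra_simps)
    with Cons show ?thesis by simp
  qed
  with Cons show ?case by (simp add: algebra_simps sum_distrib_left)
qed

lemma potential_one: "set js \<subseteq> J \<Longrightarrow> potential js ((\<lambda>_. c) * 1) = (cmod c)\<^sup>2 * card \<Omega>"
proof -
  have zero: "potential js 0 = 0" if "set js \<subseteq> J" for js
    using potential_const[OF that, of 0 0] by simp
  have "potential js 1 = card \<Omega>" if "set js \<subseteq> J"
    using that
  proof (induction js)
    case Nil
    then show ?case by (simp add: sqn_def pointwise)
  next
    case (Cons j js)
    then show ?case by (simp add: Q_one zero)
  qed
  then show "set js \<subseteq> J \<Longrightarrow> ?thesis" by (simp only: potential_const)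
qed

lemma potential_coproj_le:
  assumes "set js \<subseteq> J" "j \<in> J"
  shows "potential js (f - Q j r f) \<le> potential js f"
  using assms(1)
proof (induction js arbitrary: f)
  case Nil
  then show ?case using sqn_coproj_le[OF proj_Q[OF assms(2)]] by simp
next
  case (Cons i js)
  have "potential js ((f - Q j r f) - Q i r' (f - Q j r f)) \<le> potential js (f - Q i r' f)" for r'
  proof -
    have "(f - Q j r f) - Q i r' (f - Q j r f) = (f - Q i r' f) - Q j r (f - Q i r' f)"
      using Cons.prems assms(2) Q_commute[of i j r' r f]
      by (simp only: Q_diff set_simps insert_subset) (simp only: algebra_simps)
    then show ?thesis using Cons by (simp only: set_simps insert_subset)
  qed
  then have "inc * (\<Sum>r'<R. potential js ((f - Q j r f) - Q i r' (f - Q j r f)))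
      \<le> inc * (\<Sum>r'<R. potential js (f - Q i r' f))"
    using inc_nonneg by (intro mult_left_mono sum_mono) auto
  with Cons show ?case by (auto intro: add_mono)
qed

text \<open>The ranges of \<open>Q j r\<close> grow with \<open>r\<close>, so the part that knows
  the label of \<open>j\<close> lies beyond every degree \<open>r < R\<close>: its grade is the full
  \<open>R\<close>.\<close>

lemma potential_coproj_last_le:
  assumes "set js \<subseteq> J" "j \<in> J" "r < R"
  shows "potential js (f - Q j top_grade f) \<le> potential js (f - Q j r f)"
proof -
  have "r \<le> top_grade" using assms unfolding top_grade_def by simp
  then have "f - Q j top_grade f = (f - Q j r f) - Q j top_grade (f - Q j r f)"
    using assms by (simp only: Q_diff) (simp add: Q_nest_up)
  then show ?thesis using potential_coproj_le[OF assms(1,2)] by metis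
qed

text \<open>All projections commute, so the queried block can be moved to the innermost factor,
  where \<open>one_block_growth\<close> applies. The factors of the other blocks commute with the
  sign of the bit.\<close>

lemma potential_growth:
  assumes "set js \<subseteq> J" "distinct js" "blk e \<in> J"
  shows "potential js (sg e * f) \<le> rate * potential js f"
proof -
  let ?j = "blk e"
  have key: "potential js (sg e * f) + inc * (\<Sum>r<R. potential js (sg e * f - Q ?j r (sg e * f)))
      \<le> rate * (potential js f + inc * (\<Sum>r<R. potential js (f - Q ?j r f)))"
    if "set js \<subseteq> J" "?j \<notin> set js" for js f
    using that
  proof (induction js arbitrary: f)
    case Nil
    show ?case unfolding potential.simps by (rule one_block_growth[OF refl assms(3)])
  next
    case (Cons i js)
    define X where "X f = potential js f + inc * (\<Sum>r<R. potential js (f - Q ?j r f))" for f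
    have IH: "X (sg e * f) \<le> rate * X f" for f
      using Cons unfolding X_def by simp
    have X: "potential (i # js) f + inc * (\<Sum>r<R. potential (i # js) (f - Q ?j r f))
        = X f + inc * (\<Sum>r'<R. X (f - Q i r' f))" for f
    proof -
      have "(f - Q ?j r f) - Q i r' (f - Q ?j r f) = (f - Q i r' f) - Q ?j r (f - Q i r' f)" for r r'
        using Cons.prems assms(3) Q_commute[of i ?j r' r f]
        by (simp only: Q_diff set_simps insert_subset) (simp only: algebra_simps)
      then have "(\<Sum>r<R. \<Sum>r'<R. potential js ((f - Q ?j r f) - Q i r' (f - Q ?j r f)))
         = (\<Sum>r'<R. \<Sum>r<R. potential js ((f - Q i r' f) - Q ?j r (f - Q i r' f)))"
        by (subst sum.swap) (simp only:)
      then show ?thesis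
        unfolding X_def potential.simps sum.distrib distrib_left sum_distrib_left[symmetric]
        by (simp only: add.assoc add.left_commute)
    qed
    have "sg e * f - Q i r (sg e * f) = sg e * (f - Q i r f)" for r
      using Cons.prems assms(3) by (subst Q_sg_commute) (auto simp: algebra_simps)
    then have "X (sg e * f) + inc * (\<Sum>r'<R. X (sg e * f - Q i r' (sg e * f)))
        \<le> rate * X f + inc * (\<Sum>r'<R. rate * X (f - Q i r' f))"
      using IH inc_nonneg by (auto intro!: add_mono mult_left_mono sum_mono)
    then show ?case unfolding X by (simp add: distrib_left sum_distrib_left mult.left_commute)
  qed
  show ?thesis using assms(1,2)
  proof (induction js arbitrary: f)
    case Nil
    then show ?case using rate_ge_1 by (simp add: sqn_sg mult_right_mono[of 1 rate, simplified])
  next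
    case (Cons j js)
    show ?case
    proof (cases "?j = j")
      case True
      then show ?thesis using key[of js] Cons.prems by auto
    next
      case False
      have "sg e * f - Q j r (sg e * f) = sg e * (f - Q j r f)" for r
        using Cons.prems assms(3) False by (subst Q_sg_commute) (auto simp: algebra_simps)
      then have "potential (j # js) (sg e * f)
          \<le> rate * potential js f + inc * (\<Sum>r<R. rate * potential js (f - Q j r f))"
        using Cons inc_nonneg by (auto intro!: add_mono mult_left_mono sum_mono)
      then show ?thesis by (simp add: distrib_left sum_distrib_left mult.left_commute)
    qed
  qed
qed

end

context block_system
begin

section \<open>Splitting a function by the number of known labels\<close>

abbreviation Qm :: "'j \<Rightarrow> ('w \<Rightarrow> complex) \<Rightarrow> 'w \<Rightarrow> complex" where
  "Qm j \<equiv> Q j top_grade"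

text \<open>\<open>exactly js c\<close> projects to the part of a function for which the label is known, that is,
  which \<open>Qm j\<close> annihilates, for exactly \<open>c\<close> of the blocks \<open>j\<close> in \<open>js\<close>.\<close>

primrec exactly :: "'j list \<Rightarrow> nat \<Rightarrow> ('w \<Rightarrow> complex) \<Rightarrow> 'w \<Rightarrow> complex" where
  "exactly [] c f = (if c = 0 then f else 0)"
| "exactly (j # js) c f =
    exactly js c (Qm j f) + (if c = 0 then 0 else exactly js (c - 1) (f - Qm j f))"

primrec fewer :: "'j list \<Rightarrow> nat \<Rightarrow> ('w \<Rightarrow> complex) \<Rightarrow> 'w \<Rightarrow> complex" where
  "fewer js 0 f = 0"
| "fewer js (Suc c) f = fewer js c f + exactly js c f"

text \<open>The sum, over all selections of \<open>c\<close> entries of \<open>js\<close>, of the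
  squared norm of the part that knows these labels, whatever it knows about the others. Unlike the
  norm of \<open>exactly js c f\<close> it can be summed over choices and compared with the
  potential.\<close>

primrec known :: "'j list \<Rightarrow> nat \<Rightarrow> ('w \<Rightarrow> complex) \<Rightarrow> real" where
  "known [] c f = (if c = 0 then sqn \<Omega> f else 0)"
| "known (j # js) c f = known js c f + (if c = 0 then 0 else known js (c - 1) (f - Qm j f))"

lemma lin_exactly: "set js \<subseteq> J \<Longrightarrow> lin (exactly js c)"
proof (induction js arbitrary: c)
  case Nil
  then show ?case by (simp add: lin_def)
next
  case (Cons j js)
  then have l: "\<And>c. lin (exactly js c)" and j: "j \<in> J" by auto
  have "exactly (j # js) c (f + g) = exactly (j # js) c f + exactly (j # js) c g" for f g
    by (simp add: lin_add[OF l] lin_diff[OF l] Q_add[OF j] algebra_simps)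
  moreover have "exactly (j # js) c ((\<lambda>_. a) * f) = (\<lambda>_. a) * exactly (j # js) c f" for a f
    by (simp add: lin_diff[OF l] lin_const[OF l] Q_const[OF j] distrib_left right_diff_distrib)
  ultimately show ?case unfolding lin_def by blast
qed

lemma exactly_add: "set js \<subseteq> J \<Longrightarrow> exactly js c (f + g) = exactly js c f + exactly js c g"
  and exactly_diff: "set js \<subseteq> J \<Longrightarrow> exactly js c (f - g) = exactly js c f - exactly js c g"
  and exactly_zero: "set js \<subseteq> J \<Longrightarrow> exactly js c 0 = 0"
  using lin_exactly[of js c] lin_add lin_diff lin_zero by blast+

lemma exactly_Q:
  assumes "set js \<subseteq> J" "j \<in> J"
  shows "exactly js c (Q j r f) = Q j r (exactly js c f)"
  using assms(1)
proof (induction js arbitrary: c f)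
  case Nil
  then show ?case using Q_zero[OF assms(2)] by simp
next
  case (Cons i js)
  then have i: "i \<in> J" and js: "set js \<subseteq> J" by auto
  have "Q j r f - Qm i (Q j r f) = Q j r (f - Qm i f)"
    by (simp only: Q_diff[OF assms(2)] Q_commute[OF i assms(2)])
  then show ?case
    using Cons.IH[OF js]
    by (simp add: Q_add[OF assms(2)] Q_zero[OF assms(2)] Q_commute[OF i assms(2)])
qed

lemma exactly_mult:
  assumes "set js \<subseteq> J" "\<And>j r f. j \<in> set js \<Longrightarrow> Q j r (m * f) = m * Q j r f"
  shows "exactly js c (m * f) = m * exactly js c f"
  using assms
proof (induction js arbitrary: c f)
  case (Cons i js)
  have "Qm i (m * f) = m * Qm i f" and IH: "\<And>c f. exactly js c (m * f) = m * exactly js c f"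
    using Cons by auto
  then have "exactly (i # js) c (m * f) = exactly js c (m * Qm i f) +
      (if c = 0 then 0 else exactly js (c - 1) (m * (f - Qm i f)))"
    by (simp add: right_diff_distrib)
  then show ?case unfolding IH by (simp add: distrib_left)
qed simp

lemma exactly_sg:
  "set js \<subseteq> J \<Longrightarrow> blk e \<in> J \<Longrightarrow> blk e \<notin> set js \<Longrightarrow> exactly js c (sg e * f) = sg e * exactly js c f"
  by (rule exactly_mult) (auto intro!: Q_sg_commute)

lemma exactly_self_adjoint:
  "set js \<subseteq> J \<Longrightarrow> ip \<Omega> (exactly js c f) g = ip \<Omega> f (exactly js c g)"
proof (induction js arbitrary: c f g)
  case (Cons j js)
  then have j: "j \<in> J" and js: "set js \<subseteq> J" by auto
  have "ip \<Omega> (h - Qm j h) g = ip \<Omega> h (g - Qm j g)" for h g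
    by (simp add: ip_diff_left ip_diff_right proj_self_adjoint[OF proj_Q[OF j]])
  then show ?case
    using Cons.IH[OF js] proj_self_adjoint[OF proj_Q[OF j]]
    by (simp add: ip_add_left ip_add_right exactly_Q[OF js j] exactly_diff[OF js])
qed simp

lemma Qm_exactly_split:
  assumes "set js \<subseteq> J" "j \<in> J"
  shows "Qm j (exactly (j # js) c f) = exactly js c (Qm j f)"
    and "exactly (j # js) c f - exactly js c (Qm j f) =
      (if c = 0 then 0 else exactly js (c - 1) (f - Qm j f))"
proof -
  have "Qm j (exactly js c' (f - Qm j f)) = 0" for c'
    by (simp add: exactly_Q[OF assms, symmetric] Q_diff[OF assms(2)] Q_idem[OF assms(2)] exactly_zero[OF assms(1)])
  then show 1: "Qm j (exactly (j # js) c f) = exactly js c (Qm j f)"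
    by (simp add: Q_add[OF assms(2)] Q_zero[OF assms(2)] exactly_Q[OF assms, symmetric] Q_idem[OF assms(2)])
  show "exactly (j # js) c f - exactly js c (Qm j f) =
      (if c = 0 then 0 else exactly js (c - 1) (f - Qm j f))"
    by simp
qed

lemma exactly_exactly:
  "set js \<subseteq> J \<Longrightarrow> exactly js c (exactly js c' f) = (if c = c' then exactly js c f else 0)"
proof (induction js arbitrary: c c' f)
  case (Cons j js)
  then have j: "j \<in> J" and js: "set js \<subseteq> J" by auto
  have "exactly (j # js) c (exactly (j # js) c' f) = exactly js c (exactly js c' (Qm j f)) +
      (if c = 0 then 0 else exactly js (c - 1) (if c' = 0 then 0 else exactly js (c' - 1) (f - Qm j f)))"
    unfolding exactly.simps(2)[of j js c] Qm_exactly_split[OF js j] ..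
  then show ?case
    using Cons.IH[OF js] by (auto simp: exactly_zero[OF js])
qed simp

lemma lin_fewer: "set js \<subseteq> J \<Longrightarrow> lin (fewer js c)"
proof (induction c)
  case 0
  then show ?case by (simp add: lin_def)
next
  case (Suc c)
  then have l: "lin (fewer js c)" "lin (exactly js c)" using lin_exactly by auto
  have "fewer js (Suc c) (f + g) = fewer js (Suc c) f + fewer js (Suc c) g" for f g
    by (simp add: lin_add[OF l(1)] lin_add[OF l(2)] algebra_simps)
  moreover have "fewer js (Suc c) ((\<lambda>_. a) * f) = (\<lambda>_. a) * fewer js (Suc c) f" for a f
    by (simp add: lin_const[OF l(1)] lin_const[OF l(2)] distrib_left)
  ultimately show ?case unfolding lin_def by blast
qed

lemma fewer_add: "set js \<subseteq> J \<Longrightarrow> fewer js c (f + g) = fewer js c f + fewer js c g"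
  and fewer_diff: "set js \<subseteq> J \<Longrightarrow> fewer js c (f - g) = fewer js c f - fewer js c g"
  and fewer_zero: "set js \<subseteq> J \<Longrightarrow> fewer js c 0 = 0"
  using lin_fewer[of js c] lin_add lin_diff lin_zero by blast+

lemma fewer_exactly:
  "set js \<subseteq> J \<Longrightarrow> fewer js c (exactly js c' f) = (if c' < c then exactly js c' f else 0)"
  by (induction c) (auto simp: exactly_exactly less_Suc_eq)

lemma fewer_fewer: "set js \<subseteq> J \<Longrightarrow> c \<le> c' \<Longrightarrow> fewer js c' (fewer js c f) = fewer js c f"
  by (induction c) (auto simp: fewer_zero fewer_add fewer_exactly)

lemma fewer_Q: "set js \<subseteq> J \<Longrightarrow> j \<in> J \<Longrightarrow> fewer js c (Q j r f) = Q j r (fewer js c f)"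
  by (induction c) (auto simp: exactly_Q Q_add Q_zero)

lemma fewer_sg:
  "set js \<subseteq> J \<Longrightarrow> blk e \<in> J \<Longrightarrow> blk e \<notin> set js \<Longrightarrow> fewer js c (sg e * f) = sg e * fewer js c f"
  by (induction c) (auto simp: exactly_sg distrib_left)

lemma proj_fewer:
  assumes "set js \<subseteq> J"
  shows "proj \<Omega> (fewer js c)"
proof -
  have "ip \<Omega> (fewer js c f) g = ip \<Omega> f (fewer js c g)" for f g
    by (induction c) (simp_all add: ip_add_left ip_add_right exactly_self_adjoint[OF assms])
  then show ?thesis
    unfolding proj_def using lin_fewer[OF assms] fewer_fewer[OF assms] by auto
qed

lemma fewer_Cons:
  "set js \<subseteq> J \<Longrightarrow> fewer (j # js) (Suc c) f = fewer js (Suc c) (Qm j f) + fewer js c (f - Qm j f)"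
  by (induction c) (auto simp: algebra_simps)

lemma known_nonneg: "0 \<le> known js c f"
  by (induction js arbitrary: c f) auto

lemma known_coproj_le:
  assumes "set js \<subseteq> J" "j \<in> J"
  shows "known js c (f - Q j r f) \<le> known js c f" and "known js c (Q j r f) \<le> known js c f"
proof -
  have "known js c (Q j r f) \<le> known js c f \<and> known js c (f - Q j r f) \<le> known js c f"
    using assms(1)
  proof (induction js arbitrary: c f)
    case Nil
    then show ?case using sqn_coproj_le[OF proj_Q[OF assms(2)]] sqn_proj_le[OF proj_Q[OF assms(2)]] by simp
  next
    case (Cons i js)
    then have i: "i \<in> J" and js: "set js \<subseteq> J" by auto
    have eqs: "(f - Q j r f) - Qm i (f - Q j r f) = (f - Qm i f) - Q j r (f - Qm i f)"
      "Q j r f - Qm i (Q j r f) = Q j r (f - Qm i f)"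
      using i assms(2) by (simp_all only: Q_diff Q_commute[OF i assms(2)]) (simp only: algebra_simps)
    show ?case unfolding known.simps eqs using Cons.IH[OF js] by (simp add: add_mono)
  qed
  then show "known js c (f - Q j r f) \<le> known js c f" and "known js c (Q j r f) \<le> known js c f"
    by auto
qed

lemma known_diff_le:
  assumes "set js \<subseteq> J"
  shows "known js c (f - g) \<le> 2 * known js c f + 2 * known js c g"
  using assms
proof (induction js arbitrary: c f g)
  case Nil
  then show ?case by (simp add: sqn_diff_le)
next
  case (Cons j js)
  then have j: "j \<in> J" and js: "set js \<subseteq> J" by auto
  have eq: "f - g - Qm j (f - g) = (f - Qm j f) - (g - Qm j g)"
    by (simp only: Q_diff[OF j]) (simp only: algebra_simps)
  show ?case
    unfolding known.simps eq
    using Cons.IH[OF js, of c f g] Cons.IH[OF js, of "c - 1" "f - Qm j f" "g - Qm j g"]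
    by (cases "c = 0") simp_all
qed

text \<open>The pieces of \<open>exactly js c f\<close> for different sets of \<open>c\<close>
  blocks are orthogonal, and no longer requiring the remaining labels to be hidden can only enlarge
  each piece.\<close>

lemma sqn_exactly_le_known: "set js \<subseteq> J \<Longrightarrow> sqn \<Omega> (exactly js c f) \<le> known js c f"
proof (induction js arbitrary: c f)
  case (Cons j js)
  then have j: "j \<in> J" and js: "set js \<subseteq> J" by auto
  have "sqn \<Omega> (exactly (j # js) c f) = sqn \<Omega> (exactly js c (Qm j f))
      + sqn \<Omega> (if c = 0 then 0 else exactly js (c - 1) (f - Qm j f))"
    using sqn_proj_split[OF proj_Q[OF j, of top_grade], of "exactly (j # js) c f"]
    unfolding Qm_exactly_split[OF js j] .
  moreover have "sqn \<Omega> (exactly js c (Qm j f)) \<le> sqn \<Omega> (exactly js c f)"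
    unfolding exactly_Q[OF js j] using sqn_proj_le[OF proj_Q[OF j]] by blast
  ultimately show ?case
    using Cons.IH[OF js, of c f] Cons.IH[OF js, of "c - 1" "f - Qm j f"] by auto
qed simp

section \<open>How a query crosses the threshold on the number of known labels\<close>

definition commutator :: "'j list \<Rightarrow> nat \<Rightarrow> 'e \<Rightarrow> ('w \<Rightarrow> complex) \<Rightarrow> 'w \<Rightarrow> complex" where
  "commutator js c e f = sg e * fewer js c f - fewer js c (sg e * f)"

lemma commutator_0: "commutator js 0 e f = 0"
  unfolding commutator_def by simp

lemma commutator_other:
  "set js \<subseteq> J \<Longrightarrow> blk e \<in> J \<Longrightarrow> blk e \<notin> set js \<Longrightarrow> commutator js c e f = 0"
  unfolding commutator_def by (simp add: fewer_sg)

lemma commutator_Q: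
  assumes "set js \<subseteq> J" "blk e \<in> J" "j \<in> J" "blk e \<noteq> j"
  shows "commutator js c e (Q j r f) = Q j r (commutator js c e f)"
proof -
  have sg: "sg e * Q j r g = Q j r (sg e * g)" for g
    using assms by (simp add: Q_sg_commute)
  show ?thesis
    unfolding commutator_def using assms by (simp only: sg fewer_Q Q_diff)
qed

lemma commutator_diff:
  assumes "set js \<subseteq> J"
  shows "commutator js c e (f - g) = commutator js c e f - commutator js c e g"
  unfolding commutator_def
  by (simp add: fewer_diff[OF assms] right_diff_distrib)

lemma commutator_Cons_other:
  assumes "set js \<subseteq> J" "blk e \<in> J" "j \<in> J" "blk e \<noteq> j"
  shows "commutator (j # js) (Suc c) e f =
    commutator js (Suc c) e (Qm j f) + commutator js c e (f - Qm j f)"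
proof -
  have "sg e * f - Qm j (sg e * f) = sg e * (f - Qm j f)"
    using assms by (simp add: Q_sg_commute right_diff_distrib)
  then show ?thesis
    unfolding commutator_def fewer_Cons[OF assms(1)]
    using assms by (simp add: Q_sg_commute distrib_left)
qed

text \<open>A query can change only what is known about its own block, so the threshold is crossed
  only from functions that know exactly \<open>c\<close> of the other labels.\<close>

lemma commutator_Cons_same:
  assumes "set js \<subseteq> J" "blk e = j" "j \<in> J" "j \<notin> set js"
  shows "commutator (j # js) (Suc c) e f = exactly js c (sg e * Qm j f - Qm j (sg e * f))"
proof -
  have sg: "fewer js c' (sg e * g) = sg e * fewer js c' g" "exactly js c' (sg e * g) = sg e * exactly js c' g" for c' g
    using assms by (auto intro: fewer_sg exactly_sg)
  show ?thesis
    unfolding commutator_def fewer_Cons[OF assms(1)] fewer_diff[OF assms(1)] exactly_diff[OF assms(1)]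
    by (simp only: sg fewer.simps distrib_left right_diff_distrib) (simp add: algebra_simps)
qed

text \<open>Where the queried block is met, the commutator is a difference of two vectors that are
  no longer than the part \<open>exactly js c f\<close>. Two terms of weight 2 give the factor
  4.\<close>

lemma sqn_commutator_le:
  assumes "set js \<subseteq> J" "distinct js" "blk e \<in> J"
  shows "sqn \<Omega> (commutator js (Suc c) e f) \<le> 4 * known js c f"
  using assms(1,2)
proof (induction js arbitrary: c f)
  case Nil
  then show ?case using assms(3) known_nonneg[of "[]" c f] by (simp add: commutator_other)
next
  case (Cons j js)
  then have j: "j \<in> J" and js: "set js \<subseteq> J" "distinct js" "j \<notin> set js" by auto
  show ?case
  proof (cases "blk e = j")
    case True
    have sg: "exactly js c (sg e * g) = sg e * exactly js c g" for g
      using js j True by (intro exactly_sg) auto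
    define g where "g = exactly js c f"
    have "commutator (j # js) (Suc c) e f = sg e * Qm j g - Qm j (sg e * g)"
      unfolding commutator_Cons_same[OF js(1) True j js(3)] g_def
      by (simp add: exactly_diff[OF js(1)] sg exactly_Q[OF js(1) j])
    then have "sqn \<Omega> (commutator (j # js) (Suc c) e f) \<le> 2 * sqn \<Omega> (sg e * Qm j g) + 2 * sqn \<Omega> (Qm j (sg e * g))"
      using sqn_diff_le by metis
    also have "\<dots> \<le> 2 * sqn \<Omega> g + 2 * sqn \<Omega> g"
      using sqn_proj_le[OF proj_Q[OF j], of top_grade g] sqn_proj_le[OF proj_Q[OF j], of top_grade "sg e * g"]
      by (simp add: sqn_sg)
    also have "\<dots> \<le> 4 * known js c f"
      using sqn_exactly_le_known[OF js(1)] by (simp add: g_def)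
    also have "\<dots> \<le> 4 * known (j # js) c f"
      using known_nonneg by simp
    finally show ?thesis .
  next
    case False
    let ?K = "commutator (j # js) (Suc c) e f"
    note * = commutator_Cons_other[OF js(1) assms(3) j False]
    note cQ = commutator_Q[OF js(1) assms(3) j False]
    \<comment> \<open>One summand of \<open>commutator_Cons_other\<close> lies in the range of
      \<open>Qm j\<close>, the other in its complement, so their squared norms add.\<close>
    have Q: "Qm j ?K = commutator js (Suc c) e (Qm j f)"
      unfolding * by (simp add: cQ[symmetric] Q_add[OF j] commutator_diff[OF js(1)] Q_diff[OF j] Q_idem[OF j])
    have "sqn \<Omega> ?K = sqn \<Omega> (commutator js (Suc c) e (Qm j f)) + sqn \<Omega> (commutator js c e (f - Qm j f))"
      using sqn_proj_split[OF proj_Q[OF j, of top_grade], of ?K] unfolding Q unfolding * by simp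
    moreover have "sqn \<Omega> (commutator js (Suc c) e (Qm j f)) \<le> 4 * known js c f"
      using Cons.IH[OF js(1,2), of c "Qm j f"] known_coproj_le(2)[OF js(1) j, of c top_grade f] by linarith
    moreover have "sqn \<Omega> (commutator js c e (f - Qm j f)) \<le> (if c = 0 then 0 else 4 * known js (c - 1) (f - Qm j f))"
      using Cons.IH[OF js(1,2), of "c - 1" "f - Qm j f"] by (cases c) (auto simp: commutator_0)
    ultimately show ?thesis by (auto split: if_splits)
  qed
qed

text \<open>Whatever one query moves across the threshold \<open>c\<close> knows at most
  \<open>c\<close> labels at that moment. Hence \<open>sqn_conditioned\<close> applies to it,
  although it need not apply to what becomes of it later.\<close>

lemma fewer_commutator:
  assumes "set js \<subseteq> J" "distinct js" "blk e \<in> J"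
  shows "fewer js (Suc c) (commutator js c e f) = commutator js c e f"
  using assms(1,2)
proof (induction js arbitrary: c f)
  case Nil
  then show ?case using assms(3) by (simp add: commutator_other fewer_zero)
next
  case (Cons j js)
  then have j: "j \<in> J" and js: "set js \<subseteq> J" "distinct js" "j \<notin> set js" by auto
  show ?case
  proof (cases c)
    case 0
    have "fewer (j # js) (Suc 0) 0 = 0" using j js by (intro fewer_zero) auto
    then show ?thesis unfolding 0 commutator_0 .
  next
    case (Suc c')
    show ?thesis
    proof (cases "blk e = j")
      case True
      define D where "D = sg e * Qm j f - Qm j (sg e * f)"
      have K: "commutator (j # js) c e f = exactly js c' D"
        unfolding Suc commutator_Cons_same[OF js(1) True j js(3)] D_def ..
      have "exactly js c' D - Qm j (exactly js c' D) = exactly js c' (D - Qm j D)"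
        by (simp add: exactly_Q[OF js(1) j] exactly_diff[OF js(1)])
      then show ?thesis
        unfolding K fewer_Cons[OF js(1)]
        by (simp only: exactly_Q[OF js(1) j, symmetric] fewer_exactly[OF js(1)]
              exactly_diff[OF js(1), symmetric] Suc)
          (simp add: exactly_diff[OF js(1)])
    next
      case False
      let ?K = "commutator (j # js) (Suc c') e f"
      note * = commutator_Cons_other[OF js(1) assms(3) j False]
      note cQ = commutator_Q[OF js(1) assms(3) j False]
      have Q: "Qm j ?K = commutator js (Suc c') e (Qm j f)"
        unfolding * by (simp add: cQ[symmetric] Q_add[OF j] commutator_diff[OF js(1)] Q_diff[OF j] Q_idem[OF j])
      show ?thesis
        unfolding Suc fewer_Cons[OF js(1)] Q unfolding *
        by (simp add: Cons.IH[OF js(1,2)] del: fewer.simps)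
    qed
  qed
qed

section \<open>Characters of the labels and conditioning on cancellation\<close>

definition labels :: "'j list \<Rightarrow> nat set \<Rightarrow> 'w \<Rightarrow> complex" where
  "labels js \<eta> = prod_list (map (\<lambda>j. M j \<eta>) js)"

lemma labels_simps [simp]: "labels [] \<eta> = 1" "labels (j # js) \<eta> = M j \<eta> * labels js \<eta>"
  unfolding labels_def by simp_all

lemma labels_empty: "labels js {} = 1"
  by (induction js) (simp_all add: M_empty)

lemma Q_labels:
  "set js \<subseteq> J \<Longrightarrow> j \<in> J \<Longrightarrow> j \<notin> set js \<Longrightarrow> Q j r (labels js \<eta> * f) = labels js \<eta> * Q j r f"
proof (induction js arbitrary: f)
  case (Cons i js)
  then show ?case by (simp add: mult.assoc Q_M_commute)
qed simp

text \<open>The \<open>c + c'\<close> known labels cannot cover \<open>js\<close>, so some block is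
  hidden in both functions, and there \<open>label_hidden\<close> annihilates the product. It is
  needed in the induction only when both functions hide the first block. Otherwise
  \<open>c + c'\<close> drops at least as fast as the length, and \<open>M j \<eta>\<close> is
  absorbed into \<open>g\<close>.\<close>

lemma exactly_labels_orth:
  assumes "set js \<subseteq> J" "distinct js" "\<eta> \<subseteq> {..<s}" "\<eta> \<noteq> {}" "c + c' < length js"
  shows "ip \<Omega> (exactly js c f) (labels js \<eta> * exactly js c' g) = 0"
  using assms(1,2,5)
proof (induction js arbitrary: c c' f g)
  case (Cons j js)
  then have j: "j \<in> J" and js: "set js \<subseteq> J" "distinct js" "j \<notin> set js" by auto
  have M: "exactly js c (M j \<eta> * h) = M j \<eta> * exactly js c h" for c h
    using js j by (intro exactly_mult) (auto intro!: Q_M_commute)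
  have IH: "ip \<Omega> (exactly js d f) (M j \<eta> * (labels js \<eta> * exactly js d' g)) = 0"
    if "d + d' < length js" for d d' f g
    using Cons.IH[OF js(1,2) that, of f "M j \<eta> * g"] unfolding M by (simp add: mult.left_commute)
  have A: "ip \<Omega> (exactly js c (Qm j f)) (M j \<eta> * (labels js \<eta> * exactly js c' (Qm j g))) = 0"
  proof -
    have "ip \<Omega> (exactly js c (Qm j f)) (M j \<eta> * (labels js \<eta> * exactly js c' (Qm j g)))
      = ip \<Omega> (Qm j (exactly js c f)) (M j \<eta> * Qm j (labels js \<eta> * exactly js c' g))"
      by (simp add: exactly_Q[OF js(1) j] Q_labels[OF js(1) j js(3)])
    also have "\<dots> = ip \<Omega> (exactly js c f) (Qm j (M j \<eta> * Qm j (labels js \<eta> * exactly js c' g)))"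
      by (rule proj_self_adjoint[OF proj_Q[OF j]])
    finally show ?thesis by (simp add: label_hidden[OF j assms(3,4), folded top_grade_def])
  qed
  show ?case
    unfolding exactly.simps labels_simps ip_add_left mult.assoc distrib_left ip_add_right A
    using Cons.prems by (auto simp: IH)
qed simp

lemma fewer_labels_orth:
  assumes "set js \<subseteq> J" "distinct js" "\<eta> \<subseteq> {..<s}" "\<eta> \<noteq> {}" "2 * c < length js"
  shows "ip \<Omega> (fewer js (Suc c) f) (labels js \<eta> * fewer js (Suc c) g) = 0"
proof -
  have 1: "ip \<Omega> (exactly js d f) (labels js \<eta> * fewer js c' g) = 0" if "d \<le> c" "c' \<le> Suc c" for d c'
    using that(2)
  proof (induction c')
    case (Suc c')
    then show ?case
      using exactly_labels_orth[OF assms(1-4), of d c' f g] that(1) assms(5)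
      by (simp add: distrib_left ip_add_right)
  qed simp
  define G where "G = labels js \<eta> * fewer js (Suc c) g"
  have "ip \<Omega> (fewer js c' f) G = 0" if "c' \<le> Suc c" for c'
    using that
  proof (induction c')
    case (Suc c')
    then have "ip \<Omega> (exactly js c' f) G = 0" unfolding G_def by (intro 1) auto
    with Suc show ?case by (simp add: ip_add_left)
  qed simp
  then show ?thesis unfolding G_def by blast
qed

text \<open>The indicator of the event that all labels cancel is \<open>2\<^sup>-\<^sup>s\<close> times the sum of the
  characters \<open>labels js \<eta>\<close>. Only \<open>\<eta> = {}\<close> contributes to the norm: of two parts of \<open>g\<close> that know
  fewer than half of the blocks each, both leave the label of some common block hidden.\<close>

lemma sqn_conditioned:
  assumes "set js \<subseteq> J" "distinct js" "2 * c < length js" "fewer js (Suc c) g = g" "H \<subseteq> \<Omega>"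
    and H: "\<And>\<omega>. \<omega> \<in> \<Omega> \<Longrightarrow> (\<Sum>\<eta>\<in>Pow {..<s}. labels js \<eta> \<omega>) = (if \<omega> \<in> H then 2 ^ s else 0)"
  shows "2 ^ s * sqn H g = sqn \<Omega> g"
proof -
  have "complex_of_real (2 ^ s * sqn H g) = (\<Sum>\<omega>\<in>H. 2 ^ s * (cnj (g \<omega>) * g \<omega>))"
    by (simp add: ip_self[symmetric] ip_def sum_distrib_left)
  also have "\<dots> = (\<Sum>\<omega>\<in>\<Omega>. (\<Sum>\<eta>\<in>Pow {..<s}. labels js \<eta> \<omega>) * (cnj (g \<omega>) * g \<omega>))"
    using assms(5) finite_Omega by (intro sum.mono_neutral_cong_left) (auto simp: H)
  also have "\<dots> = (\<Sum>\<eta>\<in>Pow {..<s}. ip \<Omega> g (labels js \<eta> * g))"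
    unfolding ip_def sum_distrib_right
    by (subst sum.swap) (simp add: pointwise mult.left_commute)
  also have "\<dots> = (\<Sum>\<eta>\<in>Pow {..<s}. if \<eta> = {} then ip \<Omega> g g else 0)"
    using fewer_labels_orth[OF assms(1,2) _ _ assms(3), of _ g g] assms(4)
    by (intro sum.cong) (auto simp: labels_empty)
  also have "\<dots> = ip \<Omega> g g" by (simp add: sum.delta)
  finally show ?thesis unfolding ip_self using of_real_eq_iff by blast
qed

section \<open>Averaging the known labels over all choices\<close>

lemma potential_append_mono: "potential js f \<le> potential (g @ js) f"
proof (induction g arbitrary: f)
  case (Cons j g)
  have "0 \<le> inc * (\<Sum>r<R. potential (g @ js) (f - Q j r f))"
    by (intro mult_nonneg_nonneg sum_nonneg inc_nonneg potential_nonneg)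
  then show ?case using Cons[of f] by simp
qed simp

lemma potential_append_ge:
  assumes "set g \<subseteq> J" "set js \<subseteq> J"
  shows "potential js f + y * (\<Sum>j\<leftarrow>g. potential js (f - Qm j f)) \<le> potential (g @ js) f"
  using assms(1)
proof (induction g)
  case (Cons j g)
  then have j: "j \<in> J" and g: "set g \<subseteq> J" by auto
  have "y * potential js (f - Qm j f) = inc * (\<Sum>r<R. potential js (f - Qm j f))"
    using R_pos by (simp add: inc_def)
  also have "\<dots> \<le> inc * (\<Sum>r<R. potential (g @ js) (f - Q j r f))"
    using inc_nonneg
    by (intro mult_left_mono sum_mono order_trans[OF potential_coproj_last_le[OF assms(2) j] potential_append_mono])
      auto
  finally show ?case using Cons.IH[OF g] by (simp add: distrib_left)
qed simp

lemma sum_list_product_lists_Cons: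
  "(\<Sum>js\<leftarrow>product_lists (g # gs). F js) = (\<Sum>j\<leftarrow>g. \<Sum>js\<leftarrow>product_lists gs. F (j # js))"
  by (induction g) (simp_all add: o_def)

text \<open>A set of \<open>c\<close> blocks from different groups belongs to N^(k - c) of the
  choices from \<open>k\<close> groups, and the product form of the potential contains the part that
  knows their labels with weight y^c. So every known label costs a factor 1 / (y * N) on
  average.\<close>

lemma known_product_lists_le:
  assumes "set (concat gs) \<subseteq> J" "\<And>g. g \<in> set gs \<Longrightarrow> length g = N" "0 < N"
  shows "(\<Sum>js\<leftarrow>product_lists gs. known js c f) \<le> N ^ length gs * (1 / (y * N)) ^ c * potential (concat gs) f"
  using assms(1,2)
proof (induction gs arbitrary: c f)
  case Nil
  then show ?case using y_pos by simp
next
  case (Cons g gs)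
  define S where "S c f = (\<Sum>js\<leftarrow>product_lists gs. known js c f)" for c f
  let ?b = "\<lambda>c. N ^ length gs * (1 / (y * N)) ^ c"
  have IH: "S c f \<le> ?b c * potential (concat gs) f" for c f
    using Cons unfolding S_def by simp
  have g: "length g = N" "set g \<subseteq> J" "set (concat gs) \<subseteq> J" using Cons.prems by auto
  have b0: "0 \<le> ?b c" for c using y_pos by simp
  have "(\<Sum>js\<leftarrow>product_lists (g # gs). known js c f)
      = (\<Sum>j\<leftarrow>g. S c f + (if c = 0 then 0 else S (c - 1) (f - Qm j f)))"
    unfolding S_def sum_list_product_lists_Cons
    by (cases "c = 0") (simp_all add: sum_list_addf)
  also have "\<dots> = N * S c f + (if c = 0 then 0 else (\<Sum>j\<leftarrow>g. S (c - 1) (f - Qm j f)))"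
    using g(1) by (simp add: sum_list_addf sum_list_triv)
  also have "\<dots> \<le> N * ?b c * (potential (concat gs) f + y * (\<Sum>j\<leftarrow>g. potential (concat gs) (f - Qm j f)))"
  proof (cases c)
    case 0
    have "N * S 0 f \<le> N * (?b 0 * potential (concat gs) f)"
      by (intro mult_left_mono IH) auto
    also have "\<dots> \<le> N * (?b 0 * (potential (concat gs) f + y * (\<Sum>j\<leftarrow>g. potential (concat gs) (f - Qm j f))))"
      using y_pos b0[of 0]
      by (intro mult_left_mono) (auto intro!: mult_nonneg_nonneg sum_list_nonneg simp: potential_nonneg)
    finally show ?thesis using 0 by simp
  next
    case (Suc c')
    have "(\<Sum>j\<leftarrow>g. S c' (f - Qm j f)) \<le> (\<Sum>j\<leftarrow>g. ?b c' * potential (concat gs) (f - Qm j f))"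
      using IH by (intro sum_list_mono) auto
    also have "\<dots> = N * ?b c * (y * (\<Sum>j\<leftarrow>g. potential (concat gs) (f - Qm j f)))"
      using assms(3) y_pos by (simp add: Suc sum_list_const_mult)
    finally have "(\<Sum>j\<leftarrow>g. S c' (f - Qm j f))
      \<le> N * ?b c * (y * (\<Sum>j\<leftarrow>g. potential (concat gs) (f - Qm j f)))" .
    moreover have "N * S c f \<le> N * ?b c * potential (concat gs) f"
      using mult_left_mono[OF IH[of c f], of N] by (simp only: mult.assoc of_nat_0_le_iff)
    ultimately show ?thesis
      unfolding distrib_left using Suc by simp
  qed
  also have "\<dots> \<le> N * ?b c * potential (concat (g # gs)) f"
    using potential_append_ge[OF g(2,3)] b0[of c] by (intro mult_left_mono) auto
  finally show ?case by (simp add: mult.assoc)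
qed

end

section \<open>Query algorithms on a system of blocks\<close>

definition mix :: "nat \<Rightarrow> (nat \<Rightarrow> nat \<Rightarrow> complex) \<Rightarrow> (nat \<Rightarrow> 'w \<Rightarrow> complex) \<Rightarrow> nat \<Rightarrow> 'w \<Rightarrow> complex" where
  "mix d u G k = (\<Sum>k'<d. (\<lambda>_. u k k') * G k')"

definition isometric :: "nat \<Rightarrow> (nat \<Rightarrow> nat \<Rightarrow> complex) \<Rightarrow> bool" where
  "isometric d u \<longleftrightarrow>
    (\<forall>v. (\<Sum>k<d. (cmod (\<Sum>k'<d. u k k' * v k'))\<^sup>2) = (\<Sum>k<d. (cmod (v k))\<^sup>2))"

lemma lin_mix: "lin X \<Longrightarrow> X (mix d u G k) = mix d u (\<lambda>k'. X (G k')) k"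
  unfolding mix_def by (simp only: lin_sum lin_const)

lemma mix_diff: "mix d u G k - mix d u G' k = mix d u (\<lambda>k'. G k' - G' k') k"
  unfolding mix_def by (simp only: sum_subtractf right_diff_distrib)

lemma sum_sqn_mix:
  assumes "isometric d u"
  shows "(\<Sum>k<d. sqn A (mix d u G k)) = (\<Sum>k<d. sqn A (G k))"
proof -
  have "(\<Sum>k<d. sqn A (mix d u G k)) = (\<Sum>\<omega>\<in>A. \<Sum>k<d. (cmod (\<Sum>k'<d. u k k' * G k' \<omega>))\<^sup>2)"
    unfolding sqn_def mix_def by (subst sum.swap) (simp add: sum_fun_apply pointwise)
  also have "\<dots> = (\<Sum>\<omega>\<in>A. \<Sum>k<d. (cmod (G k \<omega>))\<^sup>2)"
    using assms by (simp add: isometric_def)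
  also have "\<dots> = (\<Sum>k<d. sqn A (G k))"
    unfolding sqn_def by (rule sum.swap)
  finally show ?thesis .
qed

lemma sqrt_sum_sqn_triangle:
  "sqrt (\<Sum>k<d. sqn A (X k + Y k)) \<le> sqrt (\<Sum>k<(d::nat). sqn A (X k)) + sqrt (\<Sum>k<d. sqn A (Y k))"
proof -
  have eq: "sqrt (\<Sum>k<d. sqn A (Z k)) = L2_set (\<lambda>k. sqrt (sqn A (Z k))) {..<d}" for Z :: "nat \<Rightarrow> _"
    unfolding L2_set_def by simp
  show ?thesis
    unfolding eq
    by (rule order_trans[OF L2_set_mono L2_set_triangle_ineq]) (auto intro: sqrt_sqn_triangle)
qed

text \<open>Amplitudes are functions of the input: \<open>F t k\<close> belongs to basis state
  \<open>k\<close> after \<open>t\<close> queries, \<open>q k\<close> is the bit queried there, and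
  \<open>fl\<close> flips the answer bit. On the sum and the difference of the amplitudes of
  \<open>k\<close> and \<open>fl k\<close> the oracle acts as 1 and as the sign of the bit.
  \<open>None\<close> marks queries on which the oracle is the identity for all inputs
  considered.\<close>

locale query_run = block_system \<Omega> J Q sg blk M R s eps y
  for \<Omega> :: "'w set" and J :: "'j set" and Q and sg :: "'e \<Rightarrow> 'w \<Rightarrow> complex" and blk M R s eps y +
  fixes d :: nat and T :: nat and U :: "nat \<Rightarrow> nat \<Rightarrow> nat \<Rightarrow> complex" and q :: "nat \<Rightarrow> 'e option"
    and fl :: "nat \<Rightarrow> nat" and F :: "nat \<Rightarrow> nat \<Rightarrow> 'w \<Rightarrow> complex" and v :: "nat \<Rightarrow> complex"
  assumes U_isometric: "t < T \<Longrightarrow> isometric d (U t)"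
    and fl: "k < d \<Longrightarrow> fl k < d" "k < d \<Longrightarrow> fl (fl k) = k" "k < d \<Longrightarrow> q (fl k) = q k"
    and q_blk: "k < d \<Longrightarrow> q k = Some e \<Longrightarrow> blk e \<in> J"
    and F_0: "k < d \<Longrightarrow> F 0 k = (\<lambda>_. v k) * 1" and v: "(\<Sum>k<d. (cmod (v k))\<^sup>2) = 1"
    and F_Suc: "t < T \<Longrightarrow> k < d \<Longrightarrow> F (Suc t) k = mix d (U t) (\<lambda>k. case q k of None \<Rightarrow> F t k |
      Some e \<Rightarrow> (\<lambda>_. 1/2) * (F t k + F t (fl k)) + sg e * ((\<lambda>_. 1/2) * (F t k - F t (fl k)))) k"
begin

definition ask :: "(nat \<Rightarrow> 'w \<Rightarrow> complex) \<Rightarrow> nat \<Rightarrow> 'w \<Rightarrow> complex" where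
  "ask G k = (case q k of None \<Rightarrow> G k |
    Some e \<Rightarrow> (\<lambda>_. 1/2) * (G k + G (fl k)) + sg e * ((\<lambda>_. 1/2) * (G k - G (fl k))))"

lemma F_Suc': "t < T \<Longrightarrow> k < d \<Longrightarrow> F (Suc t) k = mix d (U t) (ask (F t)) k"
  using F_Suc unfolding ask_def .

lemma sum_fl: "(\<Sum>k<d. B (fl k)) = (\<Sum>k<d. B k :: real)"
  by (rule sum.reindex_bij_witness[of _ fl fl]) (auto simp: fl)

lemma half_sum: "(\<lambda>_. 1/2) * (f + g) + (\<lambda>_. 1/2) * (f - g) = (f :: 'w \<Rightarrow> complex)"
  and half_diff: "(\<lambda>_. 1/2) * (f + g) - (\<lambda>_. 1/2) * (f - g) = (g :: 'w \<Rightarrow> complex)"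
  by (rule ext, simp add: pointwise field_simps)+

text \<open>For a pair \<open>k\<close>, \<open>fl k\<close> the query multiplies only the half
  difference \<open>m\<close> by a sign, and the parallelogram law recombines it with the half sum
  \<open>p\<close>.\<close>

lemma sum_ask_le:
  fixes B :: "('w \<Rightarrow> complex) \<Rightarrow> real"
  assumes par: "\<And>f g. B (f + g) + B (f - g) = 2 * B f + 2 * B g"
    and nonneg: "\<And>f. 0 \<le> B f" and r: "1 \<le> r"
    and sg: "\<And>e f. blk e \<in> J \<Longrightarrow> B (sg e * f) \<le> r * B f"
  shows "(\<Sum>k<d. B (ask G k)) \<le> r * (\<Sum>k<d. B (G k))"
proof -
  have pair: "B (ask G k) + B (ask G (fl k)) \<le> r * (B (G k) + B (G (fl k)))" if "k < d" for k
  proof (cases "q k")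
    case None
    then have "ask G k = G k" "ask G (fl k) = G (fl k)" using that fl(3) by (auto simp: ask_def)
    then show ?thesis using nonneg[of "G k"] nonneg[of "G (fl k)"] r
      by (simp add: mult_right_mono[of 1 r, simplified])
  next
    case (Some e)
    define p m where "p = (\<lambda>_. 1/2) * (G k + G (fl k))" and "m = (\<lambda>_. 1/2) * (G k - G (fl k))"
    have "ask G k = p + sg e * m"
      using Some by (simp add: ask_def p_def m_def)
    moreover have "ask G (fl k) = p - sg e * m"
      using Some that fl by (simp add: ask_def p_def m_def fun_eq_iff pointwise algebra_simps)
    ultimately have "B (ask G k) + B (ask G (fl k)) = 2 * B p + 2 * B (sg e * m)"
      by (simp only: par)
    also have "\<dots> \<le> r * (2 * B p + 2 * B m)"
      using sg[OF q_blk[OF that Some], of m] nonneg[of p] r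
        mult_right_mono[of 1 r "B p"] by (simp add: distrib_left)
    also have "2 * B p + 2 * B m = B (G k) + B (G (fl k))"
      using par[of p m] unfolding p_def m_def half_sum half_diff by simp
    finally show ?thesis .
  qed
  have "2 * (\<Sum>k<d. B (ask G k)) = (\<Sum>k<d. B (ask G k) + B (ask G (fl k)))"
    by (simp add: sum.distrib sum_fl[of "\<lambda>k. B (ask G k)"])
  also have "\<dots> \<le> (\<Sum>k<d. r * (B (G k) + B (G (fl k))))"
    using pair by (intro sum_mono) auto
  also have "\<dots> = 2 * (r * (\<Sum>k<d. B (G k)))"
    by (simp add: sum.distrib sum_distrib_left[symmetric] sum_fl[of "\<lambda>k. B (G k)"])
  finally show ?thesis by simp
qed

text \<open>Holds for the norm restricted to any set of inputs, because the oracle acts on each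
  input separately. This is what allows the norm to be followed on the conditioned inputs.\<close>

lemma sum_sqn_ask_le: "(\<Sum>k<d. sqn A (ask G k)) \<le> (\<Sum>k<d. sqn A (G k))"
proof -
  have "sqn A (sg e * f) \<le> 1 * sqn A f" for e f
    by (simp add: sqn_mult_unit sg_norm)
  from sum_ask_le[of "sqn A" 1 G, OF sqn_parallelogram sqn_nonneg order_refl this]
  show ?thesis by simp
qed

lemma sum_sqn_le: "t \<le> T \<Longrightarrow> (\<Sum>k<d. sqn \<Omega> (F t k)) \<le> card \<Omega>"
proof (induction t)
  case 0
  have "(\<Sum>k<d. sqn \<Omega> (F 0 k)) = (\<Sum>k<d. (cmod (v k))\<^sup>2 * card \<Omega>)"
    by (intro sum.cong refl) (simp add: F_0 sqn_def pointwise)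
  then show ?case using v by (simp add: sum_distrib_right[symmetric])
next
  case (Suc t)
  have "(\<Sum>k<d. sqn \<Omega> (F (Suc t) k)) = (\<Sum>k<d. sqn \<Omega> (ask (F t) k))"
    using Suc.prems sum_sqn_mix[OF U_isometric, of t \<Omega> "ask (F t)"] by (simp add: F_Suc')
  with Suc sum_sqn_ask_le[of \<Omega> "F t"] show ?case by simp
qed

text \<open>The projections act on the input and the matrix on the basis states, so they commute,
  and the potential is built from squared norms of projected functions.\<close>

lemma sum_potential_mix:
  assumes "isometric d u" "set js \<subseteq> J"
  shows "(\<Sum>k<d. potential js (mix d u G k)) = (\<Sum>k<d. potential js (G k))"
  using assms(2)
proof (induction js arbitrary: G)
  case Nil
  then show ?case by (simp add: sum_sqn_mix[OF assms(1)])
next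
  case (Cons j js)
  then have j: "j \<in> J" and js: "set js \<subseteq> J" by auto
  have "mix d u G k - Q j r (mix d u G k) = mix d u (\<lambda>k. G k - Q j r (G k)) k" for r k
    unfolding lin_mix[OF lin_Q[OF j]] mix_diff ..
  then have "(\<Sum>k<d. \<Sum>r<R. potential js (mix d u G k - Q j r (mix d u G k)))
    = (\<Sum>r<R. \<Sum>k<d. potential js (mix d u (\<lambda>k. G k - Q j r (G k)) k))"
    by (subst sum.swap) simp
  also have "\<dots> = (\<Sum>k<d. \<Sum>r<R. potential js (G k - Q j r (G k)))"
    unfolding Cons.IH[OF js] by (rule sum.swap)
  finally show ?case
    using Cons.IH[OF js, of G] by (simp add: sum.distrib sum_distrib_left[symmetric])
qed

lemma sum_potential_le:
  assumes "set js \<subseteq> J" "distinct js" "t \<le> T"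
  shows "(\<Sum>k<d. potential js (F t k)) \<le> rate ^ t * card \<Omega>"
  using assms(3)
proof (induction t)
  case 0
  have "(\<Sum>k<d. potential js (F 0 k)) = (\<Sum>k<d. (cmod (v k))\<^sup>2 * card \<Omega>)"
    by (intro sum.cong refl) (simp only: F_0 potential_one[OF assms(1)] lessThan_iff)
  then show ?case using v by (simp add: sum_distrib_right[symmetric])
next
  case (Suc t)
  have "(\<Sum>k<d. potential js (F (Suc t) k)) = (\<Sum>k<d. potential js (ask (F t) k))"
    using Suc.prems sum_potential_mix[OF U_isometric assms(1), of t "ask (F t)"] by (simp add: F_Suc')
  also have "\<dots> \<le> rate * (\<Sum>k<d. potential js (F t k))"
    by (rule sum_ask_le[OF potential_parallelogram[OF assms(1)] potential_nonneg rate_ge_1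
          potential_growth[OF assms(1,2)]])
  also have "\<dots> \<le> rate * (rate ^ t * card \<Omega>)"
    using Suc rate_ge_1 by (intro mult_left_mono) auto
  finally show ?case by simp
qed

lemma known_const: "set js \<subseteq> J \<Longrightarrow> known js c ((\<lambda>_. a) * f) = (cmod a)\<^sup>2 * known js c f"
proof (induction js arbitrary: c f)
  case Nil
  then show ?case by (simp add: sqn_const)
next
  case (Cons j js)
  then have j: "j \<in> J" and js: "set js \<subseteq> J" by auto
  have "(\<lambda>_. a) * f - Qm j ((\<lambda>_. a) * f) = (\<lambda>_. a) * (f - Qm j f)"
    by (simp add: Q_const[OF j] right_diff_distrib)
  then show ?case using Cons.IH[OF js] by (simp add: distrib_left)
qed

lemma fewer_one: "set js \<subseteq> J \<Longrightarrow> fewer js (Suc c) 1 = 1"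
proof -
  assume "set js \<subseteq> J"
  then have "exactly js c 1 = (if c = 0 then 1 else 0)" for c
    by (induction js arbitrary: c) (auto simp: Q_one exactly_zero)
  then show ?thesis by (induction c) auto
qed

section \<open>Leakage into states that know too many labels\<close>

definition progress :: "'j list \<Rightarrow> nat \<Rightarrow> nat \<Rightarrow> real" where
  "progress js h t = (\<Sum>k<d. known js h (F t k))"

lemma progress_nonneg: "0 \<le> progress js h t"
  unfolding progress_def by (intro sum_nonneg known_nonneg)

context
  fixes js :: "'j list" and h :: nat and H :: "'w set"
  assumes js: "set js \<subseteq> J" "distinct js" and h: "2 * Suc h < length js"
    and H_sub: "H \<subseteq> \<Omega>"
    and H: "\<And>\<omega>. \<omega> \<in> \<Omega> \<Longrightarrow> (\<Sum>\<eta>\<in>Pow {..<s}. labels js \<eta> \<omega>) = (if \<omega> \<in> H then 2 ^ s else 0)"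
begin

text \<open>The norm, on the conditioned inputs \<open>H\<close>, of the part that knows more than
  \<open>h\<close> labels. Conditioning may amplify this part, so it is followed query by
  query.\<close>

definition deviation :: "nat \<Rightarrow> real" where
  "deviation t = sqrt (\<Sum>k<d. sqn H (F t k - fewer js (Suc h) (F t k)))"

lemma ask_fewer:
  "k < d \<Longrightarrow> ask G k - fewer js (Suc h) (ask G k) = ask (\<lambda>k. G k - fewer js (Suc h) (G k)) k +
    (case q k of None \<Rightarrow> 0 | Some e \<Rightarrow> commutator js (Suc h) e ((\<lambda>_. 1/2) * (G k - G (fl k))))"
proof (cases "q k")
  case None
  then show ?thesis by (simp add: ask_def)
next
  case (Some e)
  note l = lin_fewer[OF js(1), of "Suc h"]
  show ?thesis
    unfolding ask_def Some option.case commutator_def lin_add[OF l] lin_diff[OF l] lin_const[OF l]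
    by (simp add: algebra_simps)
qed

text \<open>Neither the unitary nor the query increases the norm on \<open>H\<close>; only the
  commutator adds to it. The commutator knows at most \<open>Suc h\<close> labels, fewer than half,
  so its squared norm on \<open>H\<close> is smaller by exactly 2^s.\<close>

lemma deviation_Suc: "t < T \<Longrightarrow> deviation (Suc t) \<le> deviation t + 2 * sqrt (progress js h t / 2 ^ s)"
proof -
  assume t: "t < T"
  let ?f = "fewer js (Suc h)"
  define K where "K k = (case q k of None \<Rightarrow> 0 | Some e \<Rightarrow>
    commutator js (Suc h) e ((\<lambda>_. 1/2) * (F t k - F t (fl k))))" for k
  define D where "D k = F t k - ?f (F t k)" for k
  have "F (Suc t) k - ?f (F (Suc t) k) = mix d (U t) (\<lambda>k. ask (F t) k - ?f (ask (F t) k)) k" if "k < d" for k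
    unfolding F_Suc'[OF t that] lin_mix[OF lin_fewer[OF js(1)]] mix_diff ..
  then have "deviation (Suc t) = sqrt (\<Sum>k<d. sqn H (ask (F t) k - ?f (ask (F t) k)))"
    unfolding deviation_def using sum_sqn_mix[OF U_isometric[OF t]] by simp
  also have "\<dots> = sqrt (\<Sum>k<d. sqn H (ask D k + K k))"
    unfolding D_def K_def by (simp add: ask_fewer del: fewer.simps)
  also have "\<dots> \<le> sqrt (\<Sum>k<d. sqn H (ask D k)) + sqrt (\<Sum>k<d. sqn H (K k))"
    by (rule sqrt_sum_sqn_triangle)
  also have "sqrt (\<Sum>k<d. sqn H (ask D k)) \<le> deviation t"
    unfolding deviation_def using sum_sqn_ask_le[of H D] by (simp add: D_def)
  also have "(\<Sum>k<d. sqn H (K k)) \<le> (\<Sum>k<d. (2 * known js h (F t k) + 2 * known js h (F t (fl k))) / 2 ^ s)"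
  proof (intro sum_mono)
    fix k assume "k \<in> {..<d}"
    then have k: "k < d" by simp
    show "sqn H (K k) \<le> (2 * known js h (F t k) + 2 * known js h (F t (fl k))) / 2 ^ s"
    proof (cases "q k")
      case None
      then show ?thesis using known_nonneg by (simp add: K_def)
    next
      case (Some e)
      note e = q_blk[OF k Some]
      define m where "m = (\<lambda>_. 1/2) * (F t k - F t (fl k))"
      have "2 ^ s * sqn H (K k) = sqn \<Omega> (K k)"
        using fewer_commutator[OF js e, of "Suc h" m] h
        by (intro sqn_conditioned[OF js _ _ H_sub H, of "Suc h"]) (auto simp: K_def Some m_def)
      also have "\<dots> \<le> 4 * known js h m"
        using sqn_commutator_le[OF js e, of h m] by (simp add: K_def Some m_def)
      also have "\<dots> = known js h (F t k - F t (fl k))"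
        unfolding m_def known_const[OF js(1)] by (simp add: power2_eq_square norm_divide)
      also have "\<dots> \<le> 2 * known js h (F t k) + 2 * known js h (F t (fl k))"
        by (rule known_diff_le[OF js(1)])
      finally show ?thesis by (simp add: field_simps)
    qed
  qed
  also have "\<dots> = 4 * (progress js h t / 2 ^ s)"
    unfolding progress_def
    by (simp add: sum_divide_distrib[symmetric] sum.distrib sum_distrib_left[symmetric]
        sum_fl[of "\<lambda>k. known js h (F t k)"])
  also have "sqrt (4 * (progress js h t / 2 ^ s)) = 2 * sqrt (progress js h t / 2 ^ s)"
    by (simp only: real_sqrt_mult real_sqrt_four)
  finally show ?thesis by simp
qed

lemma deviation_le: "t \<le> T \<Longrightarrow> deviation t \<le> (\<Sum>i<t. 2 * sqrt (progress js h i / 2 ^ s))"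
proof (induction t)
  case 0
  have "F 0 k - fewer js (Suc h) (F 0 k) = 0" if "k < d" for k
    unfolding F_0[OF that] lin_const[OF lin_fewer[OF js(1)]] fewer_one[OF js(1)] by simp
  then show ?case by (simp add: deviation_def)
next
  case (Suc t)
  then show ?case using deviation_Suc[of t] by simp
qed

text \<open>On \<open>H\<close> the part that knows at most \<open>h\<close> labels keeps exactly
  the fraction 2^-s of its squared norm. The rest is bounded by \<open>deviation\<close>, whichever
  set \<open>C\<close> of basis states is observed.\<close>

lemma conditioned_mass_le:
  assumes "t \<le> T" "C \<subseteq> {..<d}"
  shows "(\<Sum>k\<in>C. sqn H (F t k)) \<le> (2 * (\<Sum>k\<in>C. sqn \<Omega> (F t k)) + 8 * T * (\<Sum>i<T. progress js h i)) / 2 ^ s"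
proof -
  let ?f = "fewer js (Suc h)"
  have fin: "finite C" using assms(2) finite_subset by blast
  have "(\<Sum>k\<in>C. sqn H (F t k)) \<le> (\<Sum>k\<in>C. 2 * sqn H (?f (F t k)) + 2 * sqn H (F t k - ?f (F t k)))"
  proof (intro sum_mono)
    fix k
    show "sqn H (F t k) \<le> 2 * sqn H (?f (F t k)) + 2 * sqn H (F t k - ?f (F t k))"
      using sqn_add_le[of H "?f (F t k)" "F t k - ?f (F t k)"] by (simp del: fewer.simps)
  qed
  also have "\<dots> = 2 * (\<Sum>k\<in>C. sqn H (?f (F t k))) + 2 * (\<Sum>k\<in>C. sqn H (F t k - ?f (F t k)))"
    by (simp add: sum.distrib sum_distrib_left)
  also have "(\<Sum>k\<in>C. sqn H (?f (F t k))) \<le> (\<Sum>k\<in>C. sqn \<Omega> (F t k) / 2 ^ s)"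
  proof (intro sum_mono)
    fix k
    have "2 ^ s * sqn H (?f (F t k)) = sqn \<Omega> (?f (F t k))"
      using h fewer_fewer[OF js(1) order_refl] by (intro sqn_conditioned[OF js _ _ H_sub H, of h]) (auto simp del: fewer.simps)
    also have "\<dots> \<le> sqn \<Omega> (F t k)" by (rule sqn_proj_le[OF proj_fewer[OF js(1)]])
    finally show "sqn H (?f (F t k)) \<le> sqn \<Omega> (F t k) / 2 ^ s" by (simp add: field_simps)
  qed
  also have "(\<Sum>k\<in>C. sqn H (F t k - ?f (F t k))) \<le> (\<Sum>k<d. sqn H (F t k - ?f (F t k)))"
    using assms(2) by (intro sum_mono2) auto
  also have "\<dots> = (deviation t)\<^sup>2"
    unfolding deviation_def by (simp add: sum_nonneg)
  also have "\<dots> \<le> (\<Sum>i<t. 2 * sqrt (progress js h i / 2 ^ s))\<^sup>2"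
    using deviation_le[OF assms(1)] by (intro power_mono) (auto simp: deviation_def sum_nonneg)
  also have "\<dots> \<le> (\<Sum>i<t. (2 * sqrt (progress js h i / 2 ^ s))\<^sup>2) * t"
    using sum_squared_le[of "\<lambda>i. 2 * sqrt (progress js h i / 2 ^ s)" "{..<t}"] by simp
  also have "\<dots> = (\<Sum>i<t. 4 * (progress js h i / 2 ^ s)) * t"
    using progress_nonneg by (simp add: power_mult_distrib)
  also have "\<dots> \<le> (\<Sum>i<T. 4 * (progress js h i / 2 ^ s)) * T"
    using assms(1) progress_nonneg by (intro mult_mono sum_mono2 sum_nonneg) auto
  finally show ?thesis
    by (simp add: sum_distrib_left[symmetric] sum_divide_distrib[symmetric] field_simps)
qed

end

text \<open>The sets \<open>C js\<close> are disjoint, so the main terms of all choices together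
  amount to \<open>card \<Omega>\<close> only once. The leakage terms are averaged by
  \<open>known_product_lists_le\<close>.\<close>

lemma total_conditioned_mass_le:
  fixes gs :: "'j list list" and H :: "'j list \<Rightarrow> 'w set"
  assumes gs: "set (concat gs) \<subseteq> J" "distinct (concat gs)" "\<And>g. g \<in> set gs \<Longrightarrow> length g = N" "0 < N"
    and h: "2 * Suc h < length gs"
    and H_sub: "\<And>js. js \<in> set (product_lists gs) \<Longrightarrow> H js \<subseteq> \<Omega>"
    and H: "\<And>js \<omega>. js \<in> set (product_lists gs) \<Longrightarrow> \<omega> \<in> \<Omega> \<Longrightarrow>
      (\<Sum>\<eta>\<in>Pow {..<s}. labels js \<eta> \<omega>) = (if \<omega> \<in> H js then 2 ^ s else 0)"
    and C: "\<And>js. js \<in> set (product_lists gs) \<Longrightarrow> C js \<subseteq> {..<d}"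
      "\<And>js js'. js \<in> set (product_lists gs) \<Longrightarrow> js' \<in> set (product_lists gs) \<Longrightarrow> js \<noteq> js' \<Longrightarrow> C js \<inter> C js' = {}"
    and t: "t \<le> T"
  shows "(\<Sum>js\<in>set (product_lists gs). \<Sum>k\<in>C js. sqn (H js) (F t k))
    \<le> (2 + 8 * real T ^ 2 * N ^ length gs * (1 / (y * N)) ^ h * rate ^ T) * card \<Omega> / 2 ^ s"
proof -
  let ?L = "set (product_lists gs)"
  have sub: "set js \<subseteq> J" "distinct js" "length js = length gs" if "js \<in> ?L" for js
  proof -
    have l2: "list_all2 (\<lambda>x ys. x \<in> set ys) js gs" using that by (simp add: product_lists_set)
    then show "length js = length gs" by (rule list_all2_lengthD)
    have "set js \<subseteq> set (concat gs) \<and> distinct js"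
      using l2 gs(2)
    proof (induction rule: list_all2_induct)
      case (Cons x xs ys yss)
      then show ?case by auto
    qed auto
    then show "set js \<subseteq> J" "distinct js" using gs(1) by auto
  qed
  have dist: "distinct (product_lists gs)"
    using gs(2) by (intro distinct_product_lists) (auto simp: distinct_concat_iff)
  define pr where "pr js i = progress js h i" for js i
  have "(\<Sum>js\<in>?L. \<Sum>k\<in>C js. sqn (H js) (F t k))
     \<le> (\<Sum>js\<in>?L. (2 * (\<Sum>k\<in>C js. sqn \<Omega> (F t k)) + 8 * T * (\<Sum>i<T. pr js i)) / 2 ^ s)"
  proof (intro sum_mono)
    fix js assume a: "js \<in> ?L"
    then have h': "2 * Suc h < length js" using h sub(3) by simp
    show "(\<Sum>k\<in>C js. sqn (H js) (F t k))
      \<le> (2 * (\<Sum>k\<in>C js. sqn \<Omega> (F t k)) + 8 * T * (\<Sum>i<T. pr js i)) / 2 ^ s"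
      using conditioned_mass_le[OF sub(1,2)[OF a] h' H_sub[OF a] H[OF a] t C(1)[OF a]]
      unfolding pr_def by simp
  qed
  also have "\<dots> = (2 * (\<Sum>js\<in>?L. \<Sum>k\<in>C js. sqn \<Omega> (F t k)) + 8 * T * (\<Sum>i<T. \<Sum>js\<in>?L. pr js i)) / 2 ^ s"
    by (simp add: sum_divide_distrib[symmetric] sum.distrib sum_distrib_left[symmetric] sum.swap[of _ _ ?L])
  finally have 1: "(\<Sum>js\<in>?L. \<Sum>k\<in>C js. sqn (H js) (F t k))
     \<le> (2 * (\<Sum>js\<in>?L. \<Sum>k\<in>C js. sqn \<Omega> (F t k)) + 8 * T * (\<Sum>i<T. \<Sum>js\<in>?L. pr js i)) / 2 ^ s" .
  have "(\<Sum>js\<in>?L. \<Sum>k\<in>C js. sqn \<Omega> (F t k)) = (\<Sum>k\<in>(\<Union>js\<in>?L. C js). sqn \<Omega> (F t k))"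
    using C by (intro sum.UNION_disjoint[symmetric]) (auto intro: finite_subset)
  also have "\<dots> \<le> (\<Sum>k<d. sqn \<Omega> (F t k))"
    using C(1) by (intro sum_mono2) auto
  also have "\<dots> \<le> card \<Omega>" by (rule sum_sqn_le[OF t])
  finally have 2: "(\<Sum>js\<in>?L. \<Sum>k\<in>C js. sqn \<Omega> (F t k)) \<le> card \<Omega>" .
  have 3: "(\<Sum>i<T. \<Sum>js\<in>?L. pr js i) \<le> (\<Sum>i<T. N ^ length gs * (1 / (y * N)) ^ h * (rate ^ T * card \<Omega>))"
  proof (intro sum_mono)
    fix i assume i: "i \<in> {..<T}"
    have "(\<Sum>js\<in>?L. pr js i) = (\<Sum>k<d. \<Sum>js\<leftarrow>product_lists gs. known js h (F i k))"
      unfolding pr_def progress_def sum_list_distinct_conv_sum_set[OF dist] by (rule sum.swap)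
    also have "\<dots> \<le> (\<Sum>k<d. N ^ length gs * (1 / (y * N)) ^ h * potential (concat gs) (F i k))"
      using known_product_lists_le[OF gs(1,3,4)] by (intro sum_mono) simp
    also have "\<dots> \<le> N ^ length gs * (1 / (y * N)) ^ h * (rate ^ i * card \<Omega>)"
      unfolding sum_distrib_left[symmetric]
      using sum_potential_le[OF gs(1,2), of i] i y_pos by (intro mult_left_mono) auto
    also have "\<dots> \<le> N ^ length gs * (1 / (y * N)) ^ h * (rate ^ T * card \<Omega>)"
      using i y_pos rate_ge_1 by (intro mult_left_mono mult_right_mono power_increasing) auto
    finally show "(\<Sum>js\<in>?L. pr js i) \<le> N ^ length gs * (1 / (y * N)) ^ h * (rate ^ T * card \<Omega>)" .
  qed
  have "(2 * (\<Sum>js\<in>?L. \<Sum>k\<in>C js. sqn \<Omega> (F t k)) + 8 * T * (\<Sum>i<T. \<Sum>js\<in>?L. pr js i)) / 2 ^ s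
    \<le> (2 * card \<Omega> + 8 * T * (\<Sum>i<T. N ^ length gs * (1 / (y * N)) ^ h * (rate ^ T * card \<Omega>))) / 2 ^ s"
    using 2 3 by (intro divide_right_mono add_mono mult_left_mono) auto
  also have "\<dots> = (2 + 8 * real T ^ 2 * N ^ length gs * (1 / (y * N)) ^ h * rate ^ T) * card \<Omega> / 2 ^ s"
    by (simp add: power2_eq_square algebra_simps)
  finally show ?thesis using 1 by linarith
qed

end

section \<open>Orthogonal families and operators on one coordinate\<close>

text \<open>A member of norm 0 gets coefficient 0 through division by zero, so the families below
  may contain such members.\<close>

definition coef :: "'p set \<Rightarrow> ('i \<Rightarrow> 'p \<Rightarrow> complex) \<Rightarrow> 'i \<Rightarrow> ('p \<Rightarrow> complex) \<Rightarrow> complex" where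
  "coef P b i f = ip P (b i) f / ip P (b i) (b i)"

text \<open>Projections are given by kernels so that one object can act on functions of a single
  block, by \<open>kop\<close>, and on one coordinate of functions of all blocks, by
  \<open>coord\<close>.\<close>

definition kernel :: "'p set \<Rightarrow> ('i \<Rightarrow> 'p \<Rightarrow> complex) \<Rightarrow> 'i set \<Rightarrow> 'p \<Rightarrow> 'p \<Rightarrow> complex" where
  "kernel P b I p p' = (\<Sum>i\<in>I. b i p * cnj (b i p') / ip P (b i) (b i))"

definition kop :: "'p set \<Rightarrow> ('p \<Rightarrow> 'p \<Rightarrow> complex) \<Rightarrow> ('p \<Rightarrow> complex) \<Rightarrow> 'p \<Rightarrow> complex" where
  "kop P K f p = (\<Sum>p'\<in>P. K p p' * f p')"

lemma lin_kop: "lin (kop P K)"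
  unfolding lin_def kop_def
  by (auto simp: fun_eq_iff pointwise distrib_left sum.distrib sum_distrib_left intro!: sum.cong)

lemma kop_kernel: "kop P (kernel P b I) f = (\<Sum>i\<in>I. (\<lambda>_. coef P b i f) * b i)"
proof
  fix p
  have "kop P (kernel P b I) f p = (\<Sum>p'\<in>P. \<Sum>i\<in>I. b i p * cnj (b i p') / ip P (b i) (b i) * f p')"
    unfolding kop_def kernel_def by (simp add: sum_distrib_right)
  also have "\<dots> = (\<Sum>i\<in>I. \<Sum>p'\<in>P. b i p * cnj (b i p') / ip P (b i) (b i) * f p')"
    by (rule sum.swap)
  also have "\<dots> = (\<Sum>i\<in>I. (\<lambda>_. coef P b i f) * b i) p"
    unfolding sum_fun_apply coef_def ip_def times_fun_apply sum_divide_distrib sum_distrib_right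
    by (intro sum.cong refl) (simp add: algebra_simps)
  finally show "kop P (kernel P b I) f p = (\<Sum>i\<in>I. (\<lambda>_. coef P b i f) * b i) p" .
qed

lemma ip_self_eq_0:
  assumes "finite P" "ip P f f = 0"
  shows "ip P f g = 0"
proof -
  have "sqn P f = 0" using assms(2) unfolding ip_self by simp
  then have "\<forall>p\<in>P. f p = 0"
    unfolding sqn_def using assms(1) by (simp add: sum_nonneg_eq_0_iff)
  then show ?thesis unfolding ip_def by simp
qed

locale orthogonal_family =
  fixes P :: "'p set" and b :: "'i \<Rightarrow> 'p \<Rightarrow> complex" and I0 :: "'i set"
  assumes finite_P: "finite P" and finite_I0: "finite I0"
    and orth: "i \<in> I0 \<Longrightarrow> j \<in> I0 \<Longrightarrow> i \<noteq> j \<Longrightarrow> ip P (b i) (b j) = 0"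
begin

abbreviation "fproj I \<equiv> kop P (kernel P b I)"

lemma ip_fproj:
  assumes "I \<subseteq> I0" "i \<in> I0"
  shows "ip P (b i) (fproj I f) = (if i \<in> I then ip P (b i) f else 0)"
proof -
  have fin: "finite I" using assms(1) finite_I0 finite_subset by blast
  have "ip P (b i) (fproj I f) = (\<Sum>j\<in>I. coef P b j f * ip P (b i) (b j))"
    unfolding kop_kernel ip_sum_right ip_const_right ..
  also have "\<dots> = (\<Sum>j\<in>I. if j = i then coef P b i f * ip P (b i) (b i) else 0)"
    using assms orth by (intro sum.cong) auto
  also have "\<dots> = (if i \<in> I then ip P (b i) f else 0)"
    using fin ip_self_eq_0[OF finite_P, of "b i" f] by (auto simp: coef_def)
  finally show ?thesis .
qed

lemma coef_fproj:
  "I \<subseteq> I0 \<Longrightarrow> i \<in> I0 \<Longrightarrow> coef P b i (fproj I f) = (if i \<in> I then coef P b i f else 0)"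
  unfolding coef_def by (simp add: ip_fproj)

lemma fproj_fproj:
  assumes "I \<subseteq> I0" "I' \<subseteq> I0"
  shows "fproj I (fproj I' f) = fproj (I \<inter> I') f"
proof -
  have fin: "finite I" using assms(1) finite_I0 finite_subset by blast
  have "fproj I (fproj I' f) = (\<Sum>i\<in>I. (\<lambda>_. if i \<in> I' then coef P b i f else 0) * b i)"
    unfolding kop_kernel[of P b I "fproj I' f"] using assms
    by (intro sum.cong refl) (auto simp: coef_fproj)
  also have "\<dots> = (\<Sum>i\<in>I. if i \<in> I' then (\<lambda>_. coef P b i f) * b i else 0)"
    by (intro sum.cong refl) (auto simp: fun_eq_iff pointwise)
  also have "\<dots> = fproj (I \<inter> I') f"
    unfolding kop_kernel using fin by (simp add: sum.inter_restrict)
  finally show ?thesis .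
qed

lemma proj_fproj:
  assumes "I \<subseteq> I0"
  shows "proj P (fproj I)"
proof -
  have "ip P (fproj I f) g = ip P f (fproj I g)" for f g
  proof -
    have "cnj (ip P (b i) (b i)) = ip P (b i) (b i)" for i using ip_commute[of P "b i" "b i"] by simp
    moreover have "ip P f (b i) = cnj (ip P (b i) f)" for i by (rule ip_commute)
    ultimately show ?thesis
      unfolding kop_kernel ip_sum_left ip_sum_right ip_const_left ip_const_right coef_def
      by (intro sum.cong refl) simp
  qed
  then show ?thesis
    unfolding proj_def using fproj_fproj[OF assms assms] lin_kop by auto
qed

lemma fproj_member:
  assumes "I \<subseteq> I0" "i \<in> I" "ip P (b i) (b i) \<noteq> 0"
  shows "fproj I (b i) = b i"
proof -
  have fin: "finite I" using assms(1) finite_I0 finite_subset by blast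
  have "fproj I (b i) = (\<Sum>j\<in>I. if j = i then b i else 0)"
    unfolding kop_kernel
  proof (intro sum.cong refl)
    fix j assume j: "j \<in> I"
    show "(\<lambda>_. coef P b j (b i)) * b j = (if j = i then b i else 0)"
      using assms orth[of j i] j by (auto simp: coef_def fun_eq_iff pointwise)
  qed
  also have "\<dots> = b i" using fin assms(2) by (subst sum.delta) simp_all
  finally show ?thesis .
qed

lemma sqn_fproj:
  assumes "I \<subseteq> I0"
  shows "sqn P (fproj I f) = (\<Sum>i\<in>I. (cmod (coef P b i f))\<^sup>2 * sqn P (b i))"
proof -
  have fin: "finite I" using assms finite_I0 finite_subset by blast
  show ?thesis
    unfolding kop_kernel using assms orth
    by (subst sqn_sum_orth[OF fin]) (auto simp: ip_const_left ip_const_right sqn_const)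
qed

end

section \<open>Operators acting on one coordinate of a product\<close>

definition coord :: "'p set \<Rightarrow> 'j \<Rightarrow> ('p \<Rightarrow> 'p \<Rightarrow> complex) \<Rightarrow> (('j \<Rightarrow> 'p) \<Rightarrow> complex) \<Rightarrow> ('j \<Rightarrow> 'p) \<Rightarrow> complex" where
  "coord P j K f \<omega> = (\<Sum>p\<in>P. K (\<omega> j) p * f (\<omega>(j := p)))"

lemma coord_kop: "coord P j K f \<omega> = kop P K (\<lambda>p. f (\<omega>(j := p))) (\<omega> j)"
  unfolding coord_def kop_def ..

lemma coord_upd: "coord P j K f (\<omega>(j := p)) = kop P K (\<lambda>p. f (\<omega>(j := p))) p"
  unfolding coord_def kop_def by simp

lemma lin_coord: "lin (coord P j K)"
  unfolding lin_def coord_def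
  by (auto simp: fun_eq_iff pointwise distrib_left sum.distrib sum_distrib_left intro!: sum.cong)

lemma coord_coord:
  assumes "\<And>g. kop P K (kop P K' g) = kop P K'' g"
  shows "coord P j K (coord P j K' f) = coord P j K'' f"
  by (rule ext) (simp add: coord_kop[of P j K] coord_upd assms coord_kop[of P j K''])

lemma coord_commute:
  assumes "j \<noteq> j'"
  shows "coord P j K (coord P j' K' f) = coord P j' K' (coord P j K f)"
proof
  fix \<omega>
  have "coord P j K (coord P j' K' f) \<omega>
     = (\<Sum>p\<in>P. \<Sum>p'\<in>P. K (\<omega> j) p * (K' (\<omega> j') p' * f (\<omega>(j := p, j' := p'))))"
    unfolding coord_def using assms by (simp add: sum_distrib_left)
  also have "\<dots> = (\<Sum>p'\<in>P. \<Sum>p\<in>P. K (\<omega> j) p * (K' (\<omega> j') p' * f (\<omega>(j := p, j' := p'))))"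
    by (rule sum.swap)
  also have "\<dots> = coord P j' K' (coord P j K f) \<omega>"
    unfolding coord_def using assms
    by (simp add: sum_distrib_left fun_upd_twist mult.left_commute)
  finally show "coord P j K (coord P j' K' f) \<omega> = coord P j' K' (coord P j K f) \<omega>" .
qed

lemma coord_mult:
  assumes "\<And>\<omega> p. m (\<omega>(j := p)) = m \<omega>"
  shows "coord P j K (m * f) = m * coord P j K f"
  unfolding coord_def by (rule ext) (simp add: pointwise assms sum_distrib_left mult.left_commute)

text \<open>Exchanging coordinate \<open>j\<close> with an independent value \<open>p\<close> is an
  involution on the pairs. This replaces splitting off a factor of the product, at the cost of a
  factor \<open>card P\<close>.\<close>

lemma sum_PiE_fiber:
  fixes F :: "('j \<Rightarrow> 'p) \<Rightarrow> 'a::comm_monoid_add"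
  assumes "j \<in> J"
  shows "(\<Sum>\<omega>\<in>PiE J (\<lambda>_. P). \<Sum>p\<in>P. F (\<omega>(j := p))) = (\<Sum>\<omega>\<in>PiE J (\<lambda>_. P). \<Sum>p\<in>P. F \<omega>)"
proof -
  have "(\<Sum>(\<omega>, p)\<in>PiE J (\<lambda>_. P) \<times> P. F (\<omega>(j := p))) = (\<Sum>(\<omega>, p)\<in>PiE J (\<lambda>_. P) \<times> P. F \<omega>)"
    by (rule sum.reindex_bij_witness[of _ "\<lambda>(\<omega>, p). (\<omega>(j := p), \<omega> j)" "\<lambda>(\<omega>, p). (\<omega>(j := p), \<omega> j)"])
      (use assms in \<open>auto simp: PiE_iff extensional_def\<close>)
  then show ?thesis by (simp add: sum.cartesian_product)
qed

lemma ip_PiE_fiber: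
  assumes "j \<in> J"
  shows "of_nat (card P) * ip (PiE J (\<lambda>_. P)) f g =
    (\<Sum>\<omega>\<in>PiE J (\<lambda>_. P). ip P (\<lambda>p. f (\<omega>(j := p))) (\<lambda>p. g (\<omega>(j := p))))"
  unfolding ip_def using sum_PiE_fiber[OF assms, where P = P and F = "\<lambda>\<omega>. cnj (f \<omega>) * g \<omega>"]
  by (simp add: sum_distrib_left)

lemma sqn_PiE_fiber:
  assumes "j \<in> J"
  shows "card P * sqn (PiE J (\<lambda>_. P)) f = (\<Sum>\<omega>\<in>PiE J (\<lambda>_. P). sqn P (\<lambda>p. f (\<omega>(j := p))))"
  unfolding sqn_def using sum_PiE_fiber[OF assms, where P = P and F = "\<lambda>\<omega>. (cmod (f \<omega>))\<^sup>2"]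
  by (simp add: sum_distrib_left)

lemma proj_coord:
  assumes "j \<in> J" "finite P" "P \<noteq> {}" "proj P (kop P K)"
  shows "proj (PiE J (\<lambda>_. P)) (coord P j K)"
proof -
  have "coord P j K (coord P j K f) = coord P j K f" for f
    by (rule coord_coord) (rule proj_idem[OF assms(4)])
  moreover have "ip (PiE J (\<lambda>_. P)) (coord P j K f) g = ip (PiE J (\<lambda>_. P)) f (coord P j K g)" for f g
  proof -
    have "of_nat (card P) * ip (PiE J (\<lambda>_. P)) (coord P j K f) g
        = of_nat (card P) * ip (PiE J (\<lambda>_. P)) f (coord P j K g)"
      unfolding ip_PiE_fiber[OF assms(1)] coord_upd
      by (intro sum.cong refl proj_self_adjoint[OF assms(4)])
    then show ?thesis using assms(2,3) by simp
  qed
  ultimately show ?thesis unfolding proj_def using lin_coord by auto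
qed

section \<open>A block with a hidden zero-sum tuple\<close>

definition wsign :: "'b set \<Rightarrow> 'b \<Rightarrow> complex" where
  "wsign x e = (if e \<in> x then -1 else 1)"

definition flip :: "'b set \<Rightarrow> 'b set \<Rightarrow> 'b set" where
  "flip E x = (E - x) \<union> (x - E)"

definition walsh :: "'b set \<Rightarrow> 'b set \<Rightarrow> complex" where
  "walsh \<chi> x = (\<Prod>e\<in>\<chi>. wsign x e)"

lemma wsign_flip: "wsign (flip E x) e = wsign E e * wsign x e"
  unfolding wsign_def flip_def by auto

lemma wsign_square [simp]: "wsign x e * wsign x e = 1" "cnj (wsign x e) = wsign x e"
  unfolding wsign_def by auto

lemma flip_flip [simp]: "flip E (flip E x) = x"
  unfolding flip_def by auto

lemma flip_subset: "E \<subseteq> B \<Longrightarrow> x \<subseteq> B \<Longrightarrow> flip E x \<subseteq> B"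
  unfolding flip_def by auto

lemma walsh_flip: "walsh \<chi> (flip E x) = walsh \<chi> E * walsh \<chi> x"
  unfolding walsh_def wsign_flip by (rule prod.distrib)

lemma walsh_single: "finite \<chi> \<Longrightarrow> walsh \<chi> {e} = (if e \<in> \<chi> then -1 else 1)"
  unfolding walsh_def wsign_def by (simp add: prod.delta)

lemma walsh_toggle:
  assumes "finite \<chi>"
  shows "walsh (flip {e} \<chi>) x = wsign x e * walsh \<chi> x"
proof (cases "e \<in> \<chi>")
  case True
  then have "flip {e} \<chi> = \<chi> - {e}" unfolding flip_def by auto
  moreover have "walsh \<chi> x = wsign x e * walsh (\<chi> - {e}) x"
    unfolding walsh_def using assms True by (rule prod.remove)
  ultimately show ?thesis by (simp add: mult.assoc[symmetric])
next
  case False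
  then have "flip {e} \<chi> = insert e \<chi>" unfolding flip_def by auto
  then show ?thesis using assms False by (simp add: walsh_def)
qed

lemma cnj_walsh [simp]: "cnj (walsh \<chi> x) = walsh \<chi> x"
  unfolding walsh_def by (simp_all add: prod.distrib[symmetric])

lemma cmod_walsh [simp]: "cmod (walsh \<chi> x) = 1"
  unfolding walsh_def prod_norm[symmetric] by (intro prod.neutral) (simp add: wsign_def)

text \<open>Each \<phi> C permutes \<open>S\<close> and multiplies the sign vector by that of
  \<open>C\<close>, so for every \<open>x\<close> exactly one \<open>C\<close> makes all signs 1.
  Double counting gives the fraction 2^-s; this takes the place of uniform independent bits
  throughout.\<close>

lemma card_all_one:
  fixes v :: "nat \<Rightarrow> 'x \<Rightarrow> complex"
  assumes "finite S" "\<And>C x. C \<subseteq> {..<s} \<Longrightarrow> x \<in> S \<Longrightarrow> \<phi> C x \<in> S \<and> \<phi> C (\<phi> C x) = x"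
    and v: "\<And>c x. c < s \<Longrightarrow> x \<in> S \<Longrightarrow> v c x = 1 \<or> v c x = -1"
    and \<phi>: "\<And>C c x. C \<subseteq> {..<s} \<Longrightarrow> c < s \<Longrightarrow> x \<in> S \<Longrightarrow> v c (\<phi> C x) = (if c \<in> C then -1 else 1) * v c x"
  shows "2 ^ s * card {x \<in> S. \<forall>c<s. v c x = 1} = card S"
proof -
  let ?Z = "\<lambda>x. \<forall>c<s. v c x = 1"
  have one: "(\<Sum>C\<in>Pow {..<s}. if ?Z (\<phi> C x) then 1 else 0) = (1::nat)" if x: "x \<in> S" for x
  proof -
    define C0 where "C0 = {c. c < s \<and> v c x = -1}"
    have "?Z (\<phi> C x) \<longleftrightarrow> C = C0" if C: "C \<subseteq> {..<s}" for C
    proof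
      assume Z: "?Z (\<phi> C x)"
      have "c \<in> C \<longleftrightarrow> v c x = -1" if "c < s" for c
        using Z that \<phi>[OF C that x] v[OF that x] by (cases "c \<in> C") auto
      then show "C = C0" using C unfolding C0_def by auto
    next
      assume "C = C0"
      then show "?Z (\<phi> C x)" using \<phi>[OF C _ x] v[OF _ x] unfolding C0_def by auto
    qed
    then have "(\<Sum>C\<in>Pow {..<s}. if ?Z (\<phi> C x) then 1 else (0::nat)) = (\<Sum>C\<in>Pow {..<s}. if C = C0 then 1 else 0)"
      by (intro sum.cong) auto
    also have "\<dots> = 1" unfolding C0_def by (subst sum.delta) auto
    finally show ?thesis .
  qed
  have "card S = (\<Sum>x\<in>S. \<Sum>C\<in>Pow {..<s}. if ?Z (\<phi> C x) then 1 else 0)"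
    using one by simp
  also have "\<dots> = (\<Sum>C\<in>Pow {..<s}. \<Sum>x\<in>S. if ?Z (\<phi> C x) then 1 else 0)" by (rule sum.swap)
  also have "\<dots> = (\<Sum>C\<in>Pow {..<s}. \<Sum>x\<in>S. if ?Z x then 1 else 0)"
  proof (rule sum.cong[OF refl])
    fix C assume "C \<in> Pow {..<s}"
    then show "(\<Sum>x\<in>S. if ?Z (\<phi> C x) then 1 else (0::nat)) = (\<Sum>x\<in>S. if ?Z x then 1 else 0)"
      using assms(2) by (intro sum.reindex_bij_witness[of _ "\<phi> C" "\<phi> C"]) auto
  qed
  also have "\<dots> = 2 ^ s * card {x \<in> S. ?Z x}"
    using assms(1) by (simp add: card_Pow sum.If_cases Int_def)
  finally show ?thesis by simp
qed

text \<open>\<open>h\<close> is the cut-off on the rows of a tuple that a character may touch. By a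
  union bound a character of degree at most \<open>R\<close> touches \<open>h - 1\<close> or more
  rows of a random tuple with probability at most 2^k * (R / N)^(h - 1), and \<open>eps_ge\<close>
  bounds twice this.\<close>

locale block_params =
  fixes k N s h R :: nat and eps :: real
  assumes N_pos: "0 < N" and h_pos: "0 < h" and h_lt: "2 * h < k"
    and R_pos: "0 < R" and eps_nonneg: "0 \<le> eps" and eps_le: "eps \<le> 1"
    and eps_ge: "2 * 2 ^ k * (R / N) ^ (h - 1) \<le> eps\<^sup>2"
begin

definition bits :: "(nat \<times> nat \<times> nat) set" where
  "bits = {..<k} \<times> {..<N} \<times> {..<2 * s}"

definition tup :: "(nat \<Rightarrow> nat) set" where
  "tup = PiE {..<k} (\<lambda>_. {..<N})"

text \<open>The XOR of bit \<open>c\<close> over the selected cells, as a sign. Positions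
  \<open>c < s\<close> form the first halves, positions \<open>s + c\<close> the label.\<close>

definition par :: "(nat \<Rightarrow> nat) \<Rightarrow> nat \<Rightarrow> (nat \<times> nat \<times> nat) set \<Rightarrow> complex" where
  "par A c x = (\<Prod>r<k. wsign x (r, A r, c))"

definition zero_sum :: "(nat \<Rightarrow> nat) \<Rightarrow> (nat \<times> nat \<times> nat) set set" where
  "zero_sum A = {x. x \<subseteq> bits \<and> (\<forall>c<s. par A c x = 1)}"

definition planted :: "((nat \<Rightarrow> nat) \<times> (nat \<times> nat \<times> nat) set) set" where
  "planted = Sigma tup zero_sum"

definition hits :: "(nat \<times> nat \<times> nat) set \<Rightarrow> (nat \<Rightarrow> nat) \<Rightarrow> nat" where
  "hits \<chi> A = card {r. r < k \<and> (\<exists>c. (r, A r, c) \<in> \<chi>)}"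

text \<open>The cut-off depends on the hidden tuple, so this is a function of the pair of tuple and
  content, even though an algorithm sees the content alone.\<close>

definition light :: "(nat \<times> nat \<times> nat) set \<Rightarrow> (nat \<Rightarrow> nat) \<times> (nat \<times> nat \<times> nat) set \<Rightarrow> complex" where
  "light \<chi> p = (if hits \<chi> (fst p) < h then walsh \<chi> (snd p) else 0)"

definition label_sign :: "nat set \<Rightarrow> (nat \<Rightarrow> nat) \<times> (nat \<times> nat \<times> nat) set \<Rightarrow> complex" where
  "label_sign \<eta> p = (\<Prod>c\<in>\<eta>. par (fst p) (s + c) (snd p))"

lemma finite_bits: "finite bits" and finite_tup: "finite tup"
  unfolding bits_def tup_def by (auto intro: finite_PiE)

lemma card_tup: "card tup = N ^ k"
  unfolding tup_def by (simp add: card_PiE)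

lemma finite_zero_sum: "finite (zero_sum A)"
  unfolding zero_sum_def using finite_bits by (auto intro: finite_subset[of _ "Pow bits"])

lemma finite_planted: "finite planted"
  unfolding planted_def using finite_tup finite_zero_sum by auto

lemma finite_sub_bits: "\<chi> \<subseteq> bits \<Longrightarrow> finite \<chi>"
  using finite_bits finite_subset by blast

lemma par_flip: "par A c (flip E x) = par A c E * par A c x"
  unfolding par_def wsign_flip by (rule prod.distrib)

lemma par_cases: "par A c x = 1 \<or> par A c x = -1"
proof -
  have "(\<Prod>r\<in>S. wsign x (r, A r, c)) = 1 \<or> (\<Prod>r\<in>S. wsign x (r, A r, c)) = -1" if "finite S" for S
    using that by (induction S) (auto simp: wsign_def)
  then show ?thesis unfolding par_def by simp
qed

lemma par_single: "r < k \<Longrightarrow> par A c' {(r, i, c)} = (if i = A r \<and> c' = c then -1 else 1)"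
proof -
  assume "r < k"
  have "par A c' {(r, i, c)} = (\<Prod>r'<k. if r' = r then (if i = A r \<and> c' = c then -1 else 1) else 1)"
    unfolding par_def wsign_def by (intro prod.cong) auto
  then show ?thesis using \<open>r < k\<close> by (simp add: prod.delta)
qed

lemma card_zero_sum:
  assumes A: "A \<in> tup"
  shows "2 ^ s * card (zero_sum A) = 2 ^ card bits"
proof -
  have k: "0 < k" using h_lt by simp
  define E :: "nat set \<Rightarrow> (nat \<times> nat \<times> nat) set" where "E C = {(0::nat, A 0, c) | c. c \<in> C}" for C
  have A0: "A 0 < N" using A k unfolding tup_def by (auto simp: PiE_def Pi_def)
  have E: "E C \<subseteq> bits" if "C \<subseteq> {..<s}" for C
    using that k A0 unfolding E_def bits_def by fastforce
  have par_E: "par A c (E C) = (if c \<in> C then -1 else 1)" for c C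
  proof -
    have "par A c (E C) = (\<Prod>r<k. if r = 0 then (if c \<in> C then -1 else 1) else 1)"
      unfolding par_def wsign_def E_def by (intro prod.cong) auto
    then show ?thesis using k by (simp add: prod.delta)
  qed
  have "2 ^ s * card {x \<in> Pow bits. \<forall>c<s. par A c x = 1} = card (Pow bits)"
    by (rule card_all_one[where \<phi> = "\<lambda>C. flip (E C)"])
      (use E finite_bits par_cases in \<open>auto simp: flip_subset par_flip par_E\<close>)
  moreover have "zero_sum A = {x \<in> Pow bits. \<forall>c<s. par A c x = 1}"
    unfolding zero_sum_def by auto
  ultimately show ?thesis using finite_bits by (simp add: card_Pow)
qed

lemma sum_zero_sum_eq_0:
  assumes "E \<subseteq> bits" "\<And>c. c < s \<Longrightarrow> par A c E = 1" "\<And>x. f (flip E x) = - f x"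
  shows "(\<Sum>x\<in>zero_sum A. f x) = (0 :: complex)"
proof -
  have "(\<Sum>x\<in>zero_sum A. f x) = (\<Sum>x\<in>zero_sum A. f (flip E x))"
    by (rule sum.reindex_bij_witness[of _ "flip E" "flip E"])
      (use assms(1,2) in \<open>auto simp: zero_sum_def par_flip flip_subset\<close>)
  also have "\<dots> = - (\<Sum>x\<in>zero_sum A. f x)" unfolding assms(3) by (rule sum_negf)
  finally show ?thesis by simp
qed

text \<open>Pigeonhole on the rows of the tuple. The row found is the one toggled in both
  orthogonality proofs.\<close>

lemma free_row:
  assumes "hits \<chi> A + hits \<chi>' A < k"
  obtains r where "r < k" "\<And>c. (r, A r, c) \<notin> \<chi>" "\<And>c. (r, A r, c) \<notin> \<chi>'"
proof -
  define X where "X \<psi> = {r. r < k \<and> (\<exists>c. (r, A r, c) \<in> \<psi>)}" for \<psi> :: "(nat \<times> nat \<times> nat) set"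
  have "card (X \<chi> \<union> X \<chi>') \<le> card (X \<chi>) + card (X \<chi>')" by (rule card_Un_le)
  also have "\<dots> < k" using assms unfolding hits_def X_def .
  finally have "X \<chi> \<union> X \<chi>' \<noteq> {..<k}" by (metis card_lessThan less_irrefl)
  moreover have "X \<chi> \<union> X \<chi>' \<subseteq> {..<k}" unfolding X_def by auto
  ultimately obtain r where r: "r < k" "r \<notin> X \<chi>" "r \<notin> X \<chi>'" by blast
  show ?thesis
    by (rule that[of r]) (use r in \<open>auto simp: X_def\<close>)
qed

lemma tup_less: "A \<in> tup \<Longrightarrow> r < k \<Longrightarrow> A r < N"
  unfolding tup_def by (auto simp: PiE_def Pi_def)

text \<open>A bit in which the characters differ is toggled. If it lies in the first half of a cell
  of the tuple, the same position in the tuple's cell of a free row is toggled too; this keeps the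
  sums zero and is seen by neither character.\<close>

lemma walsh_orth:
  assumes "\<chi> \<subseteq> bits" "\<chi>' \<subseteq> bits" "\<chi> \<noteq> \<chi>'" "A \<in> tup" "hits \<chi> A + hits \<chi>' A < k"
  shows "(\<Sum>x\<in>zero_sum A. walsh \<chi> x * walsh \<chi>' x) = 0"
proof -
  note fin = finite_sub_bits[OF assms(1)] finite_sub_bits[OF assms(2)]
  obtain r i c where e: "((r, i, c) \<in> \<chi>) \<noteq> ((r, i, c) \<in> \<chi>')"
    using assms(3) by auto
  then have bit: "(r, i, c) \<in> bits" using assms(1,2) by auto
  then have r: "r < k" and c: "c < 2 * s" by (auto simp: bits_def)
  obtain r' where r': "r' < k" "\<And>c. (r', A r', c) \<notin> \<chi>" "\<And>c. (r', A r', c) \<notin> \<chi>'"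
    using free_row[OF assms(5)] by blast
  define E where "E = (if A r = i \<and> c < s then flip {(r, i, c)} {(r', A r', c)} else {(r, i, c)})"
  have bit': "(r', A r', c) \<in> bits" using r'(1) c tup_less[OF assms(4)] by (auto simp: bits_def)
  have E: "E \<subseteq> bits" unfolding E_def using flip_subset[of "{(r, i, c)}" bits "{(r', A r', c)}"] bit bit' by simp
  have par: "par A c' E = 1" if "c' < s" for c'
    unfolding E_def using that r r'(1) by (auto simp: par_flip par_single)
  have "walsh \<chi> E * walsh \<chi>' E = -1"
    unfolding E_def using e r' fin by (auto simp: walsh_flip walsh_single)
  moreover have "walsh \<chi> (flip E x) * walsh \<chi>' (flip E x)
      = (walsh \<chi> E * walsh \<chi>' E) * (walsh \<chi> x * walsh \<chi>' x)" for x
    unfolding walsh_flip by (simp only: mult.assoc mult.left_commute)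
  ultimately have "walsh \<chi> (flip E x) * walsh \<chi>' (flip E x) = - (walsh \<chi> x * walsh \<chi>' x)" for x
    by simp
  then show ?thesis by (intro sum_zero_sum_eq_0[OF E par])
qed

text \<open>Toggling a label bit \<open>c \<in> \<eta>\<close> in the tuple's cell of a free row
  affects neither the first halves nor the two characters, but reverses
  \<open>label_sign \<eta>\<close>.\<close>

lemma walsh_label_orth:
  assumes "\<chi> \<subseteq> bits" "\<chi>' \<subseteq> bits" "\<eta> \<subseteq> {..<s}" "\<eta> \<noteq> {}" "A \<in> tup" "hits \<chi> A + hits \<chi>' A < k"
  shows "(\<Sum>x\<in>zero_sum A. walsh \<chi> x * (label_sign \<eta> (A, x) * walsh \<chi>' x)) = 0"
proof -
  note fin = finite_sub_bits[OF assms(1)] finite_sub_bits[OF assms(2)] finite_subset[OF assms(3)]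
  obtain c where c: "c \<in> \<eta>" using assms(4) by auto
  then have "c < s" using assms(3) by auto
  obtain r where r: "r < k" "\<And>c. (r, A r, c) \<notin> \<chi>" "\<And>c. (r, A r, c) \<notin> \<chi>'"
    using free_row[OF assms(6)] by blast
  define E where "E = {(r, A r, s + c)}"
  have E: "E \<subseteq> bits" using r(1) \<open>c < s\<close> tup_less[OF assms(5)] by (auto simp: bits_def E_def)
  have par: "par A c' E = 1" if "c' < s" for c'
    unfolding E_def using that r(1) by (auto simp: par_single)
  have "label_sign \<eta> (A, flip E x) = - label_sign \<eta> (A, x)" for x
  proof -
    have "label_sign \<eta> (A, flip E x) = (\<Prod>c'\<in>\<eta>. (if c' = c then -1 else 1)) * label_sign \<eta> (A, x)"
      unfolding label_sign_def E_def using r(1) by (simp add: par_flip par_single prod.distrib)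
    also have "(\<Prod>c'\<in>\<eta>. (if c' = c then -1 else 1)) = (-1 :: complex)"
      using c fin(3) by (simp add: prod.delta)
    finally show ?thesis by simp
  qed
  moreover have "walsh \<chi> E = 1" "walsh \<chi>' E = 1"
    using r fin by (auto simp: E_def walsh_single)
  ultimately have "walsh \<chi> (flip E x) * (label_sign \<eta> (A, flip E x) * walsh \<chi>' (flip E x))
      = - (walsh \<chi> x * (label_sign \<eta> (A, x) * walsh \<chi>' x))" for x
    by (simp add: walsh_flip)
  then show ?thesis by (intro sum_zero_sum_eq_0[OF E par])
qed

lemma sum_planted: "(\<Sum>p\<in>planted. f p) = (\<Sum>A\<in>tup. \<Sum>x\<in>zero_sum A. f (A, x))"
  unfolding planted_def using finite_tup finite_zero_sum by (subst sum.Sigma) (auto simp: split_def)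

lemma light_orth:
  assumes "\<chi> \<subseteq> bits" "\<chi>' \<subseteq> bits" "\<chi> \<noteq> \<chi>'"
  shows "ip planted (light \<chi>) (light \<chi>') = 0"
  unfolding ip_def sum_planted
proof (rule sum.neutral, rule ballI)
  fix A assume A: "A \<in> tup"
  show "(\<Sum>x\<in>zero_sum A. cnj (light \<chi> (A, x)) * light \<chi>' (A, x)) = 0"
  proof (cases "hits \<chi> A < h \<and> hits \<chi>' A < h")
    case True
    then have "hits \<chi> A + hits \<chi>' A < k" using h_lt by simp
    then show ?thesis using walsh_orth[OF assms A] True by (simp add: light_def)
  qed (auto simp: light_def)
qed

lemma light_label_orth:
  assumes "\<chi> \<subseteq> bits" "\<chi>' \<subseteq> bits" "\<eta> \<subseteq> {..<s}" "\<eta> \<noteq> {}"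
  shows "ip planted (light \<chi>) (label_sign \<eta> * light \<chi>') = 0"
  unfolding ip_def sum_planted
proof (rule sum.neutral, rule ballI)
  fix A assume A: "A \<in> tup"
  show "(\<Sum>x\<in>zero_sum A. cnj (light \<chi> (A, x)) * (label_sign \<eta> * light \<chi>') (A, x)) = 0"
  proof (cases "hits \<chi> A < h \<and> hits \<chi>' A < h")
    case True
    then have "hits \<chi> A + hits \<chi>' A < k" using h_lt by simp
    then show ?thesis using walsh_label_orth[OF assms A] True by (simp add: light_def pointwise)
  qed (auto simp: light_def pointwise)
qed

sublocale light: orthogonal_family planted light "Pow bits"
  by unfold_locales (auto simp: finite_planted finite_bits light_orth)

text \<open>Union bound over the sets of \<open>m\<close> rows in which the tuple meets \<chi>; in
  each such row at most \<open>card \<chi>\<close> of the \<open>N\<close> cells qualify.\<close>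

lemma card_hits_ge:
  assumes "finite \<chi>" "m \<le> k"
  shows "card {A \<in> tup. m \<le> hits \<chi> A} * N ^ m \<le> 2 ^ k * card \<chi> ^ m * N ^ k"
proof -
  define S where "S r = {i. i < N \<and> (\<exists>c. (r, i, c) \<in> \<chi>)}" for r
  define Y where "Y K = {A \<in> tup. \<forall>r\<in>K. A r \<in> S r}" for K
  let ?K = "{K. K \<subseteq> {..<k} \<and> card K = m}"
  have S: "card (S r) \<le> card \<chi>" for r
  proof -
    have "S r \<subseteq> (\<lambda>(r, i, c). i) ` \<chi>" unfolding S_def by force
    then show ?thesis using assms(1) by (meson card_image_le card_mono finite_imageI le_trans)
  qed
  have Y: "card (Y K) * N ^ m \<le> card \<chi> ^ m * N ^ k" if "K \<in> ?K" for K
  proof -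
    have K: "K \<subseteq> {..<k}" "card K = m" using that by auto
    have "Y K = PiE {..<k} (\<lambda>r. if r \<in> K then S r else {..<N})"
    proof (rule Set.set_eqI)
      fix A
      have "r < k" if "r \<in> K" for r using that K by auto
      then show "A \<in> Y K \<longleftrightarrow> A \<in> PiE {..<k} (\<lambda>r. if r \<in> K then S r else {..<N})"
        unfolding Y_def tup_def S_def PiE_iff mem_Collect_eq by (simp split: if_split) blast
    qed
    then have "card (Y K) = (\<Prod>r<k. if r \<in> K then card (S r) else N)"
      by (simp add: card_PiE if_distrib cong: if_cong)
    also have "\<dots> = (\<Prod>r\<in>K. card (S r)) * N ^ (k - m)"
      using K by (simp add: prod.If_cases Int_absorb1 Diff_eq[symmetric] card_Diff_subset finite_subset)
    also have "\<dots> \<le> card \<chi> ^ m * N ^ (k - m)"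
      using S prod_mono[of K "\<lambda>r. card (S r)" "\<lambda>_. card \<chi>"] K by simp
    finally have "card (Y K) * N ^ m \<le> card \<chi> ^ m * N ^ (k - m) * N ^ m" by simp
    then show ?thesis using assms(2) by (simp add: mult.assoc power_add[symmetric])
  qed
  have "{A \<in> tup. m \<le> hits \<chi> A} \<subseteq> (\<Union>K\<in>?K. Y K)"
  proof
    fix A assume "A \<in> {A \<in> tup. m \<le> hits \<chi> A}"
    then have A: "A \<in> tup" "m \<le> hits \<chi> A" by auto
    obtain K where K: "K \<subseteq> {r. r < k \<and> (\<exists>c. (r, A r, c) \<in> \<chi>)}" "card K = m"
      using A(2) unfolding hits_def by (meson obtain_subset_with_card_n)
    then have "A \<in> Y K" using A(1) tup_less[OF A(1)] unfolding Y_def S_def by auto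
    then show "A \<in> (\<Union>K\<in>?K. Y K)" using K by auto
  qed
  moreover have finK: "finite ?K" by (rule finite_subset[of _ "Pow {..<k}"]) auto
  moreover have "finite (Y K)" for K using finite_tup unfolding Y_def by simp
  ultimately have "card {A \<in> tup. m \<le> hits \<chi> A} \<le> card (\<Union>K\<in>?K. Y K)"
    by (intro card_mono) auto
  also have "\<dots> \<le> (\<Sum>K\<in>?K. card (Y K))" using finK by (rule card_UN_le)
  finally have "card {A \<in> tup. m \<le> hits \<chi> A} * N ^ m \<le> (\<Sum>K\<in>?K. card (Y K)) * N ^ m" by simp
  also have "\<dots> = (\<Sum>K\<in>?K. card (Y K) * N ^ m)" by (rule sum_distrib_right)
  also have "\<dots> \<le> card ?K * (card \<chi> ^ m * N ^ k)"
    using sum_bounded_above[of ?K "\<lambda>K. card (Y K) * N ^ m"] Y by simp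
  also have "\<dots> \<le> 2 ^ k * (card \<chi> ^ m * N ^ k)"
    using card_mono[of "Pow {..<k}" ?K] by (intro mult_right_mono) (auto simp: card_Pow)
  finally show ?thesis by simp
qed

lemma card_hits_ge_le:
  assumes "\<chi> \<subseteq> bits" "card \<chi> \<le> R"
  shows "2 * real (card {A \<in> tup. h - 1 \<le> hits \<chi> A}) \<le> eps\<^sup>2 * N ^ k"
proof -
  have fin: "finite \<chi>" using finite_sub_bits[OF assms(1)] .
  have "card {A \<in> tup. h - 1 \<le> hits \<chi> A} * N ^ (h - 1) \<le> 2 ^ k * card \<chi> ^ (h - 1) * N ^ k"
    using card_hits_ge[OF fin, of "h - 1"] h_lt by simp
  also have "\<dots> \<le> 2 ^ k * R ^ (h - 1) * N ^ k"
    using assms(2) by (intro mult_left_mono mult_right_mono power_mono) auto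
  finally have "real (card {A \<in> tup. h - 1 \<le> hits \<chi> A} * N ^ (h - 1)) \<le> real (2 ^ k * R ^ (h - 1) * N ^ k)"
    by (rule of_nat_mono)
  then have "real (card {A \<in> tup. h - 1 \<le> hits \<chi> A}) * N ^ (h - 1) \<le> 2 ^ k * R ^ (h - 1) * N ^ k"
    by simp
  then have "real (card {A \<in> tup. h - 1 \<le> hits \<chi> A}) \<le> 2 ^ k * (R / N) ^ (h - 1) * N ^ k"
    using N_pos by (simp add: field_simps power_divide)
  then have "2 * real (card {A \<in> tup. h - 1 \<le> hits \<chi> A}) \<le> 2 * 2 ^ k * (R / N) ^ (h - 1) * N ^ k"
    by simp
  also have "\<dots> \<le> eps\<^sup>2 * N ^ k"
    using eps_ge by (intro mult_right_mono) auto
  finally show ?thesis .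
qed

definition fiber :: nat where
  "fiber = card (zero_sum (SOME A. A \<in> tup))"

lemma card_zero_sum_eq: "A \<in> tup \<Longrightarrow> card (zero_sum A) = fiber"
proof -
  assume A: "A \<in> tup"
  have "(SOME A. A \<in> tup) \<in> tup" by (rule someI[of "\<lambda>A. A \<in> tup", OF A])
  then have "2 ^ s * card (zero_sum A) = 2 ^ s * fiber"
    unfolding fiber_def by (simp only: card_zero_sum[OF A] card_zero_sum)
  then show ?thesis by simp
qed

lemma tup_nonempty: "tup \<noteq> {}"
  using card_tup N_pos by (metis card.empty power_not_zero less_irrefl)

lemma fiber_pos: "0 < fiber"
proof -
  obtain A where "A \<in> tup" using tup_nonempty by auto
  then have "2 ^ s * fiber = 2 ^ card bits" using card_zero_sum card_zero_sum_eq by metis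
  then show ?thesis by (metis gr0I mult_0_right power_not_zero zero_neq_numeral)
qed

lemma sqn_light: "sqn planted (light \<chi>) = fiber * card {A \<in> tup. hits \<chi> A < h}"
proof -
  have "sqn planted (light \<chi>) = (\<Sum>A\<in>tup. if hits \<chi> A < h then real fiber else 0)"
    unfolding sqn_def sum_planted light_def by (intro sum.cong) (auto simp: card_zero_sum_eq)
  then show ?thesis using finite_tup by (simp add: sum.If_cases Int_def)
qed

text \<open>The uncut character has squared norm \<open>fiber * N ^ k\<close>, of which the cut-off
  removes at most half. This keeps the normalisation harmless and costs the factor 2 in
  \<open>eps_ge\<close>.\<close>

lemma sqn_light_ge:
  assumes "\<chi> \<subseteq> bits" "card \<chi> \<le> R"
  shows "fiber * N ^ k \<le> 2 * sqn planted (light \<chi>)"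
proof -
  have "tup = {A \<in> tup. hits \<chi> A < h} \<union> {A \<in> tup. h \<le> hits \<chi> A}" by auto
  then have "N ^ k \<le> card {A \<in> tup. hits \<chi> A < h} + card {A \<in> tup. h \<le> hits \<chi> A}"
    using card_Un_le card_tup by metis
  moreover have "card {A \<in> tup. h \<le> hits \<chi> A} \<le> card {A \<in> tup. h - 1 \<le> hits \<chi> A}"
    using finite_tup by (intro card_mono) auto
  moreover have "2 * real (card {A \<in> tup. h - 1 \<le> hits \<chi> A}) \<le> N ^ k"
    using card_hits_ge_le[OF assms] mult_right_mono[of "eps\<^sup>2" 1 "N ^ k"] power_le_one[OF eps_nonneg eps_le, of 2]
    by simp
  ultimately have "real (N ^ k) \<le> 2 * card {A \<in> tup. hits \<chi> A < h}" by linarith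
  then have "real fiber * real (N ^ k) \<le> real fiber * real (2 * card {A \<in> tup. hits \<chi> A < h})"
    by (intro mult_left_mono) auto
  then show ?thesis unfolding sqn_light by simp
qed

lemma ip_light_nonzero: "\<chi> \<subseteq> bits \<Longrightarrow> card \<chi> \<le> R \<Longrightarrow> ip planted (light \<chi>) (light \<chi>) \<noteq> 0"
proof -
  assume "\<chi> \<subseteq> bits" "card \<chi> \<le> R"
  then have "fiber * N ^ k \<le> 2 * sqn planted (light \<chi>)" by (rule sqn_light_ge)
  moreover have "0 < real (fiber * N ^ k)" using fiber_pos N_pos by simp
  ultimately have "sqn planted (light \<chi>) \<noteq> 0" by linarith
  then show ?thesis unfolding ip_self by simp
qed

section \<open>The filtration by degree in one block\<close>

definition small :: "nat \<Rightarrow> (nat \<times> nat \<times> nat) set set" where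
  "small r = {\<chi>. \<chi> \<subseteq> bits \<and> card \<chi> \<le> r}"

abbreviation block_kernel where "block_kernel r \<equiv> kernel planted light (small r)"

abbreviation Qb where "Qb r \<equiv> kop planted (block_kernel r)"

lemma small_sub: "small r \<subseteq> Pow bits"
  unfolding small_def by auto

lemma finite_small: "finite (small r)"
  using small_sub finite_bits by (meson finite_Pow_iff finite_subset)

lemma Qb_label: "\<eta> \<subseteq> {..<s} \<Longrightarrow> \<eta> \<noteq> {} \<Longrightarrow> Qb r (label_sign \<eta> * Qb r f) = 0"
proof -
  assume \<eta>: "\<eta> \<subseteq> {..<s}" "\<eta> \<noteq> {}"
  have "coef planted light \<chi> (label_sign \<eta> * Qb r f) = 0" if "\<chi> \<in> small r" for \<chi>
  proof -
    have "label_sign \<eta> * Qb r f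
        = (\<Sum>\<chi>'\<in>small r. (\<lambda>_. coef planted light \<chi>' f) * (label_sign \<eta> * light \<chi>'))"
      unfolding kop_kernel sum_distrib_left by (simp only: mult.left_commute)
    then have "ip planted (light \<chi>) (label_sign \<eta> * Qb r f) = 0"
      using light_label_orth[OF _ _ \<eta>, of \<chi>] that
      by (simp only: ip_sum_right ip_const_right) (auto simp: small_def intro!: sum.neutral)
    then show ?thesis unfolding coef_def by simp
  qed
  then have "Qb r (label_sign \<eta> * Qb r f) = (\<Sum>\<chi>\<in>small r. (\<lambda>_. 0) * light \<chi>)"
    unfolding kop_kernel[of _ _ _ "label_sign \<eta> * Qb r f"] by (intro sum.cong) auto
  then show ?thesis by (simp add: fun_eq_iff sum_fun_apply pointwise)
qed

lemma Qb_one: "Qb r 1 = 1"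
proof -
  have "light {} = 1" using h_pos by (simp add: fun_eq_iff light_def hits_def walsh_def pointwise)
  moreover have "Qb r (light {}) = light {}"
    using ip_light_nonzero[of "{}"] by (intro light.fproj_member small_sub) (auto simp: small_def)
  ultimately show ?thesis by simp
qed

lemma hits_toggle: "hits (flip {e} \<chi>) A \<le> Suc (hits \<chi> A)"
proof -
  have "{r. r < k \<and> (\<exists>c. (r, A r, c) \<in> flip {e} \<chi>)} \<subseteq> insert (fst e) {r. r < k \<and> (\<exists>c. (r, A r, c) \<in> \<chi>)}"
  proof
    fix r assume "r \<in> {r. r < k \<and> (\<exists>c. (r, A r, c) \<in> flip {e} \<chi>)}"
    then obtain c where r: "r < k" "(r, A r, c) \<in> flip {e} \<chi>" by blast
    from r(2) consider "(r, A r, c) = e" | "(r, A r, c) \<in> \<chi>" unfolding flip_def by blast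
    then show "r \<in> insert (fst e) {r. r < k \<and> (\<exists>c. (r, A r, c) \<in> \<chi>)}"
    proof cases
      case 1
      then have "fst e = r" by (metis fst_conv)
      then show ?thesis by simp
    qed (use r(1) in auto)
  qed
  then have "hits (flip {e} \<chi>) A \<le> card (insert (fst e) {r. r < k \<and> (\<exists>c. (r, A r, c) \<in> \<chi>)})"
    unfolding hits_def by (intro card_mono) auto
  also have "\<dots> \<le> Suc (hits \<chi> A)"
    unfolding hits_def by (simp add: card_insert_if)
  finally show ?thesis .
qed

text \<open>The sign of a bit toggles this bit in every character and so raises the degree by at
  most one. The cut-offs before and after can disagree only at tuples with at least
  \<open>h - 1\<close> touched rows. The resulting defects \<open>D \<chi>\<close> are still
  pairwise orthogonal and each is small against \<open>light \<chi>\<close>, so their squared norms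
  add up to the bound.\<close>

lemma Qb_step:
  assumes e: "e \<in> bits" and r: "Suc r < R"
  defines "\<sigma> \<equiv> \<lambda>p. wsign (snd p) e"
  shows "sqn planted (\<sigma> * Qb r f - Qb (Suc r) (\<sigma> * Qb r f)) \<le> eps\<^sup>2 * sqn planted (Qb r f)"
proof -
  define tg where "tg \<chi> = flip {e} \<chi>" for \<chi>
  define a where "a \<chi> = coef planted light \<chi> f" for \<chi>
  define D where "D \<chi> p = (of_bool (hits \<chi> (fst p) < h) - of_bool (hits (tg \<chi>) (fst p) < h)) * walsh (tg \<chi>) (snd p)"
    for \<chi> and p :: "(nat \<Rightarrow> nat) \<times> (nat \<times> nat \<times> nat) set"
  define u where "u = (\<Sum>\<chi>\<in>small r. (\<lambda>_. a \<chi>) * light (tg \<chi>))"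
  define w where "w = (\<Sum>\<chi>\<in>small r. (\<lambda>_. a \<chi>) * D \<chi>)"
  have tg: "tg \<chi> \<subseteq> bits" "card (tg \<chi>) \<le> Suc (card \<chi>)" "finite \<chi>" if "\<chi> \<subseteq> bits" for \<chi>
  proof -
    show "tg \<chi> \<subseteq> bits" unfolding tg_def using that e by (intro flip_subset) auto
    show fin: "finite \<chi>" using finite_sub_bits[OF that] .
    have "card (tg \<chi>) \<le> card (insert e \<chi>)"
      unfolding tg_def flip_def using fin by (intro card_mono) auto
    also have "\<dots> \<le> Suc (card \<chi>)" using fin by (simp add: card_insert_if)
    finally show "card (tg \<chi>) \<le> Suc (card \<chi>)" .
  qed
  have tg_inj: "tg \<chi> = tg \<chi>' \<Longrightarrow> \<chi> = \<chi>'" for \<chi> \<chi>'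
    unfolding tg_def by (metis flip_flip)
  have "\<sigma> * light \<chi> = light (tg \<chi>) + D \<chi>" if "\<chi> \<in> small r" for \<chi>
    using that tg(3) unfolding small_def
    by (auto simp: fun_eq_iff pointwise \<sigma>_def light_def D_def tg_def walsh_toggle)
  then have "\<sigma> * Qb r f = (\<Sum>\<chi>\<in>small r. (\<lambda>_. a \<chi>) * light (tg \<chi>) + (\<lambda>_. a \<chi>) * D \<chi>)"
    unfolding kop_kernel sum_distrib_left a_def mult.left_commute[of \<sigma>]
    by (intro sum.cong) (auto simp: distrib_left)
  then have split: "\<sigma> * Qb r f = u + w"
    unfolding u_def w_def by (simp only: sum.distrib)
  have "Qb (Suc r) (light (tg \<chi>)) = light (tg \<chi>)" if "\<chi> \<in> small r" for \<chi>
  proof (rule light.fproj_member[OF small_sub])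
    have "\<chi> \<subseteq> bits" "card \<chi> \<le> r" using that by (auto simp: small_def)
    then have t: "tg \<chi> \<subseteq> bits" "card (tg \<chi>) \<le> Suc r" using tg(1,2)[of \<chi>] by auto
    then show "tg \<chi> \<in> small (Suc r)" by (simp add: small_def)
    show "ip planted (light (tg \<chi>)) (light (tg \<chi>)) \<noteq> 0"
      using t r by (intro ip_light_nonzero) auto
  qed
  then have "Qb (Suc r) u = u"
    unfolding u_def lin_sum[OF lin_kop] lin_const[OF lin_kop] by (intro sum.cong) auto
  then have "\<sigma> * Qb r f - Qb (Suc r) (\<sigma> * Qb r f) = w - Qb (Suc r) w"
    unfolding split lin_add[OF lin_kop] by simp
  then have "sqn planted (\<sigma> * Qb r f - Qb (Suc r) (\<sigma> * Qb r f)) \<le> sqn planted w"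
    using sqn_coproj_le[OF light.proj_fproj[OF small_sub], of w "Suc r"] by simp
  also have "sqn planted w = (\<Sum>\<chi>\<in>small r. sqn planted ((\<lambda>_. a \<chi>) * D \<chi>))"
    unfolding w_def
  proof (rule sqn_sum_orth[OF finite_small])
    fix \<chi> \<chi>' assume \<chi>: "\<chi> \<in> small r" "\<chi>' \<in> small r" "\<chi> \<noteq> \<chi>'"
    have "ip planted (D \<chi>) (D \<chi>') = 0"
      unfolding ip_def sum_planted
    proof (rule sum.neutral, rule ballI)
      fix A assume A: "A \<in> tup"
      show "(\<Sum>x\<in>zero_sum A. cnj (D \<chi> (A, x)) * D \<chi>' (A, x)) = 0"
      proof (cases "(hits \<chi> A < h) \<noteq> (hits (tg \<chi>) A < h) \<and> (hits \<chi>' A < h) \<noteq> (hits (tg \<chi>') A < h)")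
        case True
        \<comment> \<open>On the common support of two defects the toggled characters may touch
          \<open>h\<close> rows, one more than the cut-off admits; \<open>2 * h < k\<close> still
          leaves a free row.\<close>
        have "hits (tg \<chi>) A \<le> h" "hits (tg \<chi>') A \<le> h"
          using True hits_toggle[of e \<chi> A] hits_toggle[of e \<chi>' A] unfolding tg_def by linarith+
        then have lt: "hits (tg \<chi>) A + hits (tg \<chi>') A < k" using h_lt by simp
        have "(\<Sum>x\<in>zero_sum A. walsh (tg \<chi>) x * walsh (tg \<chi>') x) = 0"
          using \<chi> tg(1) tg_inj by (intro walsh_orth A lt) (auto simp: small_def)
        define d where "d \<chi> = (of_bool (hits \<chi> A < h) - of_bool (hits (tg \<chi>) A < h) :: complex)" for \<chi>
        have d: "cnj (d \<chi>) = d \<chi>" for \<chi> by (simp add: d_def)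
        have "(\<Sum>x\<in>zero_sum A. cnj (D \<chi> (A, x)) * D \<chi>' (A, x))
            = (\<Sum>x\<in>zero_sum A. d \<chi> * d \<chi>' * (walsh (tg \<chi>) x * walsh (tg \<chi>') x))"
          unfolding D_def fst_conv snd_conv d_def[symmetric] complex_cnj_mult d cnj_walsh
          by (simp only: mult.assoc mult.left_commute)
        also have "\<dots> = d \<chi> * d \<chi>' * 0"
          unfolding sum_distrib_left[symmetric] using \<open>(\<Sum>x\<in>zero_sum A. walsh (tg \<chi>) x * walsh (tg \<chi>') x) = 0\<close> by simp
        finally show ?thesis by simp
      qed (auto simp: D_def)
    qed
    then show "ip planted ((\<lambda>_. a \<chi>) * D \<chi>) ((\<lambda>_. a \<chi>') * D \<chi>') = 0"
      by (simp add: ip_const_left ip_const_right)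
  qed
  also have "\<dots> \<le> (\<Sum>\<chi>\<in>small r. eps\<^sup>2 * ((cmod (a \<chi>))\<^sup>2 * sqn planted (light \<chi>)))"
  proof (intro sum_mono)
    fix \<chi> assume "\<chi> \<in> small r"
    then have \<chi>: "\<chi> \<subseteq> bits" "card \<chi> \<le> R" using r by (auto simp: small_def)
    have "sqn planted (D \<chi>) \<le> (\<Sum>A\<in>tup. if h - 1 \<le> hits \<chi> A then real fiber else 0)"
      unfolding sqn_def sum_planted
    proof (intro sum_mono)
      fix A assume A: "A \<in> tup"
      show "(\<Sum>x\<in>zero_sum A. (cmod (D \<chi> (A, x)))\<^sup>2) \<le> (if h - 1 \<le> hits \<chi> A then real fiber else 0)"
      proof (cases "h - 1 \<le> hits \<chi> A")
        case True
        have "(\<Sum>x\<in>zero_sum A. (cmod (D \<chi> (A, x)))\<^sup>2) \<le> (\<Sum>x\<in>zero_sum A. 1)"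
          by (intro sum_mono) (auto simp: D_def norm_mult)
        then show ?thesis using True card_zero_sum_eq[OF A] by simp
      next
        case False
        then have "hits \<chi> A < h" "hits (tg \<chi>) A < h" using hits_toggle[of e \<chi> A] unfolding tg_def by linarith+
        then show ?thesis using False by (simp add: D_def)
      qed
    qed
    also have "\<dots> = fiber * card {A \<in> tup. h - 1 \<le> hits \<chi> A}"
      using finite_tup by (simp add: sum.If_cases Int_def)
    finally have "2 * sqn planted (D \<chi>) \<le> real fiber * (2 * real (card {A \<in> tup. h - 1 \<le> hits \<chi> A}))" by simp
    also have "\<dots> \<le> fiber * (eps\<^sup>2 * N ^ k)"
      using card_hits_ge_le[OF \<chi>] by (intro mult_left_mono) auto
    also have "\<dots> = eps\<^sup>2 * (fiber * N ^ k)" by simp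
    also have "\<dots> \<le> eps\<^sup>2 * (2 * sqn planted (light \<chi>))"
      using sqn_light_ge[OF \<chi>] by (intro mult_left_mono) auto
    finally have "sqn planted (D \<chi>) \<le> eps\<^sup>2 * sqn planted (light \<chi>)" by simp
    then have "(cmod (a \<chi>))\<^sup>2 * sqn planted (D \<chi>) \<le> (cmod (a \<chi>))\<^sup>2 * (eps\<^sup>2 * sqn planted (light \<chi>))"
      by (intro mult_left_mono) auto
    then show "sqn planted ((\<lambda>_. a \<chi>) * D \<chi>) \<le> eps\<^sup>2 * ((cmod (a \<chi>))\<^sup>2 * sqn planted (light \<chi>))"
      unfolding sqn_const by (simp add: mult.left_commute)
  qed
  also have "\<dots> = eps\<^sup>2 * sqn planted (Qb r f)"
    unfolding light.sqn_fproj[OF small_sub] a_def by (simp add: sum_distrib_left)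
  finally show ?thesis .
qed

end

section \<open>Amplitudes of a quantum query algorithm\<close>

definition amp ::
  "nat \<Rightarrow> nat \<Rightarrow> (nat \<Rightarrow> complex mat) \<Rightarrow> bool list \<Rightarrow> nat \<Rightarrow> nat \<Rightarrow> complex" where
  "amp n m U x t k = query_state n m U x t $ k"

lemma flip_answer_less: "k < space_dim n m \<Longrightarrow> flip_answer k < space_dim n m"
proof -
  assume k: "k < space_dim n m"
  obtain a where a: "space_dim n m = 2 * a" unfolding space_dim_def by (metis mult.assoc)
  show ?thesis
  proof (cases "even k")
    case True
    then obtain b where "k = 2 * b" by (rule evenE)
    then show ?thesis using k a by (simp add: flip_answer_def)
  next
    case False
    then show ?thesis using k by (simp add: flip_answer_def)
  qed
qed

lemma flip_answer_flip_answer [simp]: "flip_answer (flip_answer k) = k"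
proof (cases "even k")
  case False
  then obtain b where "k = 2 * b + 1" by (rule oddE)
  then show ?thesis by (simp add: flip_answer_def)
qed (simp add: flip_answer_def)

lemma query_index_flip_answer [simp]: "query_index n (flip_answer k) = query_index n k"
proof -
  have "flip_answer k div 2 = k div 2"
  proof (cases "even k")
    case False
    then obtain b where "k = 2 * b + 1" by (rule oddE)
    then show ?thesis by (simp add: flip_answer_def)
  qed (simp add: flip_answer_def)
  then show ?thesis unfolding query_index_def by simp
qed

lemma oracle_perm_less: "k < space_dim n m \<Longrightarrow> oracle_perm n x k < space_dim n m"
  unfolding oracle_perm_def by (simp add: flip_answer_less)

lemma oracle_perm_oracle_perm [simp]: "oracle_perm n x (oracle_perm n x k) = k"
  by (cases "query_index n k < n \<and> x ! query_index n k") (auto simp: oracle_perm_def)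

lemma of_real_cmod_square: "complex_of_real ((cmod z)\<^sup>2) = cnj z * z"
  using complex_norm_square[of z] by (simp add: mult.commute)

lemma isometricD:
  "isometric d u \<Longrightarrow> (\<Sum>k<d. (cmod (\<Sum>k'<d. u k k' * v k'))\<^sup>2) = (\<Sum>k<d. (cmod (v k))\<^sup>2)"
  unfolding isometric_def by blast

lemma isometric_unitary:
  assumes "unitary_mat d U"
  shows "isometric d (\<lambda>k k'. U $$ (k, k'))"
  unfolding isometric_def
proof
  fix v :: "nat \<Rightarrow> complex"
  have U: "U \<in> carrier_mat d d" "mat_adjoint U * U = 1\<^sub>m d"
    using assms unfolding unitary_mat_def by auto
  have entry: "(\<Sum>k<d. cnj (U $$ (k, i)) * U $$ (k, j)) = (if i = j then 1 else 0)" if "i < d" "j < d" for i j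
  proof -
    have adj: "mat_adjoint U $$ (i, k) = cnj (U $$ (k, i))" if "k < d" for k
      using U(1) \<open>i < d\<close> that by (simp add: mat_adjoint_def mat_of_rows_index)
    have dim: "dim_row (mat_adjoint U) = d" "dim_col (mat_adjoint U) = d"
      using U(1) by (auto simp: mat_adjoint_def)
    have "(mat_adjoint U * U) $$ (i, j) = (\<Sum>k<d. mat_adjoint U $$ (i, k) * U $$ (k, j))"
      using U(1) that dim by (simp add: scalar_prod_def atLeast0LessThan)
    also have "\<dots> = (\<Sum>k<d. cnj (U $$ (k, i)) * U $$ (k, j))"
      by (intro sum.cong) (auto simp: adj)
    finally show ?thesis unfolding U(2) using that by auto
  qed
  have "complex_of_real (\<Sum>k<d. (cmod (\<Sum>k'<d. U $$ (k, k') * v k'))\<^sup>2)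
      = (\<Sum>k<d. cnj (\<Sum>i<d. U $$ (k, i) * v i) * (\<Sum>j<d. U $$ (k, j) * v j))"
    unfolding of_real_sum of_real_cmod_square ..
  also have "\<dots> = (\<Sum>k<d. \<Sum>i<d. \<Sum>j<d. cnj (v i) * v j * (cnj (U $$ (k, i)) * U $$ (k, j)))"
    unfolding cnj_sum sum_product by (intro sum.cong refl) (simp add: algebra_simps)
  also have "\<dots> = (\<Sum>i<d. \<Sum>j<d. \<Sum>k<d. cnj (v i) * v j * (cnj (U $$ (k, i)) * U $$ (k, j)))"
    by (subst sum.swap, rule sum.cong[OF refl], rule sum.swap)
  also have "\<dots> = (\<Sum>i<d. \<Sum>j<d. cnj (v i) * v j * (if i = j then 1 else 0))"
    unfolding sum_distrib_left[symmetric] by (intro sum.cong refl) (simp add: entry)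
  also have "\<dots> = (\<Sum>i<d. cnj (v i) * v i)"
    by (intro sum.cong refl) (simp add: if_distrib cong: if_cong)
  also have "\<dots> = complex_of_real (\<Sum>k<d. (cmod (v k))\<^sup>2)"
    unfolding of_real_sum of_real_cmod_square ..
  finally show "(\<Sum>k<d. (cmod (\<Sum>k'<d. U $$ (k, k') * v k'))\<^sup>2) = (\<Sum>k<d. (cmod (v k))\<^sup>2)"
    using of_real_eq_iff by blast
qed

locale quantum_run =
  fixes n m :: nat and U :: "nat \<Rightarrow> complex mat" and T :: nat
  assumes U_unitary: "t \<le> T \<Longrightarrow> unitary_mat (space_dim n m) (U t)" and m_pos: "1 \<le> m"
begin

abbreviation "d \<equiv> space_dim n m"

lemma d_pos: "0 < d"
  using m_pos unfolding space_dim_def by simp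

lemma U_carrier: "t \<le> T \<Longrightarrow> U t \<in> carrier_mat d d"
  using U_unitary unfolding unitary_mat_def by blast

lemma query_state_carrier: "t \<le> T \<Longrightarrow> query_state n m U x t \<in> carrier_vec d"
  by (cases t; rule carrier_vecI; simp add: carrier_matD(1)[OF U_carrier])

lemma amp_0: "k < d \<Longrightarrow> amp n m U x 0 k = U 0 $$ (k, 0)"
proof -
  assume k: "k < d"
  have U: "U 0 \<in> carrier_mat d d" using U_carrier by simp
  then have "row (U 0) k \<in> carrier_vec d" using k by (intro row_carrier_vec)
  then have "row (U 0) k \<bullet> unit_vec d 0 = row (U 0) k $ 0"
    using d_pos by simp
  then show ?thesis unfolding amp_def using U k d_pos by simp
qed

lemma amp_Suc:
  assumes "Suc t \<le> T" "k < d"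
  shows "amp n m U x (Suc t) k = (\<Sum>k'<d. U (Suc t) $$ (k, k') * amp n m U x t (oracle_perm n x k'))"
proof -
  let ?\<psi> = "query_state n m U x t"
  have \<psi>: "?\<psi> \<in> carrier_vec d" using assms query_state_carrier by simp
  have O: "(oracle_mat n m x *\<^sub>v ?\<psi>) $ r = ?\<psi> $ oracle_perm n x r" if r: "r < d" for r
  proof -
    have "(oracle_mat n m x *\<^sub>v ?\<psi>) $ r = (\<Sum>c<d. (if r = oracle_perm n x c then 1 else 0) * ?\<psi> $ c)"
      unfolding oracle_mat_def using \<psi> r by (simp add: scalar_prod_def atLeast0LessThan)
    also have "\<dots> = (\<Sum>c<d. if c = oracle_perm n x r then ?\<psi> $ c else 0)"
      by (intro sum.cong refl) (auto)
    also have "\<dots> = ?\<psi> $ oracle_perm n x r"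
      using oracle_perm_less[OF r] by (simp add: sum.delta)
    finally show ?thesis .
  qed
  have "(U (Suc t) *\<^sub>v w) $ k = (\<Sum>k'<d. U (Suc t) $$ (k, k') * w $ k')" if "dim_vec w = d" for w
    using carrier_matD[OF U_carrier[OF assms(1)]] assms(2) that by (simp add: scalar_prod_def atLeast0LessThan)
  then have "amp n m U x (Suc t) k = (\<Sum>k'<d. U (Suc t) $$ (k, k') * (oracle_mat n m x *\<^sub>v ?\<psi>) $ k')"
    unfolding amp_def query_state.simps by (simp add: oracle_mat_def)
  also have "\<dots> = (\<Sum>k'<d. U (Suc t) $$ (k, k') * amp n m U x t (oracle_perm n x k'))"
    unfolding amp_def by (intro sum.cong refl) (simp add: O)
  finally show ?thesis .
qed

lemma isometric_U: "t \<le> T \<Longrightarrow> isometric d (\<lambda>k k'. U t $$ (k, k'))"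
  using isometric_unitary U_unitary by blast

lemma sum_oracle_perm: "(\<Sum>k<d. g (oracle_perm n x k)) = (\<Sum>k<d. g k)"
  by (rule sum.reindex_bij_witness[of _ "oracle_perm n x" "oracle_perm n x"]) (auto simp: oracle_perm_less)

lemma sum_amp: "t \<le> T \<Longrightarrow> (\<Sum>k<d. (cmod (amp n m U x t k))\<^sup>2) = 1"
proof (induction t)
  case 0
  have "(\<Sum>k<d. (cmod (amp n m U x 0 k))\<^sup>2)
      = (\<Sum>k<d. (cmod (\<Sum>k'<d. U 0 $$ (k, k') * (if k' = 0 then 1 else 0)))\<^sup>2)"
    using d_pos by (intro sum.cong refl) (simp add: amp_0 if_distrib cong: if_cong)
  also have "\<dots> = (\<Sum>k<d. (cmod (if k = 0 then 1 else 0 :: complex))\<^sup>2)"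
    by (rule isometricD[OF isometric_U]) simp
  also have "\<dots> = (\<Sum>k<d. if k = 0 then 1 else 0)" by (intro sum.cong) auto
  also have "\<dots> = 1" using d_pos by (simp add: sum.delta)
  finally show ?case .
next
  case (Suc t)
  have "(\<Sum>k<d. (cmod (amp n m U x (Suc t) k))\<^sup>2) = (\<Sum>k<d. (cmod (amp n m U x t (oracle_perm n x k)))\<^sup>2)"
    by (subst isometricD[OF isometric_U[OF Suc.prems], symmetric])
      (intro sum.cong refl, simp only: amp_Suc[OF Suc.prems] lessThan_iff)
  then show ?case using Suc sum_oracle_perm[of "\<lambda>k. (cmod (amp n m U x t k))\<^sup>2"] by simp
qed

section \<open>The hybrid argument\<close>

definition differ :: "bool list \<Rightarrow> bool list \<Rightarrow> nat set" where
  "differ x y = {k. k < d \<and> query_index n k < n \<and> x ! query_index n k \<noteq> y ! query_index n k}"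

definition distance :: "bool list \<Rightarrow> bool list \<Rightarrow> nat \<Rightarrow> real" where
  "distance x y t = L2_set (\<lambda>k. cmod (amp n m U x t k - amp n m U y t k)) {..<d}"

text \<open>The two oracles disagree only at basis states whose queried bit differs, and there they
  exchange a state with its flip. The set of these states is closed under flipping, so both terms
  carry the same weight of the run on \<open>x\<close>; this gives 4 under the root.\<close>

lemma distance_Suc:
  assumes "Suc t \<le> T"
  shows "distance x y (Suc t) \<le> distance x y t + 2 * sqrt (\<Sum>k\<in>differ x y. (cmod (amp n m U x t k))\<^sup>2)"
proof -
  let ?a = "amp n m U x t" and ?b = "amp n m U y t" and ?ox = "oracle_perm n x" and ?oy = "oracle_perm n y"
  define g where "g k = ?a (?ox k) - ?b (?oy k)" for k
  have "amp n m U x (Suc t) k - amp n m U y (Suc t) k = (\<Sum>k'<d. U (Suc t) $$ (k, k') * g k')" if "k < d" for k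
    unfolding amp_Suc[OF assms that] g_def by (simp add: right_diff_distrib sum_subtractf)
  then have "(\<Sum>k<d. (cmod (amp n m U x (Suc t) k - amp n m U y (Suc t) k))\<^sup>2) = (\<Sum>k<d. (cmod (g k))\<^sup>2)"
    using isometricD[OF isometric_U[OF assms], of g] by simp
  then have "distance x y (Suc t) = L2_set (\<lambda>k. cmod (g k)) {..<d}"
    unfolding distance_def L2_set_def by simp
  also have "\<dots> \<le> L2_set (\<lambda>k. cmod (?a (?oy k) - ?b (?oy k)) + cmod (?a (?ox k) - ?a (?oy k))) {..<d}"
  proof (intro L2_set_mono)
    fix k
    have "g k = (?a (?oy k) - ?b (?oy k)) + (?a (?ox k) - ?a (?oy k))" unfolding g_def by simp
    then show "cmod (g k) \<le> cmod (?a (?oy k) - ?b (?oy k)) + cmod (?a (?ox k) - ?a (?oy k))"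
      by (metis norm_triangle_ineq)
  qed auto
  also have "\<dots> \<le> L2_set (\<lambda>k. cmod (?a (?oy k) - ?b (?oy k))) {..<d} + L2_set (\<lambda>k. cmod (?a (?ox k) - ?a (?oy k))) {..<d}"
    by (rule L2_set_triangle_ineq)
  also have "L2_set (\<lambda>k. cmod (?a (?oy k) - ?b (?oy k))) {..<d} = distance x y t"
    unfolding distance_def L2_set_def
    using sum_oracle_perm[of "\<lambda>k. (cmod (?a k - ?b k))\<^sup>2" y] by simp
  also have "L2_set (\<lambda>k. cmod (?a (?ox k) - ?a (?oy k))) {..<d}
      \<le> sqrt (4 * (\<Sum>k\<in>differ x y. (cmod (?a k))\<^sup>2))"
    unfolding L2_set_def
  proof (intro real_sqrt_le_mono)
    have "(\<Sum>k<d. (cmod (?a (?ox k) - ?a (?oy k)))\<^sup>2) = (\<Sum>k\<in>differ x y. (cmod (?a (?ox k) - ?a (?oy k)))\<^sup>2)"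
      by (intro sum.mono_neutral_right) (auto simp: differ_def oracle_perm_def)
    also have "\<dots> \<le> (\<Sum>k\<in>differ x y. 2 * (cmod (?a k))\<^sup>2 + 2 * (cmod (?a (flip_answer k)))\<^sup>2)"
    proof (intro sum_mono)
      fix k assume "k \<in> differ x y"
      then have "{?ox k, ?oy k} = {k, flip_answer k}" unfolding differ_def oracle_perm_def by auto
      then have "(cmod (?a (?ox k) - ?a (?oy k)))\<^sup>2 = (cmod (?a k - ?a (flip_answer k)))\<^sup>2"
        by (metis doubleton_eq_iff norm_minus_commute)
      also have "\<dots> \<le> 2 * (cmod (?a k))\<^sup>2 + 2 * (cmod (?a (flip_answer k)))\<^sup>2"
        using cmod_parallelogram[of "?a k" "?a (flip_answer k)"]
          zero_le_power2[of "cmod (?a k + ?a (flip_answer k))"] by linarith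
      finally show "(cmod (?a (?ox k) - ?a (?oy k)))\<^sup>2 \<le> 2 * (cmod (?a k))\<^sup>2 + 2 * (cmod (?a (flip_answer k)))\<^sup>2" .
    qed
    also have "\<dots> = 2 * (\<Sum>k\<in>differ x y. (cmod (?a k))\<^sup>2) + 2 * (\<Sum>k\<in>differ x y. (cmod (?a (flip_answer k)))\<^sup>2)"
      by (simp add: sum.distrib sum_distrib_left)
    also have "(\<Sum>k\<in>differ x y. (cmod (?a (flip_answer k)))\<^sup>2) = (\<Sum>k\<in>differ x y. (cmod (?a k))\<^sup>2)"
      by (rule sum.reindex_bij_witness[of _ flip_answer flip_answer]) (auto simp: differ_def flip_answer_less)
    finally show "(\<Sum>k<d. (cmod (?a (?ox k) - ?a (?oy k)))\<^sup>2) \<le> 4 * (\<Sum>k\<in>differ x y. (cmod (?a k))\<^sup>2)"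
      by simp
  qed
  finally show ?thesis by (simp only: real_sqrt_mult real_sqrt_four)
qed

lemma distance_le:
  "t \<le> T \<Longrightarrow> distance x y t \<le> (\<Sum>i<t. 2 * sqrt (\<Sum>k\<in>differ x y. (cmod (amp n m U x i k))\<^sup>2))"
proof (induction t)
  case 0
  have "(\<Sum>k<d. (cmod (amp n m U x 0 k - amp n m U y 0 k))\<^sup>2) = 0"
    by (intro sum.neutral) (simp add: amp_0)
  then show ?case unfolding distance_def L2_set_def by simp
next
  case (Suc t)
  then show ?case using distance_Suc[of t x y] by simp
qed

text \<open>Opposite answers force the final states apart: 4/5 is below the root of 2/3 and 3/5
  above the root of 1/3, which leaves a distance of 1/5. Squaring, with the factor 2 of every step,
  yields 100 = 4 * 25.\<close>

lemma sum_differ_amp_ge: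
  assumes x: "output_prob n m U A T x v \<ge> 2 / 3" and y: "output_prob n m U A T y (\<not> v) \<ge> 2 / 3"
  shows "1 \<le> 100 * T * (\<Sum>t<T. \<Sum>k\<in>differ x y. (cmod (amp n m U x t k))\<^sup>2)"
proof -
  let ?a = "amp n m U x T" and ?b = "amp n m U y T"
  define S where "S = {k. k < d \<and> (k \<in> A \<longleftrightarrow> v)}"
  have S: "S \<subseteq> {..<d}" unfolding S_def by auto
  have px: "2 / 3 \<le> (\<Sum>k\<in>S. (cmod (?a k))\<^sup>2)"
    using x unfolding output_prob_def S_def amp_def .
  have "{..<d} - S = {k. k < d \<and> (k \<in> A \<longleftrightarrow> \<not> v)}" unfolding S_def by (cases v) auto
  then have "2 / 3 \<le> (\<Sum>k\<in>{..<d} - S. (cmod (?b k))\<^sup>2)"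
    using y unfolding output_prob_def amp_def by simp
  moreover have "(\<Sum>k\<in>{..<d} - S. (cmod (?b k))\<^sup>2) = 1 - (\<Sum>k\<in>S. (cmod (?b k))\<^sup>2)"
    using S sum_amp[OF order_refl, of y] by (simp add: sum_diff)
  ultimately have py: "(\<Sum>k\<in>S. (cmod (?b k))\<^sup>2) \<le> 1 / 3" by simp
  have "4 / 5 \<le> sqrt (\<Sum>k\<in>S. (cmod (?a k))\<^sup>2)"
    using px by (intro real_le_rsqrt) (simp add: power2_eq_square)
  also have "\<dots> = L2_set (\<lambda>k. cmod (?a k)) S" by (simp add: L2_set_def)
  also have "\<dots> \<le> L2_set (\<lambda>k. cmod (?b k) + cmod (?a k - ?b k)) S"
  proof (intro L2_set_mono)
    fix k
    show "cmod (?a k) \<le> cmod (?b k) + cmod (?a k - ?b k)"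
      using norm_triangle_ineq[of "?b k" "?a k - ?b k"] by simp
  qed auto
  also have "\<dots> \<le> L2_set (\<lambda>k. cmod (?b k)) S + L2_set (\<lambda>k. cmod (?a k - ?b k)) S"
    by (rule L2_set_triangle_ineq)
  also have "L2_set (\<lambda>k. cmod (?b k)) S \<le> 3 / 5"
    unfolding L2_set_def using py by (intro real_le_lsqrt sum_nonneg) (auto simp: power2_eq_square)
  also have "L2_set (\<lambda>k. cmod (?a k - ?b k)) S \<le> distance x y T"
    unfolding distance_def L2_set_def using S by (intro real_sqrt_le_mono sum_mono2) auto
  also have "\<dots> \<le> (\<Sum>t<T. 2 * sqrt (\<Sum>k\<in>differ x y. (cmod (amp n m U x t k))\<^sup>2))"
    by (rule distance_le) simp
  finally have "1 / 5 \<le> (\<Sum>t<T. 2 * sqrt (\<Sum>k\<in>differ x y. (cmod (amp n m U x t k))\<^sup>2))" by simp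
  then have "(1 / 5)\<^sup>2 \<le> (\<Sum>t<T. 2 * sqrt (\<Sum>k\<in>differ x y. (cmod (amp n m U x t k))\<^sup>2))\<^sup>2"
    by (intro power_mono) auto
  also have "\<dots> \<le> (\<Sum>t<T. (2 * sqrt (\<Sum>k\<in>differ x y. (cmod (amp n m U x t k))\<^sup>2))\<^sup>2) * card {..<T}"
    by (rule sum_squared_le)
  also have "\<dots> = (\<Sum>t<T. 4 * (\<Sum>k\<in>differ x y. (cmod (amp n m U x t k))\<^sup>2)) * T"
    by (simp add: power_mult_distrib sum_nonneg)
  also have "\<dots> = 4 * T * (\<Sum>t<T. \<Sum>k\<in>differ x y. (cmod (amp n m U x t k))\<^sup>2)"
    unfolding sum_distrib_left[symmetric] by simp
  finally show ?thesis by (simp add: power2_eq_square)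
qed

end

section \<open>Reading the whole input\<close>

text \<open>Some number of queries must be shown to suffice, so that the minimum in
  \<open>quantum_query_complexity\<close> is attained. Copying the input into the work register
  takes only permutation matrices.\<close>

definition perm_mat :: "nat \<Rightarrow> (nat \<Rightarrow> nat) \<Rightarrow> complex mat" where
  "perm_mat d p = mat d d (\<lambda>(r, c). if r = p c then 1 else 0)"

lemma unitary_perm_mat:
  assumes "p permutes {..<d}"
  shows "unitary_mat d (perm_mat d p)"
proof -
  have lt: "p k < d" if "k < d" for k using that permutes_in_image[OF assms] by auto
  have "mat_adjoint (perm_mat d p) * perm_mat d p = 1\<^sub>m d"
  proof (rule eq_matI)
    fix i j assume "i < dim_row (1\<^sub>m d :: complex mat)" "j < dim_col (1\<^sub>m d :: complex mat)"
    then have ij: "i < d" "j < d" by auto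
    have adj: "mat_adjoint (perm_mat d p) $$ (i, k) = (if k = p i then 1 else 0)" if "k < d" for k
      using ij that by (simp add: mat_adjoint_def mat_of_rows_index perm_mat_def)
    have dim: "dim_row (mat_adjoint (perm_mat d p)) = d" "dim_col (mat_adjoint (perm_mat d p)) = d"
      by (auto simp: mat_adjoint_def perm_mat_def)
    have "(mat_adjoint (perm_mat d p) * perm_mat d p) $$ (i, j)
        = (\<Sum>k<d. mat_adjoint (perm_mat d p) $$ (i, k) * perm_mat d p $$ (k, j))"
      using ij dim by (simp add: scalar_prod_def atLeast0LessThan perm_mat_def)
    also have "\<dots> = (\<Sum>k<d. if k = p i then (if k = p j then 1 else 0) else 0)"
    proof (intro sum.cong refl)
      fix k assume "k \<in> {..<d}"
      then have "perm_mat d p $$ (k, j) = (if k = p j then 1 else 0)" "k < d"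
        using ij by (auto simp: perm_mat_def)
      then show "mat_adjoint (perm_mat d p) $$ (i, k) * perm_mat d p $$ (k, j)
          = (if k = p i then (if k = p j then 1 else 0) else 0)"
        by (simp add: adj)
    qed
    also have "\<dots> = (if p i = p j then 1 else 0)" using lt[OF ij(1)] by (simp add: sum.delta)
    also have "\<dots> = 1\<^sub>m d $$ (i, j)"
      using ij permutes_inj[OF assms] by (auto simp: inj_eq)
    finally show "(mat_adjoint (perm_mat d p) * perm_mat d p) $$ (i, j) = 1\<^sub>m d $$ (i, j)" .
  qed (auto simp: mat_adjoint_def perm_mat_def)
  then show ?thesis unfolding unitary_mat_def by (simp add: perm_mat_def)
qed

lemma perm_mat_unit_vec:
  assumes "p permutes {..<d}" "c < d"
  shows "perm_mat d p *\<^sub>v unit_vec d c = unit_vec d (p c)"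
proof (rule eq_vecI)
  fix r assume "r < dim_vec (unit_vec d (p c) :: complex vec)"
  then have r: "r < d" by simp
  have "(perm_mat d p *\<^sub>v unit_vec d c) $ r = (\<Sum>i<d. (if r = p i then 1 else 0) * (if i = c then 1 else 0))"
    using assms(2) r by (simp add: perm_mat_def scalar_prod_def unit_vec_def atLeast0LessThan)
  also have "\<dots> = (\<Sum>i<d. if i = c then (if r = p c then 1 else 0) else 0)"
    by (intro sum.cong) auto
  also have "\<dots> = unit_vec d (p c) $ r"
    using assms(2) r permutes_in_image[OF assms(1)] by (simp add: sum.delta unit_vec_def)
  finally show "(perm_mat d p *\<^sub>v unit_vec d c) $ r = unit_vec d (p c) $ r" .
qed (simp add: perm_mat_def)

lemma extend_to_permutation:
  assumes "finite B" "S \<subseteq> B" "inj_on g S" "g ` S \<subseteq> B"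
  obtains p where "p permutes B" "\<And>x. x \<in> S \<Longrightarrow> p x = g x"
proof -
  have fin: "finite S" "finite (B - S)" "finite (B - g ` S)" using assms finite_subset by auto
  have "card (B - S) = card (B - g ` S)"
    using assms fin by (simp add: card_Diff_subset card_image finite_subset)
  then obtain g' where g': "bij_betw g' (B - S) (B - g ` S)"
    using fin finite_same_card_bij by blast
  define p where "p x = (if x \<in> S then g x else if x \<in> B then g' x else x)" for x
  have "bij_betw p S (g ` S)" using assms(3) by (simp add: bij_betw_def p_def inj_on_def)
  moreover have "bij_betw p (B - S) (B - g ` S)"
    using g' by (rule bij_betw_cong[THEN iffD1, rotated]) (auto simp: p_def)
  ultimately have "bij_betw p (S \<union> (B - S)) (g ` S \<union> (B - g ` S))"
    by (rule bij_betw_combine) auto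
  moreover have "S \<union> (B - S) = B" "g ` S \<union> (B - g ` S) = B" using assms by auto
  ultimately have "p permutes B" by (intro bij_imp_permutes) (auto simp: p_def)
  then show ?thesis using that by (simp add: p_def)
qed

definition prefix_code :: "bool list \<Rightarrow> nat \<Rightarrow> nat" where
  "prefix_code x t = (\<Sum>i<t. if x ! i then 2 ^ i else 0)"

lemma prefix_code_less: "prefix_code x t < 2 ^ t"
  by (induction t) (auto simp: prefix_code_def)

text \<open>After \<open>t\<close> queries the algorithm is in the basis state with work register \<open>prefix_code x t\<close>, with
  cleared answer bit and query index \<open>t\<close>; the next step needs to be specified only on such states.\<close>

lemma ex_quantum_computable: "\<exists>T. quantum_computable_with n f T"
proof -
  define m where "m = (2::nat) ^ n"
  define d where "d = space_dim n m"
  define idx where "idx i b z = b + 2 * (i + (n + 1) * z)" for i b z :: nat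
  have idx_less: "idx i b z < d" if "i \<le> n" "b < 2" "z < m" for i b z
  proof -
    have "i + (n + 1) * z < (n + 1) * (z + 1)" using that(1) by (simp add: algebra_simps)
    also have "\<dots> \<le> (n + 1) * m" using that(3) by (intro mult_left_mono) auto
    finally show ?thesis using that(2) unfolding idx_def d_def space_dim_def by simp
  qed
  have half: "idx i b z div 2 = i + (n + 1) * z" if "b < 2" for i b z
    unfolding idx_def using that by (cases "b = 0") auto
  have qi: "query_index n (idx i b z) = i" if "i \<le> n" "b < 2" for i b z
    using that(1) unfolding query_index_def half[OF that(2)] mod_mult_self2 by simp
  have idx_z: "(idx i b z div 2) div (n + 1) = z" if "i \<le> n" "b < 2" for i b z
    unfolding half[OF that(2)] using that(1) by (subst div_mult_self2) auto
  have idx_b: "idx i b z mod 2 = b" if "b < 2" for i b z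
    unfolding idx_def mod_mult_self2 using that by simp
  have d0: "0 < d" unfolding d_def m_def space_dim_def by simp
  \<comment> \<open>Before step \<open>t\<close> the answer bit holds either value; \<open>g\<close>
    moves it to position \<open>t\<close> of the work register, clears it and advances the query
    index.\<close>
  define S where "S t = {idx t b z | b z. b < 2 \<and> z < 2 ^ t}" for t
  define g where "g t c = idx (Suc t) 0 (c div 2 div (n + 1) + 2 ^ t * (c mod 2))" for t c
  have g_idx: "g t (idx t b z) = idx (Suc t) 0 (z + 2 ^ t * b)" if "t \<le> n" "b < 2" for t b z
    unfolding g_def using idx_z[OF that] idx_b[OF that(2)] by simp
  have "\<exists>p. p permutes {..<d} \<and> (\<forall>c\<in>S t. p c = g t c)" if t: "t < n" for t
  proof -
    have pw: "z + 2 ^ t * b < 2 ^ Suc t" if "b < 2" "z < 2 ^ t" for b z :: nat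
    proof -
      have "b = 0 \<or> b = 1" using that(1) by auto
      then show ?thesis using that(2) by auto
    qed
    have le: "(2::nat) ^ t \<le> m" "(2::nat) ^ Suc t \<le> m"
      unfolding m_def using t by (intro power_increasing; simp)+
    have S: "S t \<subseteq> {..<d}"
    proof
      fix c assume "c \<in> S t"
      then obtain b z where "b < 2" "z < 2 ^ t" "c = idx t b z" unfolding S_def by blast
      then show "c \<in> {..<d}" using t le(1) idx_less[of t b z] by simp
    qed
    have gS: "g t ` S t \<subseteq> {..<d}"
    proof
      fix c assume "c \<in> g t ` S t"
      then obtain b z where "b < 2" "z < 2 ^ t" "c = g t (idx t b z)" unfolding S_def by auto
      then have "c = idx (Suc t) 0 (z + 2 ^ t * b)" "z + 2 ^ t * b < m"
        using g_idx[of t b z] t pw[of b z] le(2) by auto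
      then show "c \<in> {..<d}" using t idx_less[of "Suc t" 0] by auto
    qed
    have inj: "inj_on (g t) (S t)"
    proof (rule inj_onI)
      fix c c' assume "c \<in> S t" "c' \<in> S t" and eq: "g t c = g t c'"
      then obtain b z b' z' where c: "b < 2" "z < 2 ^ t" "c = idx t b z" "b' < 2" "z' < 2 ^ t" "c' = idx t b' z'"
        unfolding S_def by blast
      have "z + 2 ^ t * b = z' + 2 ^ t * b'"
      proof -
        have "idx (Suc t) 0 (z + 2 ^ t * b) = idx (Suc t) 0 (z' + 2 ^ t * b')"
          using eq c g_idx[of t b z] g_idx[of t b' z'] t by simp
        then have "idx (Suc t) 0 (z + 2 ^ t * b) div 2 div (n + 1) = idx (Suc t) 0 (z' + 2 ^ t * b') div 2 div (n + 1)"
          by simp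
        then show ?thesis using idx_z[of "Suc t" 0] t by simp
      qed
      \<comment> \<open>Remainder and quotient by 2^t recover the old register and the answer
        bit.\<close>
      then have "(z + 2 ^ t * b) mod 2 ^ t = (z' + 2 ^ t * b') mod 2 ^ t" "(z + 2 ^ t * b) div 2 ^ t = (z' + 2 ^ t * b') div 2 ^ t"
        by simp_all
      then show "c = c'" using c by simp
    qed
    show ?thesis using extend_to_permutation[OF _ S inj gS] by (metis finite_lessThan)
  qed
  then obtain p where p: "\<And>t. t < n \<Longrightarrow> p t permutes {..<d}" "\<And>t c. t < n \<Longrightarrow> c \<in> S t \<Longrightarrow> p t c = g t c"
    by metis
  define U where "U t = perm_mat d (if t = 0 then id else p (t - 1))" for t
  have unitary: "unitary_mat (space_dim n m) (U t)" if "t \<le> n" for t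
    using that p(1)[of "t - 1"] unfolding U_def d_def
    by (auto intro!: unitary_perm_mat simp: permutes_id)
  have state: "query_state n m U x t = unit_vec d (idx t 0 (prefix_code x t))" if "t \<le> n" for x t
    using that
  proof (induction t)
    case 0
    have "perm_mat d id *\<^sub>v unit_vec d 0 = unit_vec d (id 0)"
      using d0 by (intro perm_mat_unit_vec) (auto simp: permutes_id)
    then show ?case by (simp add: U_def idx_def prefix_code_def d_def)
  next
    case (Suc t)
    let ?z = "prefix_code x t"
    have t: "t < n" using Suc by simp
    have z: "?z < 2 ^ t" "?z < m"
      proof -
      show z: "?z < 2 ^ t" by (rule prefix_code_less)
      have "(2::nat) ^ t < 2 ^ n" using t by (intro power_strict_increasing) auto
      with z show "?z < m" unfolding m_def by (rule less_trans)
    qed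
    define b where "b = (if x ! t then 1 else 0 :: nat)"
    have "oracle_perm n x (idx t 0 ?z) = idx t b ?z"
      using t qi[of t 0 ?z] unfolding oracle_perm_def flip_answer_def b_def by (auto simp: idx_def)
    moreover have "oracle_mat n m x *\<^sub>v unit_vec d c = unit_vec d (oracle_perm n x c)" if "c < d" for c
    proof -
      \<comment> \<open>The identity outside the basis is what \<open>permutes\<close>
        demands.\<close>
      have "oracle_mat n m x = perm_mat d (\<lambda>c. if c < d then oracle_perm n x c else c)"
        unfolding oracle_mat_def perm_mat_def d_def by (intro eq_matI) auto
      moreover have "(\<lambda>c. if c < d then oracle_perm n x c else c) permutes {..<d}"
        unfolding d_def
        by (rule bij_imp_permutes, rule bij_betw_byWitness[where f' = "oracle_perm n x"])
          (auto simp: oracle_perm_less)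
      ultimately show ?thesis using perm_mat_unit_vec[OF _ that] that by simp
    qed
    ultimately have "oracle_mat n m x *\<^sub>v unit_vec d (idx t 0 ?z) = unit_vec d (idx t b ?z)"
      using idx_less[of t 0 ?z] t z by simp
    moreover have "perm_mat d (p t) *\<^sub>v unit_vec d (idx t b ?z) = unit_vec d (p t (idx t b ?z))"
      using idx_less[of t b ?z] t z by (intro perm_mat_unit_vec p) (auto simp: b_def)
    moreover have "p t (idx t b ?z) = idx (Suc t) 0 (prefix_code x (Suc t))"
    proof -
      have "b < 2" by (simp add: b_def)
      then have "idx t b ?z \<in> S t" using z unfolding S_def by blast
      then have "p t (idx t b ?z) = idx (Suc t) 0 (?z + 2 ^ t * b)"
        using p(2)[OF t] g_idx[of t b ?z] t \<open>b < 2\<close> by simp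
      moreover have "prefix_code x (Suc t) = ?z + 2 ^ t * b" unfolding prefix_code_def b_def by simp
      ultimately show ?thesis by simp
    qed
    ultimately show ?case using Suc t by (simp add: U_def)
  qed
  have code_inj: "x = y" if "length x = n" "length y = n" "prefix_code x n = prefix_code y n" for x y
  proof -
    have "\<forall>i<t. x ! i = y ! i" if "prefix_code x t = prefix_code y t" for t
      using that
    proof (induction t)
      case (Suc t)
      have "prefix_code x t + (if x ! t then 2 ^ t else 0) = prefix_code y t + (if y ! t then 2 ^ t else 0)"
        using Suc.prems unfolding prefix_code_def by simp
      then have "x ! t = y ! t \<and> prefix_code x t = prefix_code y t"
        using prefix_code_less[of x t] prefix_code_less[of y t]
        by (cases "x ! t"; cases "y ! t") simp_all
      then show ?case using Suc.IH by (auto simp: less_Suc_eq)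
    qed simp
    then show ?thesis using that by (auto intro: nth_equalityI)
  qed
  define A where "A = {idx n 0 (prefix_code x n) | x. x \<in> cube n \<and> f x}"
  have "output_prob n m U A n x (f x) \<ge> 2 / 3" if x: "x \<in> cube n" for x
  proof -
    define c where "c = idx n 0 (prefix_code x n)"
    have z: "prefix_code x n < m" unfolding m_def by (rule prefix_code_less)
    have c: "c < d" unfolding c_def using z by (intro idx_less) auto
    have "c \<in> A \<longleftrightarrow> f x"
    proof
      assume "c \<in> A"
      then obtain y where y: "y \<in> cube n" "f y" "c = idx n 0 (prefix_code y n)" unfolding A_def by auto
      then have "prefix_code x n = prefix_code y n"
        using idx_z[of n 0 "prefix_code x n"] idx_z[of n 0 "prefix_code y n"] unfolding c_def by simp
      then have "x = y" using code_inj x y(1) unfolding cube_def by auto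
      then show "f x" using y by simp
    qed (use x in \<open>auto simp: A_def c_def\<close>)
    then have "(\<Sum>k\<in>{c}. (cmod (query_state n m U x n $ k))\<^sup>2) \<le> output_prob n m U A n x (f x)"
      unfolding output_prob_def using c by (intro sum_mono2) (auto simp: d_def)
    moreover have "query_state n m U x n $ c = 1" using state[of n x] c by (simp add: c_def)
    ultimately show ?thesis by simp
  qed
  moreover have "1 \<le> m" unfolding m_def by simp
  ultimately show ?thesis
    unfolding quantum_computable_with_def using unitary by blast
qed

section \<open>Blocks whose labels cancel\<close>

text \<open>The hidden tuple and the content of every block.\<close>

type_synonym config = "nat \<times> nat \<Rightarrow> (nat \<Rightarrow> nat) \<times> (nat \<times> nat \<times> nat) set"

text \<open>\<open>good_half\<close> is the union bound of \<open>card_good_ge\<close>: given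
  cancellation on one choice, fewer than N^k other choices and \<open>k * N ^ k\<close> possible
  false tuples each spoil at most a fraction 2^-s, together at most half.\<close>

locale instance_params = block_params k N s h R eps
  for k N s h R :: nat and eps :: real +
  fixes y :: real
  assumes y_pos: "0 < y" and s_pos: "0 < s" and good_half: "2 * (1 + k) * N ^ k \<le> 2 ^ s"
begin

definition blocks :: "(nat \<times> nat) set" where
  "blocks = {..<k} \<times> {..<N}"

definition Omega :: "config set" where
  "Omega = PiE blocks (\<lambda>_. planted)"

definition groups :: "(nat \<times> nat) list list" where
  "groups = map (\<lambda>p. map (Pair p) [0..<N]) [0..<k]"

definition choices :: "(nat \<times> nat) list set" where
  "choices = set (product_lists groups)"

text \<open>The bits outside a block are sent to an index outside \<open>blocks\<close>, where nothing is claimed.\<close>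

definition block_of :: "(nat \<times> nat) \<times> (nat \<times> nat \<times> nat) \<Rightarrow> nat \<times> nat" where
  "block_of e = (if snd e \<in> bits then fst e else (k, 0))"

definition bit_sign ::
  "(nat \<times> nat) \<times> (nat \<times> nat \<times> nat) \<Rightarrow> config \<Rightarrow> complex" where
  "bit_sign e \<omega> = wsign (snd (\<omega> (fst e))) (snd e)"

definition block_label ::
  "nat \<times> nat \<Rightarrow> nat set \<Rightarrow> config \<Rightarrow> complex" where
  "block_label j \<eta> \<omega> = label_sign \<eta> (\<omega> j)"

definition Qc where "Qc j r = coord planted j (block_kernel r)"

lemma planted_nonempty: "planted \<noteq> {}"
proof -
  obtain A where A: "A \<in> tup" using tup_nonempty by auto
  then have "card (zero_sum A) \<noteq> 0" using card_zero_sum_eq fiber_pos by simp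
  then have "zero_sum A \<noteq> {}" by (metis card.empty)
  then show ?thesis using A unfolding planted_def by auto
qed

lemma finite_blocks: "finite blocks" and card_blocks: "card blocks = k * N"
  unfolding blocks_def by auto

lemma finite_Omega: "finite Omega"
  unfolding Omega_def using finite_blocks finite_planted by (intro finite_PiE) auto

lemma card_planted_pos: "0 < card planted"
  using planted_nonempty finite_planted by (simp add: card_gt_0_iff)

lemma Qb_Qb: "Qb r (Qb r' f) = Qb (min r r') f"
proof -
  have "small r \<inter> small r' = small (min r r')" unfolding small_def by auto
  then show ?thesis using light.fproj_fproj[OF small_sub small_sub, of r r' f] by simp
qed

lemma Qc_Qc: "Qc j r (Qc j r' f) = Qc j (min r r') f"
  unfolding Qc_def by (rule coord_coord) (rule Qb_Qb)

text \<open>\<open>Qc j r\<close> acts in coordinate \<open>j\<close> alone, so commutation is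
  immediate and the claims about one block carry over fibre by fibre.\<close>

sublocale blocks: block_system Omega blocks Qc bit_sign block_of block_label R s eps y
proof
  show "finite Omega" by (rule finite_Omega)
  show "0 < R" "0 \<le> eps" "eps \<le> 1" "0 < y" by (fact R_pos eps_nonneg eps_le y_pos)+
  fix j :: "nat \<times> nat" assume j: "j \<in> blocks"
  show "proj Omega (Qc j r)" for r
    unfolding Omega_def Qc_def
    by (rule proj_coord[OF j finite_planted planted_nonempty light.proj_fproj[OF small_sub]])
  show "Qc j r' (Qc j r f) = Qc j r f" "Qc j r (Qc j r' f) = Qc j r f" if "r \<le> r'" for r r' f
    using that by (simp_all add: Qc_Qc min_def)
  show "Qc j r (Qc j' r' f) = Qc j' r' (Qc j r f)" if "j \<noteq> j'" for j' r r' f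
    unfolding Qc_def by (rule coord_commute[OF that])
  show "Qc j r 1 = 1" for r
  proof
    fix \<omega>
    have "Qc j r 1 \<omega> = Qb r 1 (\<omega> j)"
      unfolding Qc_def coord_kop by (simp add: one_fun_def)
    then show "Qc j r 1 \<omega> = 1 \<omega>" unfolding Qb_one by (simp add: pointwise)
  qed
  show "Qc j r (bit_sign e * f) = bit_sign e * Qc j r f" if "block_of e \<in> blocks" "block_of e \<noteq> j" for e r f
    unfolding Qc_def
    using that by (intro coord_mult) (auto simp: bit_sign_def block_of_def blocks_def split: if_splits)
  show "Qc j r (block_label j' \<eta> * f) = block_label j' \<eta> * Qc j r f" if "j \<noteq> j'" for j' \<eta> r f
    unfolding Qc_def using that by (intro coord_mult) (auto simp: block_label_def)
  show "Qc j (R - 1) (block_label j \<eta> * Qc j (R - 1) f) = 0" if "\<eta> \<subseteq> {..<s}" "\<eta> \<noteq> {}" for \<eta> f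
  proof
    fix \<omega>
    let ?g = "\<lambda>p. f (\<omega>(j := p))"
    have "(\<lambda>p. (block_label j \<eta> * Qc j (R - 1) f) (\<omega>(j := p))) = label_sign \<eta> * Qb (R - 1) ?g"
      unfolding Qc_def by (rule ext) (simp add: pointwise block_label_def coord_upd)
    then have "Qc j (R - 1) (block_label j \<eta> * Qc j (R - 1) f) \<omega>
        = Qb (R - 1) (label_sign \<eta> * Qb (R - 1) ?g) (\<omega> j)"
      unfolding Qc_def[of j] coord_kop[of planted j "block_kernel (R - 1)" "block_label j \<eta> * _"] by simp
    then show "Qc j (R - 1) (block_label j \<eta> * Qc j (R - 1) f) \<omega> = 0 \<omega>"
      unfolding Qb_label[OF that] by (simp add: pointwise)
  qed
next
  show "bit_sign e \<omega> = 1 \<or> bit_sign e \<omega> = -1" for e \<omega> unfolding bit_sign_def wsign_def by auto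
  show "block_label j {} = 1" for j
    by (rule ext) (simp add: block_label_def label_sign_def pointwise)
next
  fix e r f assume e: "block_of e \<in> blocks" and r: "Suc r < R"
  have b: "snd e \<in> bits" and j: "block_of e = fst e" "fst e \<in> blocks"
    using e by (auto simp: block_of_def blocks_def split: if_splits)
  let ?j = "fst e" and ?\<sigma> = "\<lambda>p. wsign (snd p) (snd e)"
  let ?g = "bit_sign e * Qc ?j r f"
  have fiber: "(\<lambda>p. (?g - Qc ?j (Suc r) ?g) (\<omega>(?j := p)))
      = ?\<sigma> * Qb r (\<lambda>p. f (\<omega>(?j := p))) - Qb (Suc r) (?\<sigma> * Qb r (\<lambda>p. f (\<omega>(?j := p))))" for \<omega>
  proof -
    have eq: "?g (\<omega>(?j := p)) = (?\<sigma> * Qb r (\<lambda>p. f (\<omega>(?j := p)))) p" for p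
      unfolding Qc_def by (simp add: pointwise bit_sign_def coord_upd)
    then have "(\<lambda>p. ?g (\<omega>(?j := p))) = ?\<sigma> * Qb r (\<lambda>p. f (\<omega>(?j := p)))" by (rule ext)
    then show ?thesis
      unfolding Qc_def[of _ "Suc r"] by (intro ext) (simp only: minus_apply coord_upd eq)
  qed
  have "card planted * sqn Omega (?g - Qc ?j (Suc r) ?g)
      = (\<Sum>\<omega>\<in>Omega. sqn planted (\<lambda>p. (?g - Qc ?j (Suc r) ?g) (\<omega>(?j := p))))"
    unfolding Omega_def by (rule sqn_PiE_fiber[OF j(2)])
  also have "\<dots> \<le> (\<Sum>\<omega>\<in>Omega. eps\<^sup>2 * sqn planted (\<lambda>p. Qc ?j r f (\<omega>(?j := p))))"
    unfolding fiber
  proof (intro sum_mono)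
    fix \<omega>
    show "sqn planted (?\<sigma> * Qb r (\<lambda>p. f (\<omega>(?j := p))) - Qb (Suc r) (?\<sigma> * Qb r (\<lambda>p. f (\<omega>(?j := p)))))
      \<le> eps\<^sup>2 * sqn planted (\<lambda>p. Qc ?j r f (\<omega>(?j := p)))"
      using Qb_step[OF b r, of "\<lambda>p. f (\<omega>(?j := p))"] unfolding Qc_def coord_upd by simp
  qed
  also have "\<dots> = card planted * (eps\<^sup>2 * sqn Omega (Qc ?j r f))"
    unfolding sum_distrib_left[symmetric] Omega_def sqn_PiE_fiber[OF j(2), symmetric] by simp
  finally show "sqn Omega (bit_sign e * Qc (block_of e) r f - Qc (block_of e) (Suc r) (bit_sign e * Qc (block_of e) r f))
      \<le> eps\<^sup>2 * sqn Omega (Qc (block_of e) r f)"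
    unfolding j(1) using card_planted_pos by simp
qed

lemma set_groups: "g \<in> set groups \<Longrightarrow> length g = N" and length_groups: "length groups = k"
  and set_concat_groups: "set (concat groups) = blocks"
  unfolding groups_def blocks_def by auto

lemma distinct_concat_groups: "distinct (concat groups)"
proof -
  have "inj_on (\<lambda>p. map (Pair p) [0..<N]) {0..<k}"
  proof (rule inj_onI)
    fix p q assume "map (Pair p) [0..<N] = map (Pair q) [0..<N]"
    then have "\<forall>l\<in>set [0..<N]. (p, l) = (q, l)" by (simp only: map_eq_conv)
    then show "p = q" using N_pos by auto
  qed
  then have "distinct groups" unfolding groups_def by (simp add: distinct_map)
  moreover have "distinct g" if "g \<in> set groups" for g
    using that unfolding groups_def by (auto simp: distinct_map inj_on_def)
  moreover have "set g \<inter> set g' = {}" if "g \<in> set groups" "g' \<in> set groups" "g \<noteq> g'" for g g'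
    using that unfolding groups_def by auto
  ultimately show ?thesis by (simp add: distinct_concat)
qed

lemma choices_iff: "L \<in> choices \<longleftrightarrow> length L = k \<and> (\<forall>p<k. \<exists>l<N. L ! p = (p, l))"
proof -
  have "L \<in> choices \<longleftrightarrow> list_all2 (\<lambda>x ys. x \<in> set ys) L groups"
    unfolding choices_def by (simp add: product_lists_set)
  also have "\<dots> \<longleftrightarrow> length L = k \<and> (\<forall>p<k. \<exists>l<N. L ! p = (p, l))"
    unfolding list_all2_conv_all_nth by (simp add: groups_def image_iff Bex_def cong: conj_cong)
  finally show ?thesis .
qed

lemma choices_blocks: "L \<in> choices \<Longrightarrow> set L \<subseteq> blocks"
proof
  fix j assume L: "L \<in> choices" and "j \<in> set L"
  then obtain p where "p < length L" "j = L ! p" by (metis in_set_conv_nth)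
  then show "j \<in> blocks" using L by (auto simp: choices_iff blocks_def)
qed

lemma choices_distinct: "L \<in> choices \<Longrightarrow> distinct L"
  unfolding distinct_conv_nth choices_iff by (metis fst_conv)

lemma choices_length: "L \<in> choices \<Longrightarrow> length L = k"
  by (simp add: choices_iff)

lemma choices_new_block:
  assumes "L \<in> choices" "L' \<in> choices" "L \<noteq> L'"
  obtains j where "j \<in> set L'" "j \<notin> set L"
proof -
  obtain p where p: "p < k" "L ! p \<noteq> L' ! p"
    using assms nth_equalityI[of L L'] by (auto simp: choices_iff)
  have "L' ! p \<notin> set L"
  proof
    assume "L' ! p \<in> set L"
    then obtain q where q: "q < k" "L ! q = L' ! p"
      using assms(1) by (metis in_set_conv_nth choices_iff)
    moreover obtain l l' where "L ! q = (q, l)" "L' ! p = (p, l')"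
      using assms(1,2) p(1) q(1) unfolding choices_iff by blast
    ultimately show False using p(2) by simp
  qed
  then show ?thesis using that[of "L' ! p"] p(1) assms(2) by (auto simp: choices_iff)
qed

lemma finite_choices: "finite choices"
  unfolding choices_def by simp

lemma length_product_lists: "length (product_lists gs) = prod_list (map length gs)"
  by (induction gs) (simp_all add: length_concat comp_def sum_list_triv)

lemma card_choices: "card choices = N ^ k"
proof -
  have "distinct (product_lists groups)"
    using distinct_concat_groups by (intro distinct_product_lists) (auto simp: distinct_concat_iff)
  then have "card choices = length (product_lists groups)"
    unfolding choices_def by (rule distinct_card)
  also have "\<dots> = prod_list (map length groups)" by (rule length_product_lists)
  also have "map length groups = replicate k N"
    unfolding groups_def by (simp add: map_replicate_const comp_def)
  finally show ?thesis by (simp add: prod_list_replicate)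
qed

section \<open>Counting configurations in which the labels of a choice cancel\<close>

definition total :: "(nat \<times> nat) list \<Rightarrow> nat \<Rightarrow> config \<Rightarrow> complex" where
  "total L c \<omega> = prod_list (map (\<lambda>j. par (fst (\<omega> j)) (s + c) (snd (\<omega> j))) L)"

definition cancel :: "(nat \<times> nat) list \<Rightarrow> config set" where
  "cancel L = {\<omega> \<in> Omega. \<forall>c<s. total L c \<omega> = 1}"

lemma total_cases: "total L c \<omega> = 1 \<or> total L c \<omega> = -1"
proof (induction L)
  case (Cons j L)
  then show ?case using par_cases[of "fst (\<omega> j)" "s + c" "snd (\<omega> j)"] by (auto simp: total_def)
qed (simp add: total_def)

lemma total_upd_other: "j \<notin> set L \<Longrightarrow> total L c (\<omega>(j := p)) = total L c \<omega>"
  unfolding total_def by (intro arg_cong[where f = prod_list] map_cong) auto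

lemma total_upd:
  assumes "distinct L" "j \<in> set L"
    "par (fst p) (s + c) (snd p) = a * par (fst (\<omega> j)) (s + c) (snd (\<omega> j))"
  shows "total L c (\<omega>(j := p)) = a * total L c \<omega>"
  using assms(1,2)
proof (induction L)
  case (Cons i L)
  show ?case
  proof (cases "i = j")
    case True
    then have "j \<notin> set L" using Cons.prems by simp
    then show ?thesis using True assms(3) total_upd_other[of j L c \<omega> p] by (simp add: total_def)
  next
    case False
    then show ?thesis using Cons by (simp add: total_def)
  qed
qed simp

lemma sum_labels:
  "(\<Sum>\<eta>\<in>Pow {..<s}. blocks.labels L \<eta> \<omega>) = (if \<forall>c<s. total L c \<omega> = 1 then 2 ^ s else 0)"
proof -
  have "blocks.labels L \<eta> \<omega> = (\<Prod>c\<in>\<eta>. total L c \<omega>)" for \<eta>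
  proof (induction L)
    case Nil
    then show ?case by (simp add: total_def pointwise)
  next
    case (Cons j L)
    have "block_label j \<eta> \<omega> = (\<Prod>c\<in>\<eta>. par (fst (\<omega> j)) (s + c) (snd (\<omega> j)))"
      unfolding block_label_def label_sign_def ..
    then show ?case
      by (simp add: Cons.IH times_fun_apply total_def prod.distrib)
  qed
  then have "(\<Sum>\<eta>\<in>Pow {..<s}. blocks.labels L \<eta> \<omega>) = (\<Sum>\<eta>\<in>Pow {..<s}. (\<Prod>c\<in>\<eta>. total L c \<omega>) * (\<Prod>c\<in>{..<s} - \<eta>. 1))"
    by simp
  also have "\<dots> = (\<Prod>c<s. total L c \<omega> + 1)" by (rule prod_add[symmetric]) simp
  also have "\<dots> = (if \<forall>c<s. total L c \<omega> = 1 then 2 ^ s else 0)"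
  proof (cases "\<forall>c<s. total L c \<omega> = 1")
    case False
    then obtain c where "c < s" "total L c \<omega> = -1" using total_cases by metis
    then have "(\<Prod>c<s. total L c \<omega> + 1) = 0" by (intro prod_zero bexI[of _ c]) auto
    then show ?thesis using False by simp
  qed simp
  finally show ?thesis .
qed

text \<open>The hidden tuple is kept, so a set \<open>E\<close> computed from the tuple is the same
  after twisting; this makes the maps passed to \<open>card_all_one\<close> involutions.\<close>

definition twist :: "nat \<times> nat \<Rightarrow> (nat \<times> nat \<times> nat) set \<Rightarrow> config
    \<Rightarrow> (nat \<times> nat) \<Rightarrow> (nat \<Rightarrow> nat) \<times> (nat \<times> nat \<times> nat) set" where
  "twist j E \<omega> = \<omega>(j := (fst (\<omega> j), flip E (snd (\<omega> j))))"

lemma twist_Omega: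
  assumes "\<omega> \<in> Omega" "j \<in> blocks" "E \<subseteq> bits" "\<And>c. c < s \<Longrightarrow> par (fst (\<omega> j)) c E = 1"
  shows "twist j E \<omega> \<in> Omega"
proof -
  have "\<omega> j \<in> planted" using assms(1,2) unfolding Omega_def by auto
  then have "fst (\<omega> j) \<in> tup" "snd (\<omega> j) \<in> zero_sum (fst (\<omega> j))"
    unfolding planted_def by auto
  then have "(fst (\<omega> j), flip E (snd (\<omega> j))) \<in> planted"
    using assms(3,4) unfolding planted_def zero_sum_def by (auto simp: par_flip flip_subset)
  then show ?thesis using assms(1,2) unfolding Omega_def twist_def by (auto simp: PiE_iff extensional_def)
qed

lemma twist_twist [simp]: "twist j E (twist j E \<omega>) = \<omega>"
  unfolding twist_def by simp

lemma Omega_tup: "\<omega> \<in> Omega \<Longrightarrow> j \<in> blocks \<Longrightarrow> fst (\<omega> j) \<in> tup"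
  and Omega_zero_sum: "\<omega> \<in> Omega \<Longrightarrow> j \<in> blocks \<Longrightarrow> snd (\<omega> j) \<in> zero_sum (fst (\<omega> j))"
proof -
  assume "\<omega> \<in> Omega" "j \<in> blocks"
  then have "\<omega> j \<in> planted" unfolding Omega_def by auto
  then show "fst (\<omega> j) \<in> tup" "snd (\<omega> j) \<in> zero_sum (fst (\<omega> j))" unfolding planted_def by auto
qed

lemma par_row:
  assumes "r < k"
  shows "par A c' {(r, i, c) | c. c \<in> C} = (if i = A r \<and> c' \<in> C then -1 else 1)"
proof -
  have "par A c' {(r, i, c) | c. c \<in> C} = (\<Prod>r'<k. if r' = r then (if i = A r \<and> c' \<in> C then -1 else 1) else 1)"
    unfolding par_def wsign_def by (intro prod.cong) auto
  then show ?thesis using assms by (simp add: prod.delta)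
qed

text \<open>Toggling second-half bits in one cell of the hidden tuple of \<open>j\<close> gives the
  total over \<open>L'\<close> any value without disturbing the zero sums.\<close>

lemma card_total_one:
  assumes "S \<subseteq> Omega" "L' \<in> choices" "j \<in> set L'"
    and S: "\<And>\<omega> E. \<omega> \<in> S \<Longrightarrow> twist j E \<omega> \<in> Omega \<Longrightarrow> twist j E \<omega> \<in> S"
  shows "2 ^ s * card {\<omega> \<in> S. \<forall>c<s. total L' c \<omega> = 1} = card S"
proof -
  have k: "0 < k" using h_lt by simp
  have j: "j \<in> blocks" using choices_blocks assms(2,3) by blast
  define E :: "nat set \<Rightarrow> _ \<Rightarrow> (nat \<times> nat \<times> nat) set" where "E C \<omega> = {(0, fst (\<omega> j) 0, c') | c'. c' \<in> (\<lambda>c. s + c) ` C}"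
    for C and \<omega> :: "(nat \<times> nat) \<Rightarrow> (nat \<Rightarrow> nat) \<times> (nat \<times> nat \<times> nat) set"
  have E: "E C \<omega> \<subseteq> bits" if "C \<subseteq> {..<s}" "\<omega> \<in> Omega" for C \<omega>
    using that tup_less[OF Omega_tup[OF that(2) j] k] k unfolding E_def bits_def by fastforce
  have par_E: "par (fst (\<omega> j)) c (E C \<omega>) = (if c \<in> (\<lambda>c. s + c) ` C then -1 else 1)" for C c \<omega>
    unfolding E_def par_row[OF k] by simp
  show ?thesis
  proof (rule card_all_one[where \<phi> = "\<lambda>C \<omega>. twist j (E C \<omega>) \<omega>"])
    show "finite S" using assms(1) finite_Omega finite_subset by blast
    fix C \<omega> assume C: "C \<subseteq> {..<s}" and \<omega>: "\<omega> \<in> S"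
    then have \<omega>': "\<omega> \<in> Omega" using assms(1) by auto
    have "twist j (E C \<omega>) \<omega> \<in> Omega"
      using E[OF C \<omega>'] by (intro twist_Omega \<omega>' j) (auto simp: par_E)
    moreover have "E C (twist j (E C \<omega>) \<omega>) = E C \<omega>" unfolding E_def twist_def by simp
    ultimately show "twist j (E C \<omega>) \<omega> \<in> S \<and> twist j (E C (twist j (E C \<omega>) \<omega>)) (twist j (E C \<omega>) \<omega>) = \<omega>"
      using S[OF \<omega>] by simp
    fix c assume "c < s"
    have "(s + c \<in> (\<lambda>c. s + c) ` C) = (c \<in> C)" by auto
    then show "total L' c (twist j (E C \<omega>) \<omega>) = (if c \<in> C then -1 else 1) * total L' c \<omega>"
      unfolding twist_def using choices_distinct[OF assms(2)] assms(3)
      by (intro total_upd) (simp_all add: par_flip par_E)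
  qed (rule total_cases)
qed

lemma card_cancel: "L \<in> choices \<Longrightarrow> 2 ^ s * card (cancel L) = card Omega"
proof -
  assume L: "L \<in> choices"
  have "L \<noteq> []" using choices_length[OF L] h_lt by auto
  then have "hd L \<in> set L" by simp
  then show ?thesis
    using card_total_one[OF subset_refl L, of "hd L"] unfolding cancel_def by simp
qed

text \<open>\<open>L'\<close> has a block outside \<open>L\<close>, whose label can be changed
  without touching the total over \<open>L\<close>. Hence cancellations on different choices are
  pairwise independent.\<close>

lemma card_cancel_two:
  assumes "L \<in> choices" "L' \<in> choices" "L \<noteq> L'"
  shows "2 ^ s * card (cancel L \<inter> cancel L') = card (cancel L)"
proof -
  obtain j where j: "j \<in> set L'" "j \<notin> set L" using choices_new_block[OF assms] .
  have "2 ^ s * card {\<omega> \<in> cancel L. \<forall>c<s. total L' c \<omega> = 1} = card (cancel L)"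
    by (rule card_total_one[OF _ assms(2) j(1)])
      (auto simp: cancel_def twist_def total_upd_other[OF j(2)])
  moreover have "{\<omega> \<in> cancel L. \<forall>c<s. total L' c \<omega> = 1} = cancel L \<inter> cancel L'"
    unfolding cancel_def by auto
  ultimately show ?thesis by simp
qed

text \<open>In some row \<open>A'\<close> selects a cell off the hidden tuple. Toggling first-half
  bits of this cell leaves the hidden tuple's sums and all labels alone, but shifts the sums of
  \<open>A'\<close> arbitrarily.\<close>

lemma card_other_zero_sum:
  assumes L: "L \<in> choices" and j: "j \<in> set L" and A': "A' \<in> tup"
  shows "2 ^ s * card {\<omega> \<in> cancel L. fst (\<omega> j) \<noteq> A' \<and> snd (\<omega> j) \<in> zero_sum A'} \<le> card (cancel L)"
proof -
  have jb: "j \<in> blocks" using choices_blocks L j by blast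
  define S where "S = {\<omega> \<in> cancel L. fst (\<omega> j) \<noteq> A'}"
  \<comment> \<open>The row is a function of the hidden tuple only and hence invariant under
    \<open>twist\<close>.\<close>
  define row where "row \<omega> = (SOME r. r < k \<and> fst (\<omega> j) r \<noteq> A' r)"
    for \<omega> :: "(nat \<times> nat) \<Rightarrow> (nat \<Rightarrow> nat) \<times> (nat \<times> nat \<times> nat) set"
  define E :: "nat set \<Rightarrow> _ \<Rightarrow> (nat \<times> nat \<times> nat) set" where "E C \<omega> = {(row \<omega>, A' (row \<omega>), c) | c. c \<in> C}" for C \<omega>
  have row: "row \<omega> < k" "fst (\<omega> j) (row \<omega>) \<noteq> A' (row \<omega>)" if "\<omega> \<in> S" for \<omega>
  proof -
    have "fst (\<omega> j) \<in> tup" using that Omega_tup[OF _ jb] unfolding S_def cancel_def by auto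
    have "\<exists>r. r < k \<and> fst (\<omega> j) r \<noteq> A' r"
    proof (rule ccontr)
      assume "\<not> ?thesis"
      then have "fst (\<omega> j) = A'"
        using PiE_ext[OF \<open>fst (\<omega> j) \<in> tup\<close>[unfolded tup_def] A'[unfolded tup_def]] by auto
      then show False using that unfolding S_def by simp
    qed
    then show "row \<omega> < k" "fst (\<omega> j) (row \<omega>) \<noteq> A' (row \<omega>)"
      unfolding row_def by (metis (mono_tags, lifting) someI_ex)+
  qed
  have row_twist: "row (twist j F \<omega>) = row \<omega>" for F \<omega> unfolding row_def twist_def by simp
  have "2 ^ s * card {\<omega> \<in> S. \<forall>c<s. par A' c (snd (\<omega> j)) = 1} = card S"
  proof (rule card_all_one[where \<phi> = "\<lambda>C \<omega>. twist j (E C \<omega>) \<omega>"])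
    show "finite S" unfolding S_def cancel_def using finite_Omega by simp
    fix C \<omega> assume C: "C \<subseteq> {..<s}" and \<omega>: "\<omega> \<in> S"
    then have \<omega>': "\<omega> \<in> Omega" unfolding S_def cancel_def by auto
    note r = row[OF \<omega>]
    have E: "E C \<omega> \<subseteq> bits"
      using C tup_less[OF A' r(1)] r(1) unfolding E_def bits_def by fastforce
    have parE: "par (fst (\<omega> j)) c (E C \<omega>) = 1" for c
      unfolding E_def par_row[OF r(1)] using r(2) by auto
    have "twist j (E C \<omega>) \<omega> \<in> Omega"
      by (rule twist_Omega[OF \<omega>' jb E parE])
    moreover have "total L c (twist j (E C \<omega>) \<omega>) = 1 * total L c \<omega>" for c
      unfolding twist_def using choices_distinct[OF L] j
      by (intro total_upd) (simp_all add: par_flip parE)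
    ultimately have "twist j (E C \<omega>) \<omega> \<in> S"
      using \<omega> unfolding S_def cancel_def by (auto simp: twist_def)
    moreover have "E C (twist j (E C \<omega>) \<omega>) = E C \<omega>" unfolding E_def row_twist ..
    ultimately show "twist j (E C \<omega>) \<omega> \<in> S \<and> twist j (E C (twist j (E C \<omega>) \<omega>)) (twist j (E C \<omega>) \<omega>) = \<omega>"
      by simp
    fix c assume "c < s"
    show "par A' c (snd (twist j (E C \<omega>) \<omega> j)) = (if c \<in> C then -1 else 1) * par A' c (snd (\<omega> j))"
      unfolding twist_def E_def by (simp add: par_flip par_row[OF r(1)])
  qed (rule par_cases)
  moreover have "{\<omega> \<in> cancel L. fst (\<omega> j) \<noteq> A' \<and> snd (\<omega> j) \<in> zero_sum A'}
      \<subseteq> {\<omega> \<in> S. \<forall>c<s. par A' c (snd (\<omega> j)) = 1}"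
    unfolding S_def zero_sum_def by auto
  moreover have "finite S" unfolding S_def cancel_def using finite_Omega by simp
  ultimately have "2 ^ s * card {\<omega> \<in> cancel L. fst (\<omega> j) \<noteq> A' \<and> snd (\<omega> j) \<in> zero_sum A'} \<le> card S"
    using mult_le_mono2[OF card_mono, of "{\<omega> \<in> S. \<forall>c<s. par A' c (snd (\<omega> j)) = 1}" _ "2 ^ s"] by simp
  also have "\<dots> \<le> card (cancel L)"
    unfolding S_def cancel_def using finite_Omega by (intro card_mono) auto
  finally show ?thesis .
qed

text \<open>These configurations become accepted inputs once the advice string of \<open>L\<close>
  is filled in; the conditions mirror the clauses of \<open>valid\<close>.\<close>

definition good :: "(nat \<times> nat) list \<Rightarrow> config set" where
  "good L = {\<omega> \<in> cancel L. (\<forall>L'\<in>choices. L' \<noteq> L \<longrightarrow> \<omega> \<notin> cancel L') \<and>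
    (\<forall>j\<in>set L. \<forall>A'\<in>tup. snd (\<omega> j) \<in> zero_sum A' \<longrightarrow> A' = fst (\<omega> j))}"

lemma card_good_ge:
  assumes L: "L \<in> choices"
  shows "card Omega \<le> 2 * 2 ^ s * card (good L)"
proof -
  define B1 where "B1 L' = cancel L \<inter> cancel L'" for L'
  define B2 where "B2 = (\<lambda>(j, A'). {\<omega> \<in> cancel L. fst (\<omega> j) \<noteq> A' \<and> snd (\<omega> j) \<in> zero_sum A'})"
  have fin: "finite (cancel L)" unfolding cancel_def using finite_Omega by simp
  have "cancel L \<subseteq> good L \<union> ((\<Union>L'\<in>choices - {L}. B1 L') \<union> (\<Union>jA\<in>set L \<times> tup. B2 jA))"
    unfolding good_def B1_def B2_def by auto
  moreover have "finite (good L \<union> ((\<Union>L'\<in>choices - {L}. B1 L') \<union> (\<Union>jA\<in>set L \<times> tup. B2 jA)))"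
    using fin by (rule finite_subset[rotated]) (auto simp: good_def B1_def B2_def)
  ultimately have "card (cancel L) \<le> card (good L \<union> ((\<Union>L'\<in>choices - {L}. B1 L') \<union> (\<Union>jA\<in>set L \<times> tup. B2 jA)))"
    by (rule card_mono[rotated])
  also have "\<dots> \<le> card (good L) + (card (\<Union>L'\<in>choices - {L}. B1 L') + card (\<Union>jA\<in>set L \<times> tup. B2 jA))"
    by (meson card_Un_le add_left_mono order_trans)
  also have "card (\<Union>L'\<in>choices - {L}. B1 L') \<le> (\<Sum>L'\<in>choices - {L}. card (B1 L'))"
    using finite_choices by (intro card_UN_le) auto
  also have "card (\<Union>jA\<in>set L \<times> tup. B2 jA) \<le> (\<Sum>jA\<in>set L \<times> tup. card (B2 jA))"
    using finite_tup by (intro card_UN_le) auto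
  finally have "2 ^ s * card (cancel L) \<le> 2 ^ s * card (good L)
      + ((\<Sum>L'\<in>choices - {L}. 2 ^ s * card (B1 L')) + (\<Sum>jA\<in>set L \<times> tup. 2 ^ s * card (B2 jA)))"
    by (simp add: sum_distrib_left[symmetric] distrib_left[symmetric])
  also have "(\<Sum>L'\<in>choices - {L}. 2 ^ s * card (B1 L')) \<le> (\<Sum>L'\<in>choices - {L}. card (cancel L))"
    using card_cancel_two[OF L] by (intro sum_mono) (auto simp: B1_def)
  also have "(\<Sum>jA\<in>set L \<times> tup. 2 ^ s * card (B2 jA)) \<le> (\<Sum>jA\<in>set L \<times> tup. card (cancel L))"
    using card_other_zero_sum[OF L] by (intro sum_mono) (auto simp: B2_def)
  also have "(\<Sum>jA\<in>set L \<times> tup. card (cancel L)) = k * N ^ k * card (cancel L)"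
    using choices_distinct[OF L] choices_length[OF L] by (simp add: distinct_card card_tup card_cartesian_product)
  also have "(\<Sum>L'\<in>choices - {L}. card (cancel L)) \<le> N ^ k * card (cancel L)"
    using card_choices finite_choices by (simp add: card_Diff_subset card_Diff_singleton_if)
  finally have *: "2 ^ s * card (cancel L) \<le> 2 ^ s * card (good L) + (1 + k) * N ^ k * card (cancel L)"
    by (simp add: algebra_simps)
  have "2 * ((1 + k) * N ^ k * card (cancel L)) \<le> 2 ^ s * card (cancel L)"
    using mult_le_mono1[OF good_half, of "card (cancel L)"] by (simp only: mult.assoc)
  with * have "2 ^ s * card (cancel L) \<le> 2 * (2 ^ s * card (good L))" by linarith
  then show ?thesis using card_cancel[OF L] by simp
qed

end

section \<open>The Boolean function\<close>

type_synonym var = "((nat \<times> nat) \<times> (nat \<times> nat \<times> nat)) + ((nat \<times> nat) list \<times> nat)"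

text \<open>\<open>B\<close> is the length of an advice string. The strict inequality leaves room to
  encode all assignments by nonempty sets, so an empty string names none.\<close>

locale hard_instance = instance_params k N s h R eps y
  for k N s h R :: nat and eps y :: real +
  fixes B :: nat
  assumes code_room: "(N ^ k) ^ (k * N) < 2 ^ B"
begin

definition assignments :: "((nat \<times> nat) \<Rightarrow> nat \<Rightarrow> nat) set" where
  "assignments = PiE blocks (\<lambda>_. tup)"

definition code :: "((nat \<times> nat) \<Rightarrow> nat \<Rightarrow> nat) \<Rightarrow> nat set" where
  "code = (SOME g. inj_on g assignments \<and> g ` assignments \<subseteq> Pow {..<B} - {{}})"

lemma code: "inj_on code assignments" "code ` assignments \<subseteq> Pow {..<B} - {{}}"
proof -
  have "card assignments = (N ^ k) ^ (k * N)"
    unfolding assignments_def using finite_blocks by (simp add: card_PiE card_tup card_blocks)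
  then have "card assignments \<le> card (Pow {..<B} - {{}})"
    using code_room by (simp add: card_Diff_singleton card_Pow)
  moreover have "finite assignments"
    unfolding assignments_def using finite_blocks finite_tup by (intro finite_PiE) auto
  ultimately have "\<exists>g. g ` assignments \<subseteq> Pow {..<B} - {{}} \<and> inj_on g assignments"
    by (intro card_le_inj) auto
  then have "\<exists>g. inj_on g assignments \<and> g ` assignments \<subseteq> Pow {..<B} - {{}}" by blast
  from someI_ex[OF this] show "inj_on code assignments" "code ` assignments \<subseteq> Pow {..<B} - {{}}"
    unfolding code_def by auto
qed

section \<open>Inputs as bit lists and the accepted inputs\<close>

definition vars :: "var set" where
  "vars = Inl ` (blocks \<times> bits) \<union> Inr ` (choices \<times> {..<B})"

definition n_vars :: nat where
  "n_vars = card vars"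

definition var_of :: "nat \<Rightarrow> var" where
  "var_of = (SOME g. bij_betw g {..<n_vars} vars)"

lemma finite_vars: "finite vars"
  unfolding vars_def using finite_blocks finite_bits finite_choices by auto

lemma bij_var_of: "bij_betw var_of {..<n_vars} vars"
proof -
  have "\<exists>g. bij_betw g {0..<card vars} vars" using ex_bij_betw_nat_finite[OF finite_vars] .
  then have "\<exists>g. bij_betw g {..<n_vars} vars" by (simp add: n_vars_def atLeast0LessThan)
  then show ?thesis unfolding var_of_def by (rule someI_ex)
qed

lemma var_of_vars: "i < n_vars \<Longrightarrow> var_of i \<in> vars"
  using bij_betw_apply[OF bij_var_of] by auto

lemma var_of_inj: "i < n_vars \<Longrightarrow> i' < n_vars \<Longrightarrow> var_of i = var_of i' \<Longrightarrow> i = i'"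
  using bij_var_of unfolding bij_betw_def inj_on_def by auto

lemma var_of_surj: "e \<in> vars \<Longrightarrow> \<exists>i<n_vars. var_of i = e"
  using bij_var_of unfolding bij_betw_def by (metis imageE lessThan_iff)

definition word :: "var set \<Rightarrow> bool list" where
  "word V = map (\<lambda>i. var_of i \<in> V) [0..<n_vars]"

definition true_vars :: "bool list \<Rightarrow> var set" where
  "true_vars z = {var_of i | i. i < n_vars \<and> z ! i}"

lemma word_cube: "word V \<in> cube n_vars"
  unfolding word_def cube_def by simp

lemma word_nth: "i < n_vars \<Longrightarrow> word V ! i \<longleftrightarrow> var_of i \<in> V"
  unfolding word_def by simp

lemma true_vars_iff: "i < n_vars \<Longrightarrow> var_of i \<in> true_vars z \<longleftrightarrow> z ! i"
  unfolding true_vars_def using var_of_inj by blast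

lemma true_vars_sub: "true_vars z \<subseteq> vars"
  unfolding true_vars_def using var_of_vars by auto

lemma true_vars_word: "true_vars (word V) = V \<inter> vars"
proof (rule Set.set_eqI)
  fix e
  show "e \<in> true_vars (word V) \<longleftrightarrow> e \<in> V \<inter> vars"
  proof (cases "e \<in> vars")
    case True
    then obtain i where "i < n_vars" "var_of i = e" using var_of_surj by blast
    then show ?thesis using true_vars_iff[of i "word V"] word_nth[of i V] True by auto
  next
    case False
    then show ?thesis using true_vars_sub by auto
  qed
qed

definition block_bits :: "var set \<Rightarrow> nat \<times> nat \<Rightarrow> (nat \<times> nat \<times> nat) set" where
  "block_bits V j = {b. Inl (j, b) \<in> V}"

definition cell :: "var set \<Rightarrow> (nat \<times> nat) list \<Rightarrow> nat set" where
  "cell V L = {b. Inr (L, b) \<in> V}"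

definition shown :: "var set \<Rightarrow> ((nat \<times> nat) \<Rightarrow> nat \<Rightarrow> nat) \<Rightarrow> (nat \<times> nat) \<Rightarrow> (nat \<Rightarrow> nat) \<times> (nat \<times> nat \<times> nat) set" where
  "shown V A j = (A j, block_bits V j)"

text \<open>The last clause, uniqueness of the zero-sum tuple in the blocks of \<open>L\<close>, is what makes the
  terms of \<open>dnf\<close> disjoint: if \<open>(L, A)\<close> and \<open>(L', A')\<close> are both valid, it forces \<open>A = A'\<close> on \<open>L\<close>, so
  that the labels cancel on \<open>L\<close> for both.\<close>

definition valid :: "var set \<Rightarrow> (nat \<times> nat) list \<Rightarrow> ((nat \<times> nat) \<Rightarrow> nat \<Rightarrow> nat) \<Rightarrow> bool" where
  "valid V L A \<longleftrightarrow> L \<in> choices \<and> A \<in> assignments \<and> cell V L = code A \<and>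
    (\<forall>j\<in>blocks. \<forall>c<s. par (A j) c (block_bits V j) = 1) \<and>
    (\<forall>c<s. total L c (shown V A) = 1) \<and>
    (\<forall>L'\<in>choices. L' \<noteq> L \<longrightarrow> \<not> (\<forall>c<s. total L' c (shown V A) = 1)) \<and>
    (\<forall>j\<in>set L. \<forall>A'\<in>tup. (\<forall>c<s. par A' c (block_bits V j) = 1) \<longrightarrow> A' = A j)"

lemma validD:
  assumes "valid V L A"
  shows "L \<in> choices" "A \<in> assignments" "cell V L = code A"
    "j \<in> blocks \<Longrightarrow> c < s \<Longrightarrow> par (A j) c (block_bits V j) = 1"
    "c < s \<Longrightarrow> total L c (shown V A) = 1"
    "L' \<in> choices \<Longrightarrow> L' \<noteq> L \<Longrightarrow> \<not> (\<forall>c<s. total L' c (shown V A) = 1)"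
    "j \<in> set L \<Longrightarrow> A' \<in> tup \<Longrightarrow> \<forall>c<s. par A' c (block_bits V j) = 1 \<Longrightarrow> A' = A j"
  using assms unfolding valid_def by blast+

definition fn :: "bool list \<Rightarrow> bool" where
  "fn z \<longleftrightarrow> (\<exists>L A. valid (true_vars z) L A)"

lemma valid_unique:
  assumes "valid V L A" "valid V L' A'"
  shows "L = L' \<and> A = A'"
proof -
  note v = validD[OF assms(1)] and v' = validD[OF assms(2)]
  have "L = L'"
  proof (rule ccontr)
    assume "L \<noteq> L'"
    have "A' j = A j" if j: "j \<in> set L" for j
    proof (rule v(7)[OF j])
      have jb: "j \<in> blocks" using choices_blocks[OF v(1)] j by auto
      then show "A' j \<in> tup" using v'(2) unfolding assignments_def by auto
      show "\<forall>c<s. par (A' j) c (block_bits V j) = 1" using v'(4)[OF jb] by blast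
    qed
    then have "total L c (shown V A') = total L c (shown V A)" for c
      unfolding total_def shown_def by (intro arg_cong[where f = prod_list] map_cong) auto
    then have "\<forall>c<s. total L c (shown V A') = 1" using v(5) by simp
    then show False using v'(6)[OF v(1) \<open>L \<noteq> L'\<close>] by blast
  qed
  moreover have "A = A'"
    using v(3) v'(3) \<open>L = L'\<close> code(1) v(2) v'(2) by (auto dest: inj_onD)
  ultimately show ?thesis ..
qed

section \<open>Certificates and their disjointness\<close>

definition reads :: "(nat \<times> nat) list \<Rightarrow> ((nat \<times> nat) \<Rightarrow> nat \<Rightarrow> nat) \<Rightarrow> var set" where
  "reads L A = Inr ` ({L} \<times> {..<B}) \<union> Inl ` (set L \<times> bits) \<union>
    (\<lambda>(j, r, c). Inl (j, r, A j r, c)) ` (blocks \<times> {..<k} \<times> {..<2 * s})"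

lemma card_reads: "L \<in> choices \<Longrightarrow> card (reads L A) \<le> B + k * (k * (N * (2 * s))) + k * N * (k * (2 * s))"
proof -
  assume L: "L \<in> choices"
  have "card (Inr ` ({L} \<times> {..<B}) :: var set) \<le> B"
    by (rule order_trans[OF card_image_le]) (simp_all add: card_cartesian_product)
  moreover have "card (Inl ` (set L \<times> bits) :: var set) \<le> k * (k * (N * (2 * s)))"
  proof -
    have "card (Inl ` (set L \<times> bits) :: var set) \<le> card (set L \<times> bits)"
      using finite_bits by (intro card_image_le) auto
    also have "\<dots> = card (set L) * card bits" by (rule card_cartesian_product)
    also have "\<dots> \<le> k * card bits"
      using choices_length[OF L] card_length[of L] by (intro mult_le_mono1) simp
    also have "card bits = k * (N * (2 * s))" unfolding bits_def by (simp add: card_cartesian_product)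
    finally show ?thesis .
  qed
  moreover have "card ((\<lambda>(j, r, c). Inl (j, r, A j r, c)) ` (blocks \<times> {..<k} \<times> {..<2 * s}) :: var set) \<le> k * N * (k * (2 * s))"
    by (rule order_trans[OF card_image_le]) (simp_all add: card_cartesian_product card_blocks finite_blocks)
  ultimately show ?thesis unfolding reads_def by (meson card_Un_le add_mono order_trans)
qed

lemma reads_vars: "L \<in> choices \<Longrightarrow> A \<in> assignments \<Longrightarrow> reads L A \<subseteq> vars"
proof
  fix e assume L: "L \<in> choices" and A: "A \<in> assignments" and "e \<in> reads L A"
  then consider b where "e = Inr (L, b)" "b < B" | j b where "e = Inl (j, b)" "j \<in> set L" "b \<in> bits"
    | j r c where "e = Inl (j, r, A j r, c)" "j \<in> blocks" "r < k" "c < 2 * s"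
    unfolding reads_def by auto
  then show "e \<in> vars"
  proof cases
    case 1
    then show ?thesis using L unfolding vars_def by auto
  next
    case 2
    then show ?thesis using choices_blocks[OF L] unfolding vars_def by auto
  next
    case 3
    then have "A j r < N" using A tup_less unfolding assignments_def by auto
    then show ?thesis using 3 unfolding vars_def bits_def by auto
  qed
qed

lemma par_cong: "(\<And>r. r < k \<Longrightarrow> (r, A r, c) \<in> x \<longleftrightarrow> (r, A r, c) \<in> x') \<Longrightarrow> par A c x = par A c x'"
  unfolding par_def wsign_def by (intro prod.cong) auto

text \<open>Uniqueness of tuples is asked only for the blocks of \<open>L\<close>, which are read
  completely. The clauses on zero sums and totals, also those refuting all other choices, look only
  at the cells named by \<open>A\<close>, which are read in every block.\<close>

lemma valid_cong:
  assumes "valid V L A" "V \<subseteq> vars" "V' \<subseteq> vars" and agree: "\<And>e. e \<in> reads L A \<Longrightarrow> e \<in> V \<longleftrightarrow> e \<in> V'"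
  shows "valid V' L A"
proof -
  have L: "L \<in> choices" and A: "A \<in> assignments" using validD(1,2)[OF assms(1)] .
  have cell: "cell V' L = cell V L"
  proof -
    have "Inr (L, b) \<in> V \<longleftrightarrow> Inr (L, b) \<in> V'" for b
    proof (cases "b < B")
      case True
      then show ?thesis using agree[of "Inr (L, b)"] unfolding reads_def by auto
    next
      case False
      then show ?thesis using assms(2,3) unfolding vars_def by auto
    qed
    then show ?thesis unfolding cell_def by auto
  qed
  have bb: "block_bits V' j = block_bits V j" if "j \<in> set L" for j
  proof -
    have "Inl (j, b) \<in> V \<longleftrightarrow> Inl (j, b) \<in> V'" for b
    proof (cases "b \<in> bits")
      case True
      then show ?thesis using agree[of "Inl (j, b)"] that unfolding reads_def by auto
    next
      case False
      then show ?thesis using assms(2,3) unfolding vars_def by auto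
    qed
    then show ?thesis unfolding block_bits_def by auto
  qed
  have par: "par (A j) c (block_bits V' j) = par (A j) c (block_bits V j)" if "j \<in> blocks" "c < 2 * s" for j c
  proof (rule par_cong)
    fix r assume "r < k"
    then have "Inl (j, r, A j r, c) \<in> reads L A"
      unfolding reads_def using that by (intro UnI2 image_eqI[where x = "(j, r, c)"]) auto
    then show "(r, A j r, c) \<in> block_bits V' j \<longleftrightarrow> (r, A j r, c) \<in> block_bits V j"
      using agree unfolding block_bits_def by auto
  qed
  have tot: "total L' c (shown V' A) = total L' c (shown V A)" if "L' \<in> choices" "c < s" for L' c
    unfolding total_def using choices_blocks[OF that(1)] that(2)
    by (intro arg_cong[where f = prod_list] map_cong refl) (auto simp: shown_def intro!: par)
  note v = validD[OF assms(1)]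
  show ?thesis
    unfolding valid_def
  proof (intro conjI ballI allI impI L A)
    show "cell V' L = code A" using v(3) cell by simp
    show "par (A j) c (block_bits V' j) = 1" if "j \<in> blocks" "c < s" for j c
      using par[OF that(1)] v(4)[OF that] that(2) by simp
    show "total L c (shown V' A) = 1" if "c < s" for c using tot[OF L that] v(5)[OF that] by simp
    show "\<not> (\<forall>c<s. total L' c (shown V' A) = 1)" if "L' \<in> choices" "L' \<noteq> L" for L'
      using tot[OF that(1)] v(6)[OF that] by simp
    show "A' = A j" if "j \<in> set L" "A' \<in> tup" "\<forall>c<s. par A' c (block_bits V' j) = 1" for j A'
      using v(7)[OF that(1,2)] that(3) bb[OF that(1)] by simp
  qed
qed

definition cert :: "bool list \<Rightarrow> (nat \<times> nat) list \<Rightarrow> ((nat \<times> nat) \<Rightarrow> nat \<Rightarrow> nat) \<Rightarrow> nat \<Rightarrow> bool option" where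
  "cert z L A i = (if i < n_vars \<and> var_of i \<in> reads L A then Some (z ! i) else None)"

lemma dom_cert: "dom (cert z L A) = {i. i < n_vars \<and> var_of i \<in> reads L A}"
  unfolding cert_def by (auto split: if_splits)

lemma consistent_cert:
  "consistent (cert z L A) z' \<longleftrightarrow> (\<forall>i<n_vars. var_of i \<in> reads L A \<longrightarrow> z ! i = z' ! i)"
  unfolding consistent_def dom_cert by (auto simp: cert_def)

lemma consistent_cert_valid:
  assumes "valid (true_vars z) L A" "consistent (cert z L A) z'"
  shows "valid (true_vars z') L A"
proof (rule valid_cong[OF assms(1) true_vars_sub true_vars_sub])
  fix e assume e: "e \<in> reads L A"
  have "L \<in> choices" "A \<in> assignments" using validD(1,2)[OF assms(1)] .
  then have "e \<in> vars" using e reads_vars by blast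
  then obtain i where "i < n_vars" "var_of i = e" using var_of_surj by blast
  then show "e \<in> true_vars z \<longleftrightarrow> e \<in> true_vars z'"
    using assms(2) e true_vars_iff unfolding consistent_cert by auto
qed

definition dnf :: "(nat \<Rightarrow> bool option) set" where
  "dnf = {cert z L A | z L A. z \<in> cube n_vars \<and> valid (true_vars z) L A}"

text \<open>Every term consistent with \<open>z\<close> comes from a pair valid at \<open>z\<close>,
  and \<open>valid_unique\<close> leaves one pair. The pair determines the variables of the term,
  and \<open>z\<close> their values.\<close>

lemma unambiguous_dnf_fn: "unambiguous_dnf n_vars fn dnf"
  unfolding unambiguous_dnf_def
proof (intro conjI ballI impI)
  show "dnf \<subseteq> terms n_vars"
  proof
    fix t assume "t \<in> dnf"
    then obtain z L A where "t = cert z L A" unfolding dnf_def by blast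
    then have "dom t \<subseteq> {..<n_vars}" by (auto simp only: dom_cert)
    then show "t \<in> terms n_vars" unfolding terms_def by simp
  qed
  fix z assume z: "z \<in> cube n_vars"
  show "fn z \<longleftrightarrow> (\<exists>t\<in>dnf. consistent t z)"
  proof
    assume "fn z"
    then obtain L A where "valid (true_vars z) L A" unfolding fn_def by blast
    then have "cert z L A \<in> dnf" "consistent (cert z L A) z"
      using z unfolding dnf_def consistent_cert by auto
    then show "\<exists>t\<in>dnf. consistent t z" by blast
  next
    assume "\<exists>t\<in>dnf. consistent t z"
    then show "fn z" unfolding dnf_def fn_def using consistent_cert_valid by blast
  qed
  fix t t' assume "t \<in> dnf" "t' \<in> dnf" and c: "consistent t z" "consistent t' z"
  then obtain x L A x' L' A' where t: "t = cert x L A" "valid (true_vars x) L A"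
    "t' = cert x' L' A'" "valid (true_vars x') L' A'"
    unfolding dnf_def by blast
  have "valid (true_vars z) L A" "valid (true_vars z) L' A'"
    using c t consistent_cert_valid by auto
  then have eq: "L = L'" "A = A'" using valid_unique by auto
  show "t = t'"
  proof
    fix i
    show "t i = t' i"
      using c unfolding t(1,3) consistent_cert eq by (auto simp: cert_def eq)
  qed
qed

definition width_bound :: nat where
  "width_bound = B + k * (k * (N * (2 * s))) + k * N * (k * (2 * s))"

lemma width_dnf:
  assumes "t \<in> dnf"
  shows "width t \<le> width_bound"
proof -
  obtain z L A where t: "t = cert z L A" "valid (true_vars z) L A" using assms unfolding dnf_def by blast
  have L: "L \<in> choices" using t(2) unfolding valid_def by simp
  have "width t \<le> card (reads L A)"
    unfolding width_def t(1) dom_cert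
    by (rule card_inj_on_le[of var_of])
      (auto simp: inj_on_def reads_def finite_blocks finite_bits intro: var_of_inj)
  also have "\<dots> \<le> width_bound" unfolding width_bound_def by (rule card_reads[OF L])
  finally show ?thesis .
qed

lemma UC1_witness: "\<exists>D. unambiguous_dnf n_vars fn D \<and> (\<forall>t\<in>D. width t \<le> UC1 n_vars fn)"
proof -
  have "\<exists>D. unambiguous_dnf n_vars fn D \<and> (\<forall>t\<in>D. width t \<le> width_bound)"
    using unambiguous_dnf_fn width_dnf by blast
  then show ?thesis unfolding UC1_def by (rule LeastI)
qed

lemma UC1_le: "UC1 n_vars fn \<le> width_bound"
  unfolding UC1_def using unambiguous_dnf_fn width_dnf by (intro Least_le) blast

section \<open>Inputs with empty and with filled advice\<close>

definition content ::
  "config \<Rightarrow> ((nat \<times> nat) list \<times> nat) set \<Rightarrow> var set" where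
  "content \<omega> C = Inl ` {(j, b). b \<in> snd (\<omega> j)} \<union> Inr ` C"

definition tuples :: "config \<Rightarrow> (nat \<times> nat) \<Rightarrow> nat \<Rightarrow> nat" where
  "tuples \<omega> = restrict (\<lambda>j. fst (\<omega> j)) blocks"

definition empty_word where "empty_word \<omega> = word (content \<omega> {})"

definition filled_word where "filled_word L \<omega> = word (content \<omega> ({L} \<times> code (tuples \<omega>)))"

lemma tuples_assignments: "\<omega> \<in> Omega \<Longrightarrow> tuples \<omega> \<in> assignments"
  unfolding tuples_def assignments_def using Omega_tup by auto

lemma code_nonempty: "A \<in> assignments \<Longrightarrow> code A \<noteq> {}" and code_less: "A \<in> assignments \<Longrightarrow> code A \<subseteq> {..<B}"
  using code(2) by auto

lemma block_bits_content:
  assumes "\<omega> \<in> Omega" "j \<in> blocks"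
  shows "block_bits (content \<omega> C \<inter> vars) j = snd (\<omega> j)"
proof -
  have "snd (\<omega> j) \<subseteq> bits" using Omega_zero_sum[OF assms] unfolding zero_sum_def by auto
  then show ?thesis unfolding block_bits_def content_def vars_def using assms(2) by auto
qed

lemma not_fn_empty_word: "\<not> fn (empty_word \<omega>)"
proof
  assume "fn (empty_word \<omega>)"
  then obtain L A where "valid (content \<omega> {} \<inter> vars) L A"
    unfolding fn_def empty_word_def true_vars_word by blast
  note v = validD[OF this]
  have "code A = {}" using v(3) unfolding cell_def content_def by auto
  then show False using code_nonempty[OF v(2)] by simp
qed

lemma total_content:
  assumes "\<omega> \<in> Omega" "L \<in> choices"
  shows "total L c (shown (content \<omega> C \<inter> vars) (tuples \<omega>)) = total L c \<omega>"
  unfolding total_def using choices_blocks[OF assms(2)]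
  by (intro arg_cong[where f = prod_list] map_cong refl)
    (auto simp: shown_def tuples_def block_bits_content[OF assms(1)])

lemma good_Omega: "\<omega> \<in> good L \<Longrightarrow> \<omega> \<in> Omega"
  unfolding good_def cancel_def by auto

lemma valid_filled_word:
  assumes L: "L \<in> choices" and \<omega>: "\<omega> \<in> good L"
  shows "valid (true_vars (filled_word L \<omega>)) L (tuples \<omega>)"
proof -
  note O = good_Omega[OF \<omega>]
  let ?V = "content \<omega> ({L} \<times> code (tuples \<omega>)) \<inter> vars"
  have A: "tuples \<omega> \<in> assignments" by (rule tuples_assignments[OF O])
  have cell: "cell ?V L = code (tuples \<omega>)"
    using L code_less[OF A] unfolding cell_def content_def vars_def by auto
  have par: "par (tuples \<omega> j) c (block_bits ?V j) = 1" if "j \<in> blocks" "c < s" for j c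
    using that Omega_zero_sum[OF O that(1)] unfolding zero_sum_def
    by (simp add: block_bits_content[OF O] tuples_def)
  have tot: "(\<forall>c<s. total L' c (shown ?V (tuples \<omega>)) = 1) \<longleftrightarrow> \<omega> \<in> cancel L'" if "L' \<in> choices" for L'
    unfolding cancel_def using O by (simp add: total_content[OF O that])
  have unique: "A' = tuples \<omega> j" if "j \<in> set L" "A' \<in> tup" "\<forall>c<s. par A' c (block_bits ?V j) = 1" for j A'
  proof -
    have j: "j \<in> blocks" using choices_blocks[OF L] that(1) by auto
    then have "snd (\<omega> j) \<in> zero_sum A'"
      using that(3) Omega_zero_sum[OF O j] unfolding zero_sum_def by (auto simp: block_bits_content[OF O j])
    then show ?thesis using \<omega> that(1,2) j unfolding good_def tuples_def by auto
  qed
  have "\<omega> \<in> cancel L" "\<And>L'. L' \<in> choices \<Longrightarrow> L' \<noteq> L \<Longrightarrow> \<omega> \<notin> cancel L'"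
    using \<omega> unfolding good_def by auto
  then show ?thesis
    unfolding filled_word_def true_vars_word valid_def
    using L A cell par tot unique by blast
qed

text \<open>If a term holding at an accepted input missed a block, a first-half bit of this block's
  hidden tuple could be toggled without leaving the term. The advice still names \<open>A\<close>,
  and all other strings are empty, so only \<open>A\<close> could be valid, but its zero sum is
  destroyed. Hence the term has a variable in each of the \<open>k * N\<close> blocks.\<close>

lemma UC1_ge:
  assumes L: "L \<in> choices" and \<omega>: "\<omega> \<in> good L"
  shows "k * N \<le> UC1 n_vars fn"
proof -
  define z where "z = filled_word L \<omega>"
  define A where "A = tuples \<omega>"
  have z: "z \<in> cube n_vars" unfolding z_def filled_word_def by (rule word_cube)
  have val: "valid (true_vars z) L A" unfolding z_def A_def by (rule valid_filled_word[OF L \<omega>])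
  have k0: "0 < k" using h_lt by simp
  obtain D where D: "unambiguous_dnf n_vars fn D" "\<And>t. t \<in> D \<Longrightarrow> width t \<le> UC1 n_vars fn"
    using UC1_witness by blast
  have "fn z" using val unfolding fn_def by blast
  then obtain t where t: "t \<in> D" "consistent t z"
    using D(1) z unfolding unambiguous_dnf_def by blast
  have finite_dom: "finite (dom t)" "dom t \<subseteq> {..<n_vars}"
    using D(1) t(1) unfolding unambiguous_dnf_def terms_def by (auto intro: finite_subset)
  have touch: "\<exists>i\<in>dom t. \<exists>b. var_of i = Inl (j, b)" if j: "j \<in> blocks" for j
  proof (rule ccontr)
    assume no: "\<not> (\<exists>i\<in>dom t. \<exists>b. var_of i = Inl (j, b))"
    define e :: var where "e = Inl (j, 0, A j 0, 0)"
    have Aj: "A j \<in> tup" using validD(2)[OF val] j unfolding assignments_def by auto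
    have e: "e \<in> vars" using j tup_less[OF Aj k0] k0 s_pos unfolding e_def vars_def bits_def by auto
    define V where "V = flip {e} (true_vars z)"
    have V: "V \<subseteq> vars" unfolding V_def using e true_vars_sub by (intro flip_subset) auto
    have tvV: "true_vars (word V) = V" unfolding true_vars_word using V by auto
    have "consistent t (word V)"
      unfolding consistent_def
    proof
      fix i assume i: "i \<in> dom t"
      then have "i < n_vars" "var_of i \<noteq> e" using finite_dom(2) no unfolding e_def by auto
      then have "word V ! i \<longleftrightarrow> z ! i"
        unfolding word_nth[OF \<open>i < n_vars\<close>] V_def flip_def using true_vars_iff[of i z] by auto
      then show "t i = Some (word V ! i)" using t(2) i unfolding consistent_def by auto
    qed
    then have "fn (word V)" using D(1) t(1) word_cube unfolding unambiguous_dnf_def by blast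
    then obtain L' A' where val': "valid V L' A'" unfolding fn_def tvV by blast
    have "A' \<in> assignments" "code A' = cell V L'" using validD(2,3)[OF val'] by auto
    moreover have "cell V L' = (if L' = L then code A else {})"
    proof -
      have "A \<in> assignments" using validD(2)[OF val] .
      then show ?thesis
        using code_less L unfolding cell_def V_def flip_def e_def z_def filled_word_def true_vars_word content_def A_def[symmetric] vars_def
        by auto
    qed
    ultimately have "code A' = code A" using code_nonempty[of A'] by (auto split: if_splits)
    then have "A' = A"
      using inj_onD[OF code(1)] validD(2)[OF val] validD(2)[OF val'] by blast
    have "par (A j) 0 (block_bits V j) = 1"
      using validD(4)[OF val' j s_pos] unfolding \<open>A' = A\<close> .
    moreover have "block_bits V j = flip {(0, A j 0, 0)} (block_bits (true_vars z) j)"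
      unfolding V_def block_bits_def flip_def e_def by auto
    moreover have "par (A j) 0 (block_bits (true_vars z) j) = 1"
      by (rule validD(4)[OF val j s_pos])
    ultimately show False using k0 by (simp add: par_flip par_single)
  qed
  define pos where "pos j = (SOME i. i \<in> dom t \<and> (\<exists>b. var_of i = Inl (j, b)))" for j
  have pos: "pos j \<in> dom t \<and> (\<exists>b. var_of (pos j) = Inl (j, b))" if "j \<in> blocks" for j
    unfolding pos_def by (rule someI_ex) (use touch[OF that] in blast)
  have "inj_on pos blocks"
  proof (rule inj_onI)
    fix j j' assume j: "j \<in> blocks" "j' \<in> blocks" "pos j = pos j'"
    obtain b where b: "var_of (pos j) = Inl (j, b)" using pos[OF j(1)] by blast
    obtain b' where "var_of (pos j') = Inl (j', b')" using pos[OF j(2)] by blast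
    then show "j = j'" using b unfolding j(3) by simp
  qed
  then have "card blocks \<le> card (dom t)"
    using pos finite_dom(1) by (intro card_inj_on_le[where f = pos] image_subsetI) blast+
  then have "k * N \<le> width t" unfolding width_def card_blocks .
  then show ?thesis using D(2)[OF t(1)] by linarith
qed

lemma card_Omega_pos: "0 < card Omega"
  unfolding Omega_def using finite_blocks planted_nonempty finite_planted
  by (simp add: card_PiE card_gt_0_iff)

text \<open>On a good configuration the algorithm tells the empty from the filled advice string of
  \<open>L\<close>, so this string receives query weight at least 1 / (100 * T). Good configurations
  are at least a fraction 2^-s / 2 of \<open>Omega\<close> for each of the N^k choices, and
  \<open>total_conditioned_mass_le\<close> bounds the whole weight on cancelling configurations with
  the same 2^-s, which drops out.\<close>

lemma query_bound:
  assumes comp: "quantum_computable_with n_vars fn T"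
  shows "N ^ k \<le> 200 * real T ^ 2 *
    (2 + 8 * real T ^ 2 * N ^ k * (1 / (y * N)) ^ (h - 1) * blocks.rate ^ T)"
proof -
  obtain m U Acc where m: "1 \<le> m" and U: "\<And>t. t \<le> T \<Longrightarrow> unitary_mat (space_dim n_vars m) (U t)"
    and out: "\<And>z. z \<in> cube n_vars \<Longrightarrow> output_prob n_vars m U Acc T z (fn z) \<ge> 2 / 3"
    using comp unfolding quantum_computable_with_def by blast
  interpret run: quantum_run n_vars m U T
    by unfold_locales (use U m in auto)
  let ?d = "space_dim n_vars m"
  define F where "F t k' \<omega> = amp n_vars m U (empty_word \<omega>) t k'" for t k' \<omega>
  \<comment> \<open>Advice bits are 0 in every \<open>empty_word\<close>, so querying them acts like
    the null query.\<close>
  define q where "q k' = (if query_index n_vars k' < n_vars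
    then (case var_of (query_index n_vars k') of Inl e \<Rightarrow> Some e | Inr _ \<Rightarrow> None) else None)" for k'
  have q_fl: "q (flip_answer k') = q k'" for k' unfolding q_def by simp
  have q_blk: "block_of e \<in> blocks" if "q k' = Some e" for k' e
  proof -
    have "query_index n_vars k' < n_vars" "var_of (query_index n_vars k') = Inl e"
      using that unfolding q_def by (auto split: if_splits sum.splits)
    then have "Inl e \<in> vars" using var_of_vars by metis
    then show ?thesis unfolding vars_def block_of_def by auto
  qed
  have ask: "amp n_vars m U (empty_word \<omega>) t (oracle_perm n_vars (empty_word \<omega>) k') =
    (case q k' of None \<Rightarrow> F t k' | Some e \<Rightarrow>
      (\<lambda>_. 1/2) * (F t k' + F t (flip_answer k')) + bit_sign e * ((\<lambda>_. 1/2) * (F t k' - F t (flip_answer k')))) \<omega>"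
    for t k' \<omega>
  proof (cases "query_index n_vars k' < n_vars")
    case True
    note nth = word_nth[OF True, of "content \<omega> {}"]
    show ?thesis
    proof (cases "var_of (query_index n_vars k')")
      case (Inl e)
      have "empty_word \<omega> ! query_index n_vars k' \<longleftrightarrow> snd e \<in> snd (\<omega> (fst e))"
        unfolding empty_word_def nth Inl unfolding content_def by (cases e) auto
      then show ?thesis
        using True Inl unfolding q_def oracle_perm_def F_def bit_sign_def wsign_def
        by (auto simp: pointwise field_simps)
    next
      case (Inr e)
      then have "\<not> empty_word \<omega> ! query_index n_vars k'"
        unfolding empty_word_def nth unfolding content_def by auto
      then show ?thesis using Inr unfolding q_def oracle_perm_def F_def by simp
    qed
  next
    case False
    then show ?thesis unfolding q_def oracle_perm_def F_def by simp
  qed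
  have F_Suc: "F (Suc t) k' = mix ?d (\<lambda>i i'. U (Suc t) $$ (i, i')) (\<lambda>k'. case q k' of None \<Rightarrow> F t k' | Some e \<Rightarrow>
      (\<lambda>_. 1/2) * (F t k' + F t (flip_answer k')) + bit_sign e * ((\<lambda>_. 1/2) * (F t k' - F t (flip_answer k')))) k'"
    if "t < T" "k' < ?d" for t k'
  proof
    fix \<omega>
    have "F (Suc t) k' \<omega> = (\<Sum>i<?d. U (Suc t) $$ (k', i) *
        amp n_vars m U (empty_word \<omega>) t (oracle_perm n_vars (empty_word \<omega>) i))"
      unfolding F_def using that by (intro run.amp_Suc) auto
    then show "F (Suc t) k' \<omega> = mix ?d (\<lambda>i i'. U (Suc t) $$ (i, i')) (\<lambda>k'. case q k' of None \<Rightarrow> F t k' | Some e \<Rightarrow>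
      (\<lambda>_. 1/2) * (F t k' + F t (flip_answer k')) + bit_sign e * ((\<lambda>_. 1/2) * (F t k' - F t (flip_answer k')))) k' \<omega>"
      unfolding mix_def sum_fun_apply times_fun_apply ask .
  qed
  have v: "(\<Sum>k'<?d. (cmod (U 0 $$ (k', 0)))\<^sup>2) = 1"
    using run.sum_amp[of 0 "[]"] by (simp add: run.amp_0)
  \<comment> \<open>The unitaries are shifted by one: \<open>U 0\<close> only prepares the initial
    amplitudes, which do not depend on the input.\<close>
  interpret qr: query_run Omega blocks Qc bit_sign block_of block_label R s eps y ?d T
    "\<lambda>t i i'. U (Suc t) $$ (i, i')" q flip_answer F "\<lambda>k'. U 0 $$ (k', 0)"
  proof unfold_locales
    show "isometric ?d (\<lambda>i i'. U (Suc t) $$ (i, i'))" if "t < T" for t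
      using that run.isometric_U[of "Suc t"] by simp
    show "F 0 k' = (\<lambda>_. U 0 $$ (k', 0)) * 1" if "k' < ?d" for k'
      unfolding F_def by (rule ext) (simp add: run.amp_0[OF that] pointwise)
  qed (use q_fl q_blk F_Suc v in \<open>auto simp: flip_answer_less\<close>)
  define C where "C L = {k'. k' < ?d \<and> query_index n_vars k' < n_vars \<and>
    (\<exists>b. var_of (query_index n_vars k') = Inr (L, b))}" for L
  have C: "C L \<subseteq> {..<?d}" for L unfolding C_def by auto
  have C_disj: "C L \<inter> C L' = {}" if "L \<noteq> L'" for L L' using that unfolding C_def by auto
  let ?X = "(2 + 8 * real T ^ 2 * N ^ k * (1 / (y * N)) ^ (h - 1) * blocks.rate ^ T) * card Omega / 2 ^ s"
  have mass: "(\<Sum>L\<in>choices. \<Sum>k'\<in>C L. sqn (cancel L) (F t k')) \<le> ?X" if t: "t \<le> T" for t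
  proof -
    have "(\<Sum>L\<in>set (product_lists groups). \<Sum>k'\<in>C L. sqn (cancel L) (F t k'))
      \<le> (2 + 8 * real T ^ 2 * N ^ length groups * (1 / (y * N)) ^ (h - 1) * blocks.rate ^ T) * card Omega / 2 ^ s"
    proof (rule qr.total_conditioned_mass_le)
      show "set (concat groups) \<subseteq> blocks" "distinct (concat groups)" "0 < N" "t \<le> T"
        using set_concat_groups distinct_concat_groups N_pos t by auto
      \<comment> \<open>The threshold is \<open>h - 1\<close> because a query may reveal one more
        label, and even then fewer than half may be known.\<close>
      show "2 * Suc (h - 1) < length groups" using h_lt h_pos length_groups by simp
      show "length g = N" if "g \<in> set groups" for g using set_groups[OF that] .
      show "cancel L \<subseteq> Omega" for L unfolding cancel_def by auto
      show "(\<Sum>\<eta>\<in>Pow {..<s}. blocks.labels L \<eta> \<omega>) = (if \<omega> \<in> cancel L then 2 ^ s else 0)"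
        if "\<omega> \<in> Omega" for L \<omega>
        using that unfolding sum_labels cancel_def by simp
      show "C L \<subseteq> {..<?d}" for L by (rule C)
      show "C L \<inter> C L' = {}" if "L \<noteq> L'" for L L' by (rule C_disj[OF that])
    qed
    then show ?thesis unfolding length_groups choices_def .
  qed
  have one: "1 \<le> 100 * T * (\<Sum>t<T. \<Sum>k'\<in>C L. (cmod (F t k' \<omega>))\<^sup>2)" if L: "L \<in> choices" and \<omega>: "\<omega> \<in> good L" for L \<omega>
  proof -
    have "fn (filled_word L \<omega>)" using valid_filled_word[OF L \<omega>] unfolding fn_def by blast
    then have "1 \<le> 100 * T * (\<Sum>t<T. \<Sum>k'\<in>run.differ (empty_word \<omega>) (filled_word L \<omega>). (cmod (F t k' \<omega>))\<^sup>2)"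
      unfolding F_def
      using out[of "empty_word \<omega>"] out[of "filled_word L \<omega>"] not_fn_empty_word[of \<omega>]
      by (intro run.sum_differ_amp_ge[where v = False and A = Acc]) (auto simp: empty_word_def filled_word_def word_cube)
    also have "\<dots> \<le> 100 * T * (\<Sum>t<T. \<Sum>k'\<in>C L. (cmod (F t k' \<omega>))\<^sup>2)"
    proof (intro mult_left_mono sum_mono sum_mono2)
      show "finite (C L)" using C finite_subset by blast
      show "run.differ (empty_word \<omega>) (filled_word L \<omega>) \<subseteq> C L"
      proof
        fix k' assume "k' \<in> run.differ (empty_word \<omega>) (filled_word L \<omega>)"
        then have k': "k' < ?d" "query_index n_vars k' < n_vars"
          "empty_word \<omega> ! query_index n_vars k' \<noteq> filled_word L \<omega> ! query_index n_vars k'"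
          unfolding run.differ_def by auto
        then show "k' \<in> C L"
          unfolding C_def empty_word_def filled_word_def word_nth[OF k'(2)] unfolding content_def by auto
      qed
    qed auto
    finally show ?thesis .
  qed
  have "N ^ k * card Omega = (\<Sum>L\<in>choices. card Omega)" by (simp add: card_choices)
  also have "\<dots> \<le> (\<Sum>L\<in>choices. 2 * 2 ^ s * card (good L))"
    using card_good_ge by (intro sum_mono) auto
  finally have "real (N ^ k * card Omega) \<le> real (\<Sum>L\<in>choices. 2 * 2 ^ s * card (good L))"
    by (rule of_nat_mono)
  also have "\<dots> = 2 * 2 ^ s * (\<Sum>L\<in>choices. \<Sum>\<omega>\<in>good L. 1)"
    by (simp add: sum_distrib_left)
  also have "(\<Sum>L\<in>choices. \<Sum>\<omega>\<in>good L. 1)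
      \<le> (\<Sum>L\<in>choices. \<Sum>\<omega>\<in>cancel L. 100 * T * (\<Sum>t<T. \<Sum>k'\<in>C L. (cmod (F t k' \<omega>))\<^sup>2))"
  proof (intro sum_mono)
    fix L assume L: "L \<in> choices"
    have "(\<Sum>\<omega>\<in>good L. 1) \<le> (\<Sum>\<omega>\<in>good L. 100 * T * (\<Sum>t<T. \<Sum>k'\<in>C L. (cmod (F t k' \<omega>))\<^sup>2))"
      using one[OF L] by (intro sum_mono)
    also have "\<dots> \<le> (\<Sum>\<omega>\<in>cancel L. 100 * T * (\<Sum>t<T. \<Sum>k'\<in>C L. (cmod (F t k' \<omega>))\<^sup>2))"
      using finite_Omega by (intro sum_mono2) (auto simp: good_def cancel_def intro!: mult_nonneg_nonneg sum_nonneg)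
    finally show "(\<Sum>\<omega>\<in>good L. 1) \<le> (\<Sum>\<omega>\<in>cancel L. 100 * T * (\<Sum>t<T. \<Sum>k'\<in>C L. (cmod (F t k' \<omega>))\<^sup>2))" .
  qed
  also have "\<dots> = 100 * T * (\<Sum>t<T. \<Sum>L\<in>choices. \<Sum>k'\<in>C L. sqn (cancel L) (F t k'))"
  proof -
    have "(\<Sum>L\<in>choices. \<Sum>\<omega>\<in>cancel L. \<Sum>t<T. \<Sum>k'\<in>C L. (cmod (F t k' \<omega>))\<^sup>2)
        = (\<Sum>L\<in>choices. \<Sum>t<T. \<Sum>\<omega>\<in>cancel L. \<Sum>k'\<in>C L. (cmod (F t k' \<omega>))\<^sup>2)"
      by (rule sum.cong[OF refl], rule sum.swap)
    also have "\<dots> = (\<Sum>t<T. \<Sum>L\<in>choices. \<Sum>\<omega>\<in>cancel L. \<Sum>k'\<in>C L. (cmod (F t k' \<omega>))\<^sup>2)"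
      by (rule sum.swap)
    also have "\<dots> = (\<Sum>t<T. \<Sum>L\<in>choices. \<Sum>k'\<in>C L. sqn (cancel L) (F t k'))"
      unfolding sqn_def by (rule sum.cong[OF refl], rule sum.cong[OF refl], rule sum.swap)
    finally show ?thesis by (simp only: sum_distrib_left[symmetric])
  qed
  also have "(\<Sum>t<T. \<Sum>L\<in>choices. \<Sum>k'\<in>C L. sqn (cancel L) (F t k')) \<le> (\<Sum>t<T. ?X)"
    using mass by (intro sum_mono) auto
  also have "(\<Sum>t<T. ?X) = T * ?X" by simp
  finally have "N ^ k * card Omega \<le> 2 * 2 ^ s * (100 * T * (T * ?X))"
    by (simp add: mult_left_mono)
  then have "N ^ k * card Omega \<le> 200 * real T ^ 2 *
    (2 + 8 * real T ^ 2 * N ^ k * (1 / (y * N)) ^ (h - 1) * blocks.rate ^ T) * card Omega"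
    by (simp add: power2_eq_square)
  then show ?thesis using card_Omega_pos by simp
qed

lemma UC1_ge_card_blocks: "k * N \<le> UC1 n_vars fn"
proof -
  have "0 < card choices" using N_pos by (simp add: card_choices)
  then obtain L where L: "L \<in> choices" by (metis card_gt_0_iff ex_in_conv)
  have "0 < 2 * 2 ^ s * card (good L)" using card_Omega_pos card_good_ge[OF L] by (rule less_le_trans)
  then have "0 < card (good L)" by simp
  then obtain \<omega> where "\<omega> \<in> good L" by (metis card_gt_0_iff ex_in_conv)
  then show ?thesis by (rule UC1_ge[OF L])
qed

end

section \<open>Choice of the parameters\<close>

text \<open>From 21 on, \<open>8 * a + 21\<close> is at most \<open>9 * a\<close>, as the estimate
  of the width requires; also \<open>a - 6\<close> is a true subtraction.\<close>

locale hard_sequence =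
  fixes a :: nat
  assumes a_ge: "21 \<le> a"
begin

text \<open>This is 2 * h + 1 for the cut-off h = 4 * a + 10, chosen so that 4^-(h - 1) = N^-8 / 4^9
  for N = 2^a.\<close>

abbreviation "K \<equiv> 8 * a + 21"

lemma pow4: "(4::real) ^ (4 * a) = (2 ^ a) ^ 8"
proof -
  have "(4::real) ^ (4 * a) = (2 ^ 2) ^ (4 * a)" by simp
  also have "\<dots> = 2 ^ (2 * (4 * a))" by (rule power_mult[symmetric])
  also have "\<dots> = (2 ^ a) ^ 8" by (simp add: power_mult[symmetric] mult.commute)
  finally show ?thesis .
qed

lemma R_eq: "real (2 ^ (a - 6)) = 2 ^ a / 64"
proof -
  have "(2::real) ^ a = 2 ^ (a - 6) * 2 ^ 6" using a_ge by (subst power_add[symmetric]) simp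
  then show ?thesis by simp
qed

lemma two_pow_ge: "2097152 \<le> (2::real) ^ a"
  using power_increasing[OF a_ge, of "2::real"] by simp

text \<open>The value of \<open>eps\<close> turns the condition \<open>eps_ge\<close> into an equality, and \<open>y / R = 256 / N\<^sup>2\<close>.\<close>

sublocale hard_instance K "2 ^ a" "K * (a + 1)" "4 * a + 10" "2 ^ (a - 6)" "(1 / 4) ^ (4 * a + 8)" "4 / 2 ^ a"
  "a * K * K * 2 ^ a + 1"
proof unfold_locales
  show "2 * 2 ^ K * (real (2 ^ (a - 6)) / real (2 ^ a)) ^ (4 * a + 10 - 1) \<le> ((1 / 4) ^ (4 * a + 8))\<^sup>2"
  proof -
    let ?m = "4 * a + 8"
    have "(2::real) ^ K = 2 ^ (2 * ?m + 5)" by simp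
    also have "\<dots> = 4 ^ ?m * 32" unfolding power_add power_mult by simp
    finally have 1: "(2::real) ^ K = 4 ^ ?m * 32" .
    have 2: "real (2 ^ (a - 6)) / real (2 ^ a) = 1 / 64" unfolding R_eq by simp
    have 3: "(1 / 64 :: real) ^ (4 * a + 10 - 1) = (1 / 64) ^ ?m * (1 / 64)"
      unfolding power_Suc2[symmetric] by (rule arg_cong) simp
    have 4: "2 * ((4::real) ^ ?m * 32) * ((1 / 64) ^ ?m * (1 / 64)) = (4 * (1 / 64)) ^ ?m"
      unfolding power_mult_distrib by (simp add: power_one_over)
    have 5: "((1 / 4 :: real) ^ ?m)\<^sup>2 = (4 * (1 / 64)) ^ ?m"
      by (simp add: power2_eq_square power_mult_distrib[symmetric])
    show ?thesis unfolding 1 2 3 4 5 by (rule order_refl)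
  qed
  show "2 * (1 + K) * (2 ^ a) ^ K \<le> 2 ^ (K * (a + 1))"
  proof -
    have "2 * (1 + m) \<le> (2::nat) ^ m" if "3 \<le> m" for m
      using that by (induction m rule: dec_induct) auto
    from this[of K] have "2 * (1 + K) * (2 ^ a) ^ K \<le> (2::nat) ^ K * (2 ^ a) ^ K"
      by (intro mult_right_mono) auto
    also have "\<dots> = 2 ^ (K * (a + 1))"
      by (simp only: power_mult[symmetric] power_add[symmetric]) (simp add: algebra_simps)
    finally show ?thesis .
  qed
  \<comment> \<open>The exponents of 2 differ by exactly the \<open>+ 1\<close> in the length of the
    advice.\<close>
  show "((2 ^ a) ^ K) ^ (K * 2 ^ a) < (2::nat) ^ (a * K * K * 2 ^ a + 1)"
    by (simp only: power_mult[symmetric] mult.assoc) simp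
  show "(1 / 4 :: real) ^ (4 * a + 8) \<le> 1" by (rule power_le_one) auto
qed auto

text \<open>With y / R = 256 / N^2 and at most 1 / N^2 contributed by \<open>eps\<close>, the rate
  is at most exp (257 / N^2); over N^2 / 256 queries its power stays below exp 2, hence below
  9.\<close>

lemma rate_power_le:
  assumes "real T \<le> (2 ^ a)\<^sup>2 / 256"
  shows "blocks.rate ^ T \<le> 9"
proof -
  let ?X = "(2::real) ^ a"
  have "(1 / 4 :: real) ^ (4 * a + 8) = 1 / (?X ^ 8 * 65536)"
    unfolding power_add pow4[symmetric] by (simp add: power_one_over)
  also have "\<dots> \<le> 1 / (?X\<^sup>2 * 3)"
    using two_pow_ge by (intro divide_left_mono mult_mono power_increasing) auto
  finally have eps: "(1 / 4 :: real) ^ (4 * a + 8) \<le> 1 / (?X\<^sup>2 * 3)" .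
  have "1 + 2 * (4 / ?X) \<le> 3" using two_pow_ge by (simp add: field_simps)
  then have "(1 / 4) ^ (4 * a + 8) * (1 + 2 * (4 / ?X)) \<le> 1 / (?X\<^sup>2 * 3) * 3"
    by (intro mult_mono eps) auto
  also have "\<dots> = 1 / ?X\<^sup>2" by simp
  finally have "blocks.rate \<le> 1 + 4 / ?X / (?X / 64) + 1 / ?X\<^sup>2"
    unfolding blocks.rate_def R_eq by linarith
  also have "\<dots> = 1 + 257 / ?X\<^sup>2" by (simp add: power2_eq_square add_divide_distrib[symmetric])
  also have "\<dots> \<le> exp (257 / ?X\<^sup>2)" by (rule exp_ge_add_one_self)
  finally have "blocks.rate ^ T \<le> exp (257 / ?X\<^sup>2) ^ T"
    using blocks.rate_ge_1 by (intro power_mono) auto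
  also have "\<dots> = exp (T * (257 / ?X\<^sup>2))" by (rule exp_of_nat_mult[symmetric])
  also have "\<dots> \<le> exp (2 * 1)"
  proof (subst exp_le_cancel_iff)
    have "T * (257 / ?X\<^sup>2) \<le> ?X\<^sup>2 / 256 * (257 / ?X\<^sup>2)"
      by (rule mult_right_mono[OF assms]) simp
    also have "\<dots> \<le> 2 * 1" by simp
    finally show "T * (257 / ?X\<^sup>2) \<le> 2 * 1" .
  qed
  also have "\<dots> = exp 1 ^ 2" by (simp add: exp_of_nat_mult[of 2, symmetric])
  also have "\<dots> \<le> 3 ^ 2" using exp_le by (intro power_mono) auto
  finally show ?thesis by simp
qed

text \<open>The factor 4^-(h - 1) = 1 / (N^8 * 4^9) meets T^4 <= N^8 / 2^32, so the leakage term of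
  \<open>query_bound\<close> is a small fraction of N^K. The main term 400 * T^2 is at most N^K /
  100, and the two cannot add up to N^K.\<close>

lemma computable_ge:
  assumes "quantum_computable_with n_vars fn T"
  shows "(2 ^ a)\<^sup>2 / 256 \<le> real T"
proof (rule ccontr)
  assume "\<not> ?thesis"
  then have T: "real T \<le> (2 ^ a)\<^sup>2 / 256" by simp
  let ?X = "(2::real) ^ a"
  have X: "1 \<le> ?X" using two_pow_ge by linarith
  have T2: "real T ^ 2 \<le> ?X ^ 4 / 65536"
    using power_mono[OF T, of 2] by (simp add: power_divide power2_eq_square power4_eq_xxxx)
  have T4: "real T ^ 2 * real T ^ 2 \<le> ?X ^ 8 / 4294967296"
    using mult_mono[OF T2 T2] by (simp add: power_add[symmetric])
  have q: "(1 / (4 / ?X * real (2 ^ a))) ^ (4 * a + 10 - 1) = 1 / (?X ^ 8 * 262144)"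
  proof -
    have "4 / ?X * real (2 ^ a) = 4" by simp
    moreover have "(1 / 4 :: real) ^ (4 * a + 10 - 1) = (1 / 4) ^ (4 * a) * (1 / 4) ^ 9"
      unfolding power_add[symmetric] by (rule arg_cong) simp
    ultimately show ?thesis unfolding pow4[symmetric] by (simp add: power_one_over)
  qed
  have "?X ^ 4 * 1 \<le> ?X ^ K" using X by (simp add: power_increasing)
  moreover have "0 \<le> ?X ^ 4" by simp
  ultimately have low: "400 * real T ^ 2 \<le> ?X ^ K / 100" using T2 by linarith
  have "?X ^ K \<le> 200 * real T ^ 2 * (2 + 8 * real T ^ 2 * ?X ^ K * (1 / (?X ^ 8 * 262144)) * blocks.rate ^ T)"
    using query_bound[OF assms] unfolding q by simp
  also have "\<dots> \<le> 200 * real T ^ 2 * (2 + 8 * real T ^ 2 * ?X ^ K * (1 / (?X ^ 8 * 262144)) * 9)"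
    by (intro mult_left_mono add_left_mono rate_power_le[OF T]) auto
  also have "\<dots> = 400 * real T ^ 2 + (real T ^ 2 * real T ^ 2) * (?X ^ K * (14400 / (?X ^ 8 * 262144)))"
    by (simp add: field_simps)
  also have "\<dots> \<le> ?X ^ K / 100 + ?X ^ 8 / 4294967296 * (?X ^ K * (14400 / (?X ^ 8 * 262144)))"
    by (intro add_mono low mult_right_mono T4) auto
  also have "\<dots> = ?X ^ K / 100 + ?X ^ K * (14400 / (4294967296 * 262144))"
    by simp
  finally have "?X ^ K \<le> ?X ^ K / 100 + ?X ^ K * (14400 / (4294967296 * 262144))" .
  moreover have "0 < ?X ^ K" by simp
  ultimately show False by simp
qed

lemma quantum_query_complexity_ge: "(2 ^ a)\<^sup>2 / 256 \<le> real (quantum_query_complexity n_vars fn)"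
  unfolding quantum_query_complexity_def
  by (rule computable_ge[OF LeastI_ex[OF ex_quantum_computable]])

lemma UC1_ge_pow: "2 ^ a \<le> UC1 n_vars fn"
  using UC1_ge_card_blocks by (rule order_trans[rotated]) simp

text \<open>With K <= 9 * a and a + 1 <= 2 * a the width is at most (81 * 73 + 1) * a^4 * N, where
  72 of the 73 come from the cells read and 1 from the advice.\<close>

lemma UC1_le_pow: "real (UC1 n_vars fn) \<le> 6000 * real a ^ 4 * 2 ^ a"
proof -
  let ?X = "(2::real) ^ a"
  have a1: "1 \<le> real a" using a_ge by simp
  have "real (UC1 n_vars fn) \<le> real width_bound" using UC1_le by (rule of_nat_mono)
  also have "\<dots> = real K ^ 2 * ?X * (real a + 4 * real K * (real a + 1)) + 1"
    unfolding width_bound_def by (simp add: algebra_simps power2_eq_square)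
  also have "\<dots> \<le> (9 * real a) ^ 2 * ?X * (real a * real a + 4 * (9 * real a) * (2 * real a)) + real a ^ 4 * ?X"
  proof (intro add_mono mult_mono power_mono)
    show "real a \<le> real a * real a" using a1 by simp
    show "1 \<le> real a ^ 4 * ?X"
      using mult_mono[of 1 "real a ^ 4" 1 ?X] a1 two_pow_ge by (simp add: one_le_power)
  qed (use a_ge in auto)
  also have "\<dots> = 5914 * real a ^ 4 * ?X" by (simp add: power2_eq_square power4_eq_xxxx algebra_simps)
  also have "\<dots> \<le> 6000 * real a ^ 4 * ?X" by (intro mult_right_mono) auto
  finally show ?thesis .
qed

text \<open>Squaring \<open>UC1_le_pow\<close> costs 6000^2 * a^8, and \<open>a\<close> is at most
  the logarithm of \<open>UC1\<close> by \<open>UC1_ge_pow\<close>. The constant \<open>c\<close>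
  collects the factors 256 and 6000^2, and as an exponent it exceeds 8.\<close>

lemma query_complexity_ge_UC1:
  assumes c: "(c::real) = 256 * 6000 ^ 2"
  shows "(real (UC1 n_vars fn))\<^sup>2 / (c * log 2 (real (UC1 n_vars fn)) powr c)
    \<le> real (quantum_query_complexity n_vars fn)"
proof -
  let ?X = "(2::real) ^ a" and ?u = "real (UC1 n_vars fn)"
  have a1: "1 \<le> real a" using a_ge by simp
  have X: "?X \<le> ?u" using of_nat_mono[OF UC1_ge_pow, where 'a = real] by simp
  have u: "0 < ?u" using X two_pow_ge by linarith
  have "real a \<le> log 2 ?u" using X u by (simp add: le_log_iff powr_realpow)
  then have "real a powr c \<le> log 2 ?u powr c" using c by (intro powr_mono2) auto
  moreover have "real a ^ 8 \<le> real a powr c"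
    using powr_mono[of 8 c "real a"] a1 c powr_realpow[of "real a" 8] by simp
  ultimately have a8: "real a ^ 8 \<le> log 2 ?u powr c" by linarith
  have c0: "0 < c" and a80: "0 < real a ^ 8" using c a1 by simp_all
  have "?u\<^sup>2 / (c * log 2 ?u powr c) \<le> (6000 * real a ^ 4 * ?X)\<^sup>2 / (c * real a ^ 8)"
    using UC1_le_pow a8 c0 a80 by (intro frac_le power_mono mult_left_mono mult_pos_pos) auto
  also have "\<dots> = ?X\<^sup>2 / 256"
    using a1 unfolding c power_mult_distrib by (simp add: power_mult[symmetric])
  also have "\<dots> \<le> real (quantum_query_complexity n_vars fn)" by (rule quantum_query_complexity_ge)
  finally show ?thesis .
qed

end

theorem theorem5:
  shows "\<exists>(n :: nat \<Rightarrow> nat) (f :: nat \<Rightarrow> bool list \<Rightarrow> bool).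
    filterlim (\<lambda>j. UC1 (n j) (f j)) at_top sequentially \<and>
    (\<exists>c::real. c > 0 \<and>
      (\<forall>\<^sub>F j in sequentially.
        real (quantum_query_complexity (n j) (f j)) \<ge>
          (real (UC1 (n j) (f j)))\<^sup>2 / (c * (log 2 (real (UC1 (n j) (f j)))) powr c)))"
proof -
  \<comment> \<open>The shift of the index meets \<open>a_ge\<close>.\<close>
  have inst: "hard_sequence (j + 21)" for j by unfold_locales simp
  have "\<exists>n f. 2 ^ (j + 21) \<le> UC1 n f \<and>
    (real (UC1 n f))\<^sup>2 / (256 * 6000 ^ 2 * log 2 (real (UC1 n f)) powr (256 * 6000 ^ 2))
      \<le> real (quantum_query_complexity n f)" for j
    using hard_sequence.UC1_ge_pow[OF inst] hard_sequence.query_complexity_ge_UC1[OF inst refl] by blast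
  then obtain n f where *: "2 ^ (j + 21) \<le> UC1 (n j) (f j)"
    "(real (UC1 (n j) (f j)))\<^sup>2 / (256 * 6000 ^ 2 * log 2 (real (UC1 (n j) (f j))) powr (256 * 6000 ^ 2))
      \<le> real (quantum_query_complexity (n j) (f j))" for j
    by metis
  have "j \<le> UC1 (n j) (f j)" for j
  proof -
    have "j < 2 ^ j" by (rule less_exp)
    also have "\<dots> \<le> (2::nat) ^ (j + 21)" by (rule power_increasing) auto
    finally show ?thesis using *(1)[of j] by linarith
  qed
  then have "filterlim (\<lambda>j. UC1 (n j) (f j)) at_top sequentially"
    by (intro filterlim_at_top_mono[OF filterlim_ident]) auto
  moreover have "\<exists>c::real. c > 0 \<and> (\<forall>\<^sub>F j in sequentially.
        real (quantum_query_complexity (n j) (f j)) \<ge>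
          (real (UC1 (n j) (f j)))\<^sup>2 / (c * (log 2 (real (UC1 (n j) (f j)))) powr c))"
    using *(2) by (intro exI[of _ "256 * 6000 ^ 2"] conjI always_eventually allI) auto
  ultimately show ?thesis by blast
qed

end
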